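(* Let $q,m_{1},m_{2},m_{3},a,b,c\in\mathbb{N}$ with $q\ge2$, $m_{3}\geq2$, $m_{1}+m_{2}\equiv m_{3}\pmod 2$ and $(a,q)=(b,q)=(c,q)=1$. Then \begin{align*} &V_{\chi_{1},\chi_{2},q}(m_{1},m_{2},m_{3};a,b,c)\\ &=\frac{(-1)^{\frac{m_{1}-m_{2}-m_{3}}{2}}(2\pi)^{m_{1}+m_{2}+m_{3}}(b,c)^{m_{2}+m_{3}}\phi(q)^{2}}{8q^{m_{1}+m_{2}+m_{3}}b^{m_{3}}c^{m_{2}}m_{1}!(m_{2}+m_{3})!}\Bigl(R\bigl(m_{1},m_{2}+m_{3},q;a,\tfrac{bc}{(b,c)}\bigr)+R\bigl(m_{2}+m_{3},m_{1},q;\tfrac{bc}{(b,c)},a\bigr)\Bigr)\\ &\quad-\frac{(-1)^{\frac{m_{1}+m_{2}-m_{3}}{2}}(2\pi)^{m_{1}+m_{2}+m_{3}}\phi(q)^{2}}{8q^{m_{1}+m_{2}+m_{3}}m_{1}!m_{2}!m_{3}!}\Bigl(A_{m_{1},m_{2},m_{3},q}(a,b,c)+(-1)^{m_{1}}A_{m_{1},m_{3},m_{2},q}(a,c,b)\\ &\qquad+B_{m_{1},m_{2},m_{3},q}(a,b,c)+(-1)^{m_{1}}B_{m_{1},m_{3},m_{2},q}(a,c,b)+C_{m_{1},m_{2},m_{3},q}(a,b,c)+(-1)^{m_{1}}C_{m_{1},m_{3},m_{2},q}(a,c,b)\\ &\qquad-D_{m_{1},m_{2},m_{3},q}(b,c)+D_{m_{1},m_{3},m_{2},q}(c,b)+C_{2}\Bigr),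 \end{align*} where, for positive integers $m,n,q,a,b$, \[R(m,n,q;a,b)=nb^{n-1}\sum_{j=0}^{m}\binom{m}{j}\frac{(-1)^{j}a^{m-j}}{m+n-j}\sum_{l=1}^{b}\overline{B}_{j}\Bigl(\frac{al}{b}\Bigr)\sum_{d\mid q}\mu\Bigl(\frac{q}{d}\Bigr)d^{j}\,\overline{B}_{m+n-j}\Bigl(\frac{dl}{b}\Bigr),\] and, for positive integers $m_1,m_2,m_3,q,a,b,c$ (the quantities with permuted indices/arguments being obtained by the corresponding substitution), \begin{align*} A_{m_{1},m_{2},m_{3},q}(a,b,c)&=m_{3}b^{m_{2}-1}c^{m_{3}-1}\sum_{j=1}^{m_{2}}\binom{m_{2}}{j}\frac{(-1)^{j}j}{m_{2}+m_{3}-j}\sum_{j_{1}=0}^{m_{1}}\binom{m_{1}}{j_{1}}\frac{(-1)^{j_{1}}a^{m_{1}-j_{1}}}{m_{1}+j-j_{1}}\\ &\quad\times\sum_{l=1}^{c}\sum_{l_{1}=1}^{b}\overline{B}_{j_{1}}\Bigl(\frac{al_{1}}{b}+\frac{al}{c}\Bigr)\sum_{d\mid q}\mu\Bigl(\frac{q}{d}\Bigr)d^{j_{1}}\,\overline{B}_{m_{2}+m_{3}-j}\Bigl(\frac{dl}{c}\Bigr)\overline{B}_{m_{1}+j-j_{1}}\Bigl(\frac{dl_{1}}{b}+\frac{dl}{c}\Bigr), \end{align*} \begin{align*} B_{m_{1},m_{2},m_{3},q}(a,b,c)&=m_{1}m_{2}a^{m_{1}-1}b^{m_{2}-1}\sum_{j=1}^{m_{3}}\binom{m_{3}}{j}\frac{1}{m_{2}+m_{3}-j}\sum_{j_{1}=0}^{j}\binom{j}{j_{1}}\frac{(-1)^{j_{1}}c^{m_{3}-j_{1}}}{m_{1}+j-j_{1}}\\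 &\quad\times\sum_{l=1}^{b}\sum_{l_{1}=1}^{a}\overline{B}_{j_{1}}\Bigl(\frac{cl_{1}}{a}+\frac{cl}{b}\Bigr)\sum_{d\mid q}\mu\Bigl(\frac{q}{d}\Bigr)d^{j_{1}}\,\overline{B}_{m_{2}+m_{3}-j}\Bigl(\frac{dl}{b}\Bigr)\overline{B}_{m_{1}+j-j_{1}}\Bigl(\frac{dl_{1}}{a}\Bigr), \end{align*} \begin{align*} C_{m_{1},m_{2},m_{3},q}(a,b,c)&=-\frac{m_{2}\,m_{1}!\,b^{m_{2}-1}(a,c)^{m_{1}}}{c^{m_{1}}}\sum_{j=1}^{m_{3}}\binom{m_{3}}{j}\frac{(-1)^{j}(a,c)^{j}c^{m_{3}-j}j!}{a^{j}(m_{2}+m_{3}-j)(m_{1}+j)!}\\ &\quad\times\sum_{l=1}^{b}\overline{B}_{m_{1}+j}\Bigl(\frac{ac\,l}{(a,c)\,b}\Bigr)\sum_{d\mid q}\mu\Bigl(\frac{q}{d}\Bigr)d^{m_{1}+j}\,\overline{B}_{m_{2}+m_{3}-j}\Bigl(\frac{dl}{b}\Bigr), \end{align*} \[D_{m_{1},m_{2},m_{3},q}(b,c)=\frac{\delta_{1,m_{1}}m_{2}m_{3}b^{m_{2}-1}c^{m_{3}-1}}{4(m_{2}+m_{3}-1)}\sum_{d\mid q}\mu\Bigl(\frac{q}{d}\Bigr)d^{m_{1}}\sum_{l=1}^{b}\overline{B}_{m_{2}+m_{3}-1}\Bigl(\frac{dl}{b}\Bigr)\delta_{\mathbb{Z}}\Bigl(\frac{cl}{b}\Bigr),\]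 \[C_{2}=\frac{(-1)^{m_{1}+m_{2}}m_{1}!\,m_{2}!\,m_{3}!\,\bigl(a(b,c),bc\bigr)^{m_{1}+m_{2}+m_{3}}B_{m_{1}+m_{2}+m_{3}}J_{m_{1}+m_{2}+m_{3}}(q)}{a^{m_{2}+m_{3}}b^{m_{1}+m_{3}}c^{m_{1}+m_{2}}(m_{1}+m_{2}+m_{3})!}.\]
   Context: For $q\in\mathbb{N}$ and Dirichlet characters $\chi$ modulo $q$, $L(s,\chi)=\sum_{n\ge1}\chi(n)n^{-s}$, and $\overline{\chi}$ denotes complex conjugation. For $m_1,m_2,m_3\in\mathbb{N}$ and integers $a,b,c$, \[V_{\chi_{1},\chi_{2},q}(m_{1},m_{2},m_{3};a,b,c)=\sum_{\substack{\chi_{1},\chi_{2}\bmod q\\ \chi_{1}(-1)=(-1)^{m_{1}},\ \chi_{2}(-1)=(-1)^{m_{2}}}}\chi_{1}(a)\chi_{2}(b)\overline{\chi_{1}\chi_{2}}(c)L(m_{1},\chi_{1})L(m_{2},\chi_{2})L(m_{3},\overline{\chi_{1}\chi_{2}}).\] $\phi$ is Euler's totient function, $\mu$ the Möbius function, $(x,y)$ the greatest common divisor, and for $\alpha\in\mathbb{C}$, $J_{\alpha}(q)=q^{\alpha}\prod_{p\mid q,\ p\text{ prime}}(1-p^{-\alpha})$. $\delta_{m,n}$ is the Kronecker delta, and $\delta_{\mathbb{Z}}(x)=1$ if $x\in\mathbb{Z}$, $0$ otherwise. $B_n(x)$ is the $n$-th Bernoulli polynomial and $B_n=B_n(0)$.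 The Bernoulli functions are $\overline{B}_0(x)=1$; $\overline{B}_1(x)=0$ if $x\in\mathbb{Z}$ and $\overline{B}_1(x)=B_1(\{x\})$ otherwise; $\overline{B}_n(x)=B_n(\{x\})$ for $n\ge2$, where $\{x\}$ is the fractional part of $x$. *)

theory Defs
  imports "HOL-Analysis.Analysis" "HOL-Number_Theory.Number_Theory"
    "HOL-Computational_Algebra.Squarefree"
begin

text \<open>Characters are functions on the integers, so that \<open>chi (-1)\<close> makes sense.\<close>

definition dchars :: "nat \<Rightarrow> (int \<Rightarrow> complex) set" where
  "dchars q = {chi. (\<forall>x. chi (x + int q) = chi x) \<and> (\<forall>x y. chi (x * y) = chi x * chi y) \<and>
                   (\<forall>x. chi x \<noteq> 0 \<longleftrightarrow> coprime x (int q))}"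

text \<open>The series is summed in the natural order; for \<open>s = 1\<close> and non-principal \<open>chi\<close> it converges
  only conditionally.\<close>

definition dirichlet_L :: "complex \<Rightarrow> (int \<Rightarrow> complex) \<Rightarrow> complex" where
  "dirichlet_L s chi = (\<Sum>n. chi (int (Suc n)) * of_nat (Suc n) powr (-s))"

definition V :: "nat \<Rightarrow> nat \<Rightarrow> nat \<Rightarrow> nat \<Rightarrow> int \<Rightarrow> int \<Rightarrow> int \<Rightarrow> complex" where
  "V q m1 m2 m3 a b c =
     (\<Sum>chi1 \<in> {chi \<in> dchars q. chi (-1) = (-1) ^ m1}. \<Sum>chi2 \<in> {chi \<in> dchars q. chi (-1) = (-1) ^ m2}.
        chi1 a * chi2 b * cnj (chi1 c * chi2 c) *
        dirichlet_L (of_nat m1) chi1 * dirichlet_L (of_nat m2) chi2 *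
        dirichlet_L (of_nat m3) (\<lambda>n. cnj (chi1 n * chi2 n)))"

text \<open>The sums in the definition of \<open>V\<close> range over finite sets.\<close>

lemma dchars_mod:
  assumes "chi \<in> dchars q"
  shows "chi (x mod int q) = chi x"
proof -
  have per: "chi (y + int q) = chi y" for y
    using assms by (auto simp: dchars_def)
  have pos: "chi (y + int k * int q) = chi y" for y k
  proof (induction k)
    case (Suc k)
    have "y + int (Suc k) * int q = (y + int k * int q) + int q"
      by (simp add: algebra_simps)
    then show ?case using per[of "y + int k * int q"] Suc by metis
  qed auto
  have all: "chi (y + k * int q) = chi y" for y k
  proof (cases "k \<ge> 0")
    case True
    then show ?thesis using pos[of y "nat k"] by simp
  next
    case False
    then show ?thesis using pos[of "y + k * int q" "nat (-k)"] by simp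
  qed
  show ?thesis
    using all[of "x mod int q" "x div int q"] by simp
qed

lemma finite_dchars:
  assumes "q > 0"
  shows "finite (dchars q)"
proof -
  define T where "T = insert 0 {z :: complex. z ^ totient q = 1}"
  have fin: "finite ({0..<q} \<rightarrow>\<^sub>E T)"
    unfolding T_def using assms
    by (intro finite_PiE) (auto intro!: finite_roots_unity Suc_leI)
  have inj: "inj_on (\<lambda>chi. restrict (\<lambda>n. chi (int n)) {0..<q}) (dchars q)"
  proof (rule inj_onI)
    fix chi psi assume A: "chi \<in> dchars q" "psi \<in> dchars q"
      and eq: "restrict (\<lambda>n. chi (int n)) {0..<q} = restrict (\<lambda>n. psi (int n)) {0..<q}"
    show "chi = psi"
    proof
      fix x :: int
      define n where "n = nat (x mod int q)"
      have n: "n < q" "int n = x mod int q"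
        using assms by (auto simp: n_def nat_less_iff)
      have "chi (int n) = psi (int n)"
        using fun_cong[OF eq, of n] n(1) by simp
      then show "chi x = psi x"
        using dchars_mod[OF A(1), of x] dchars_mod[OF A(2), of x] n(2) by simp
    qed
  qed
  have sub: "(\<lambda>chi. restrict (\<lambda>n. chi (int n)) {0..<q}) ` dchars q \<subseteq> ({0..<q} \<rightarrow>\<^sub>E T)"
  proof safe
    fix chi :: "int \<Rightarrow> complex" and n assume A: "chi \<in> dchars q"
    have mult: "chi (x * y) = chi x * chi y" for x y
      using A by (auto simp: dchars_def)
    have nz: "chi x \<noteq> 0 \<longleftrightarrow> coprime x (int q)" for x
      using A by (auto simp: dchars_def)
    have "chi 1 * chi 1 = chi 1" "chi 1 \<noteq> 0"
      using mult[of 1 1] nz[of 1] by auto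
    then have one: "chi 1 = 1" by simp
    have pow: "chi (x ^ k) = chi x ^ k" for x k
      by (induction k) (auto simp: one mult)
    have "chi (int n) \<in> T"
    proof (cases "coprime n q")
      case True
      then have "[n ^ totient q = 1] (mod q)" by (rule euler_theorem)
      then have "int n ^ totient q mod int q = 1 mod int q"
        by (metis cong_def of_nat_1 of_nat_power zmod_int)
      then have "chi (int n) ^ totient q = 1"
        using dchars_mod[OF A, of "int n ^ totient q"] dchars_mod[OF A, of 1] one pow by metis
      then show ?thesis by (simp add: T_def)
    next
      case False
      then show ?thesis using nz[of "int n"] by (simp add: T_def)
    qed
    then show "restrict (\<lambda>n. chi (int n)) {0..<q} n \<in> T" if "n \<in> {0..<q}"
      using that by simp
  qed auto
  show ?thesis
    by (rule finite_imageD[OF finite_subset[OF sub fin] inj])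
qed

definition moebius :: "nat \<Rightarrow> int" where
  "moebius n = (if squarefree n then (-1) ^ card (prime_factors n) else 0)"

definition jordan_J :: "complex \<Rightarrow> nat \<Rightarrow> complex" where
  "jordan_J \<alpha> q = of_nat q powr \<alpha> * (\<Prod>p\<in>prime_factors q. 1 - of_nat p powr (-\<alpha>))"

definition kronecker_delta :: "nat \<Rightarrow> nat \<Rightarrow> real" where
  "kronecker_delta m n = (if m = n then 1 else 0)"

definition delta_int :: "real \<Rightarrow> real" where
  "delta_int x = (if x \<in> \<int> then 1 else 0)"

text \<open>Generating function \<open>t * exp (x * t) / (exp t - 1) = (\<Sum>n. B\<^sub>n(x) * t ^ n / n!)\<close>,
  as formal power series in \<open>t\<close>; in particular \<open>B\<^sub>1(x) = x - 1/2\<close>.\<close>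

definition bernoulli_poly :: "nat \<Rightarrow> real \<Rightarrow> real" where
  "bernoulli_poly n x = fact n * fps_nth (fps_X * fps_exp x / (fps_exp 1 - 1)) n"

definition bernoulli_num :: "nat \<Rightarrow> real" where
  "bernoulli_num n = bernoulli_poly n 0"

definition bernoulli_fun :: "nat \<Rightarrow> real \<Rightarrow> real" where
  "bernoulli_fun n x =
     (if n = 0 then 1 else if n = 1 \<and> x \<in> \<int> then 0 else bernoulli_poly n (frac x))"

definition R_term :: "nat \<Rightarrow> nat \<Rightarrow> nat \<Rightarrow> nat \<Rightarrow> nat \<Rightarrow> real" where
  "R_term m n q a b =
     real n * real b ^ (n - 1) *
     (\<Sum>j = 0..m. real (m choose j) * ((-1) ^ j * real a ^ (m - j) / real (m + n - j)) *
        (\<Sum>l = 1..b. bernoulli_fun j (real a * real l / real b) *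
           (\<Sum>d | d dvd q. of_int (moebius (q div d)) * real d ^ j *
              bernoulli_fun (m + n - j) (real d * real l / real b))))"

definition A_term :: "nat \<Rightarrow> nat \<Rightarrow> nat \<Rightarrow> nat \<Rightarrow> nat \<Rightarrow> nat \<Rightarrow> nat \<Rightarrow> real" where
  "A_term m1 m2 m3 q a b c =
     real m3 * real b ^ (m2 - 1) * real c ^ (m3 - 1) *
     (\<Sum>j = 1..m2. real (m2 choose j) * ((-1) ^ j * real j / real (m2 + m3 - j)) *
        (\<Sum>j1 = 0..m1. real (m1 choose j1) *
             ((-1) ^ j1 * real a ^ (m1 - j1) / real (m1 + j - j1)) *
           (\<Sum>l = 1..c. \<Sum>l1 = 1..b.
              bernoulli_fun j1 (real a * real l1 / real b + real a * real l / real c) *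
              (\<Sum>d | d dvd q. of_int (moebius (q div d)) * real d ^ j1 *
                 bernoulli_fun (m2 + m3 - j) (real d * real l / real c) *
                 bernoulli_fun (m1 + j - j1)
                   (real d * real l1 / real b + real d * real l / real c)))))"

definition B_term :: "nat \<Rightarrow> nat \<Rightarrow> nat \<Rightarrow> nat \<Rightarrow> nat \<Rightarrow> nat \<Rightarrow> nat \<Rightarrow> real" where
  "B_term m1 m2 m3 q a b c =
     real m1 * real m2 * real a ^ (m1 - 1) * real b ^ (m2 - 1) *
     (\<Sum>j = 1..m3. real (m3 choose j) * (1 / real (m2 + m3 - j)) *
        (\<Sum>j1 = 0..j. real (j choose j1) *
             ((-1) ^ j1 * real c ^ (m3 - j1) / real (m1 + j - j1)) *
           (\<Sum>l = 1..b. \<Sum>l1 = 1..a.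
              bernoulli_fun j1 (real c * real l1 / real a + real c * real l / real b) *
              (\<Sum>d | d dvd q. of_int (moebius (q div d)) * real d ^ j1 *
                 bernoulli_fun (m2 + m3 - j) (real d * real l / real b) *
                 bernoulli_fun (m1 + j - j1) (real d * real l1 / real a)))))"

definition C_term :: "nat \<Rightarrow> nat \<Rightarrow> nat \<Rightarrow> nat \<Rightarrow> nat \<Rightarrow> nat \<Rightarrow> nat \<Rightarrow> real" where
  "C_term m1 m2 m3 q a b c =
     - (real m2 * fact m1 * real b ^ (m2 - 1) * real (gcd a c) ^ m1 / real c ^ m1) *
     (\<Sum>j = 1..m3. real (m3 choose j) *
          ((-1) ^ j * real (gcd a c) ^ j * real c ^ (m3 - j) * fact j /
             (real a ^ j * real (m2 + m3 - j) * fact (m1 + j))) *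
        (\<Sum>l = 1..b.
           bernoulli_fun (m1 + j) (real a * real c * real l / (real (gcd a c) * real b)) *
           (\<Sum>d | d dvd q. of_int (moebius (q div d)) * real d ^ (m1 + j) *
              bernoulli_fun (m2 + m3 - j) (real d * real l / real b))))"

definition D_term :: "nat \<Rightarrow> nat \<Rightarrow> nat \<Rightarrow> nat \<Rightarrow> nat \<Rightarrow> nat \<Rightarrow> real" where
  "D_term m1 m2 m3 q b c =
     kronecker_delta 1 m1 * real m2 * real m3 * real b ^ (m2 - 1) * real c ^ (m3 - 1) /
       (4 * real (m2 + m3 - 1)) *
     (\<Sum>d | d dvd q. of_int (moebius (q div d)) * real d ^ m1 *
        (\<Sum>l = 1..b. bernoulli_fun (m2 + m3 - 1) (real d * real l / real b) *
           delta_int (real c * real l / real b)))"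

definition C2_term :: "nat \<Rightarrow> nat \<Rightarrow> nat \<Rightarrow> nat \<Rightarrow> nat \<Rightarrow> nat \<Rightarrow> nat \<Rightarrow> complex" where
  "C2_term m1 m2 m3 q a b c =
     (-1) ^ (m1 + m2) * fact m1 * fact m2 * fact m3 *
     of_nat (gcd (a * gcd b c) (b * c)) ^ (m1 + m2 + m3) *
     of_real (bernoulli_num (m1 + m2 + m3)) * jordan_J (of_nat (m1 + m2 + m3)) q /
     (of_nat a ^ (m2 + m3) * of_nat b ^ (m1 + m3) * of_nat c ^ (m1 + m2) * fact (m1 + m2 + m3))"

end

theory Submission
  imports Defs
begin

text \<open>
  The idea is to turn the sum over characters into a finite sum of Bernoulli functions and to
  evaluate that sum by a reciprocity law.

  By the Fourier expansion of the Bernoulli functions, each \<open>L\<close>-value is a finite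
  Fourier transform of a Bernoulli function paired with the character. Orthogonality of characters
  then leaves a sum over the residues coprime to \<open>q\<close>, and Moebius inversion reduces it to
  the sums
  \<open>T\<^sub>d = \<Sum> B\<^bsub>m1\<^esub>(a k1/d) B\<^bsub>m2\<^esub>(b k2/d) B\<^bsub>m3\<^esub>(c k3/d)\<close> over
  \<open>k1 + k2 + k3 = 0\<close> modulo \<open>d\<close>, for the divisors \<open>d\<close> of \<open>q\<close>.

  The reciprocity law rests on the partial fraction identity
  \<open>E(x,s) E(y,t) = E(y-x,t) E(x,s+t) + E(x-y,s) E(y,s+t)\<close> for
  \<open>E(x,s) = e\<^bsup>{x}s\<^esup> / (e\<^sup>s - 1)\<close>, taken at integers \<open>x\<close> as the mean of the
  one-sided limits; a correction term appears when \<open>x\<close> and \<open>y\<close> are both integers. Comparing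
  coefficients, it expands \<open>B\<^sub>m(x) B\<^sub>n(y)\<close> into products of a function of \<open>x - y\<close> and a
  function of \<open>x\<close> or of \<open>y\<close> alone, so that one summation becomes trivial. Applying this first
  to the factors with indices \<open>m2\<close> and \<open>m3\<close> and then once more gives every term of the formula;
  a contribution independent of \<open>d\<close> is killed by \<open>\<Sum>\<^bsub>d|q\<^esub> \<mu>(q/d) = 0\<close>.
\<close>

section \<open>Products of Bernoulli functions\<close>

text \<open>The parity conditions on the characters cost nothing: the finite Fourier transform of
  \<open>bernoulli_fun m\<close> has parity \<open>(-1) ^ m\<close>, so characters of the wrong
  parity contribute 0 and full orthogonality applies. The value 0 of \<open>bernoulli_fun 1\<close>
  at integers is both the sum of its Fourier series there and the mean of the one-sided limits;
  parity and the distribution relation therefore hold at every point. The price is a correction 1/4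
  to the product of two functions of index 1 at integers. As m3 >= 2, it is absent when the factors
  of index m2 and m3 are multiplied and arises only later, for m1 = 1 against the term j = 1: this
  is D. The first expansion has terms of three kinds. Those with j >= 1 meet the factor of index m1
  in the second expansion, whose two halves, difference term and correction are A, B, C and D. The
  one that depends on the difference of the arguments alone, with slope lcm(b,c), gives both R terms
  and, via the sum of mu(q/d) d^M = J_M(q) with M = m1 + m2 + m3, the term C2. Those with j = 0 are
  freed of d by the coprimality hypotheses; they are what the Moebius sum kills.\<close>

text \<open>Numerator and denominator of the defining quotient both vanish at 0, the denominator to
  order exactly one, so the division of power series is exact. Later identities are proved after
  multiplication by \<open>fps_exp 1 - 1\<close>, which is then cancelled.\<close>

lemma bernoulli_poly_fps:
  "Abs_fps (\<lambda>n. bernoulli_poly n x / fact n) * (fps_exp 1 - 1) = fps_X * fps_exp x"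
proof -
  let ?u = "fps_exp 1 - 1 :: real fps"
  have u: "?u \<noteq> 0" by simp
  have "fps_nth ?u 0 = 0" "fps_nth ?u 1 \<noteq> 0" by simp_all
  then have "subdegree ?u = 1" by (intro subdegreeI) auto
  moreover have "subdegree (fps_X * fps_exp x :: real fps) \<ge> 1"
    by (intro subdegree_geI) auto
  ultimately have "?u dvd fps_X * fps_exp x"
    using u by (subst fps_dvd_iff) auto
  then have "fps_X * fps_exp x / ?u * ?u = fps_X * fps_exp x" by simp
  moreover have "Abs_fps (\<lambda>n. bernoulli_poly n x / fact n) = fps_X * fps_exp x / ?u"
    by (simp add: fps_eq_iff bernoulli_poly_def)
  ultimately show ?thesis by metis
qed

lemma bernoulli_poly_low: "bernoulli_poly 0 x = 1" "bernoulli_poly 1 x = x - 1/2"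
proof -
  let ?F = "Abs_fps (\<lambda>n. bernoulli_poly n x / fact n)"
  have *: "fps_nth (?F * (fps_exp 1 - 1)) n = fps_nth (fps_X * fps_exp x :: real fps) n" for n
    by (simp add: bernoulli_poly_fps)
  have "bernoulli_poly 0 x = 1" using *[of 1] by (simp add: fps_mult_nth)
  then show "bernoulli_poly 0 x = 1" "bernoulli_poly 1 x = x - 1/2"
    using *[of 2] by (simp_all add: fps_mult_nth numeral_2_eq_2)
qed

definition bernoulli_fun_fps :: "real \<Rightarrow> real fps" where
  "bernoulli_fun_fps x = Abs_fps (\<lambda>n. bernoulli_fun n x / fact n)"

text \<open>The numerator of E(x,l) in the variable X. At an integer it is the mean of its one-sided
  limits 1 and e^l, the choice that matches \<open>bernoulli_fun 1 x = 0\<close> there.\<close>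

definition periodic_fps_exp :: "real \<Rightarrow> real \<Rightarrow> real fps" where
  "periodic_fps_exp l x = (if x \<in> \<int> then fps_const (1/2) * (fps_exp l + 1) else fps_exp (l * frac x))"

text \<open>At an integer the convention for index 1 raises B_1 = -1/2 to 0, which adds t/2 to the
  series; and t + (t/2)(e^t - 1) = (t/2)(e^t + 1).\<close>

lemma bernoulli_fun_fps_mult:
  "bernoulli_fun_fps x * (fps_exp 1 - 1) = fps_X * periodic_fps_exp 1 x"
proof (cases "x \<in> \<int>")
  case False
  then have "bernoulli_fun n x = bernoulli_poly n (frac x)" for n
    using bernoulli_poly_low by (auto simp: bernoulli_fun_def)
  then show ?thesis
    using False bernoulli_poly_fps[of "frac x"]
    by (simp add: bernoulli_fun_fps_def periodic_fps_exp_def)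
next
  case True
  then have "bernoulli_fun n x = bernoulli_poly n 0 + (if n = 1 then 1/2 else 0)" for n
    using bernoulli_poly_low[of 0] by (cases "n = 0") (auto simp: bernoulli_fun_def simp flip: frac_eq_0_iff)
  then have "bernoulli_fun_fps x = Abs_fps (\<lambda>n. bernoulli_poly n 0 / fact n) + fps_const (1/2) * fps_X"
    by (auto simp: bernoulli_fun_fps_def fps_eq_iff le_Suc_eq)
  then have "bernoulli_fun_fps x * (fps_exp 1 - 1) =
      fps_X + fps_const (1/2) * fps_X * (fps_exp 1 - 1)"
    using bernoulli_poly_fps[of 0] by (simp only: distrib_right fps_exp_0 mult_1_right)
  also have "\<dots> = fps_X * ((fps_const (1/2) + fps_const (1/2)) + fps_const (1/2) * (fps_exp 1 - 1))"
    by (subst fps_const_add) (simp add: algebra_simps)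
  also have "\<dots> = fps_X * (fps_const (1/2) * (fps_exp 1 + 1))"
    by (simp add: algebra_simps)
  finally show ?thesis
    using True by (simp add: periodic_fps_exp_def)
qed

abbreviation scaled_bernoulli_fps :: "real \<Rightarrow> real \<Rightarrow> real fps" where
  "scaled_bernoulli_fps l x \<equiv> bernoulli_fun_fps x oo (fps_const l * fps_X)"

lemma scaled_bernoulli_fps_mult:
  "scaled_bernoulli_fps l x * (fps_exp l - 1) = fps_const l * fps_X * periodic_fps_exp l x"
proof -
  have "(bernoulli_fun_fps x * (fps_exp 1 - 1)) oo (fps_const l * fps_X) =
        (fps_X * periodic_fps_exp 1 x) oo (fps_const l * fps_X)"
    by (simp only: bernoulli_fun_fps_mult)
  moreover have "periodic_fps_exp 1 x oo (fps_const l * fps_X) = periodic_fps_exp l x"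
    by (simp add: periodic_fps_exp_def fps_compose_mult_distrib fps_compose_add_distrib
        mult.commute[of l])
  ultimately show ?thesis
    by (simp add: fps_compose_mult_distrib fps_compose_sub_distrib)
qed

text \<open>For non-integral \<open>x\<close> and \<open>y\<close> this is \<open>e\<^bsup>s+t\<^esup> - 1 = e\<^sup>t (e\<^sup>s - 1) + (e\<^sup>t - 1)\<close>
  up to a factor; the correction term accounts for averaging the one-sided limits at integers.\<close>

lemma periodic_fps_exp_product:
  fixes l x y :: real
  defines "u \<equiv> fps_exp l" and "v \<equiv> fps_exp 1" and "w \<equiv> fps_exp (1 + l)"
  shows "periodic_fps_exp l x * periodic_fps_exp 1 y * (w - 1) +
      (if x \<in> \<int> \<and> y \<in> \<int> then fps_const (1/4) else 0) * ((u - 1) * (v - 1) * (w - 1)) =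
      periodic_fps_exp 1 (y - x) * periodic_fps_exp (1 + l) x * (u - 1) +
      periodic_fps_exp l (x - y) * periodic_fps_exp (1 + l) y * (v - 1)"
proof -
  note E = fps_exp_add_mult
  have w: "w = v * u" by (simp add: w_def u_def v_def E)
  define h :: "real fps" where "h = fps_const (1/2)"
  have h2: "h * a + h * a = a" for a
    by (simp add: h_def flip: distrib_right)
  have h: "h + h = 1" "fps_const (1/4) = h * h" by (simp_all add: h_def)
  have yx: "frac y < frac x \<Longrightarrow> frac (y - x) = 1 + frac y - frac x" for x y :: real
    using frac_diff_neg[of y x] by simp
  have int_diff: "frac x = frac y \<longleftrightarrow> x - y \<in> \<int>" "frac x = frac y \<longleftrightarrow> y - x \<in> \<int>"
    by (metis frac_diff_eq frac_diff_zero frac_eq_0_iff)+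
  define U V where "U = fps_exp (l * frac x)" and "V = fps_exp (frac y)"
  have exp_diff: "fps_exp a = fps_exp (a - b) * fps_exp b" for a b :: real
    by (simp flip: E)
  \<comment> \<open>The order of the fractional parts decides which of \<open>frac (x - y)\<close>
    and \<open>frac (y - x)\<close> carries the extra 1; integrality of x, y or x - y switches on
    the averaged values. The correction is nonzero only in the first case.\<close>
  consider "x \<in> \<int>" "y \<in> \<int>" | "x \<in> \<int>" "y \<notin> \<int>" | "x \<notin> \<int>" "y \<in> \<int>"
    | "x \<notin> \<int>" "y \<notin> \<int>" "frac x = frac y" | "x \<notin> \<int>" "y \<notin> \<int>" "frac x < frac y"
    | "x \<notin> \<int>" "y \<notin> \<int>" "frac x > frac y"
    by fastforce
  then show ?thesis
  proof cases
    case 1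
    then have *: "x - y \<in> \<int>" "y - x \<in> \<int>" by auto
    show ?thesis
      unfolding periodic_fps_exp_def using 1 *
      apply (simp add: flip: u_def v_def w_def h_def)
      apply (simp only: h w)
      apply (simp add: algebra_simps)
      done
  next
    case 2
    then have **: "x - y \<notin> \<int>" "y - x \<notin> \<int>"
      by (metis Ints_diff diff_diff_eq2 add_diff_cancel_left' diff_add_cancel Ints_add)+
    have *: "frac (x - y) = 1 - frac y" "frac (y - x) = frac y" "frac x = 0"
      using 2 frac_add_int_left[of x "- y"] frac_add_int_right[of "- x" y] by (auto simp: frac_neg)
    have e: "fps_exp (l * (1 - frac y)) * fps_exp ((1 + l) * frac y) = u * V"
      unfolding u_def V_def by (simp flip: E add: algebra_simps)
    show ?thesis
      unfolding periodic_fps_exp_def using 2 * **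
      apply (simp add: e flip: u_def v_def w_def h_def V_def)
      unfolding w using h2[of "u * V * (v - 1)"] by (simp add: algebra_simps)
  next
    case 3
    then have **: "x - y \<notin> \<int>" "y - x \<notin> \<int>"
      by (metis Ints_diff diff_diff_eq2 add_diff_cancel_left' diff_add_cancel Ints_add)+
    have *: "frac (x - y) = frac x" "frac (y - x) = 1 - frac x" "frac y = 0"
      using 3 frac_add_int_left[of y "- x"] frac_add_int_right[of "- y" x] by (auto simp: frac_neg)
    have e: "fps_exp (1 - frac x) * fps_exp ((1 + l) * frac x) = v * U"
      unfolding v_def U_def by (simp flip: E add: algebra_simps)
    show ?thesis
      unfolding periodic_fps_exp_def using 3 * **
      apply (simp add: e flip: u_def v_def w_def h_def U_def)
      unfolding w using h2[of "v * U * (u - 1)"] by (simp add: algebra_simps)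
  next
    case 4
    have *: "x - y \<in> \<int>" "y - x \<in> \<int>" using int_diff 4 by auto
    have e: "fps_exp ((1 + l) * frac y) = U * V"
      unfolding U_def V_def using 4 by (simp flip: E add: algebra_simps)
    have e': "fps_exp (l * frac y) = U" using 4 by (simp add: U_def)
    show ?thesis
      unfolding periodic_fps_exp_def using 4 *
      apply (simp add: e flip: u_def v_def w_def h_def)
      apply (simp add: e e' flip: V_def)
      unfolding w using h2[of "U * V * (u * v - 1)"] by (simp add: algebra_simps)
  next
    case 5
    have *: "x - y \<notin> \<int>" "y - x \<notin> \<int>" using int_diff 5 by auto
    have f: "frac (x - y) = 1 + frac x - frac y" "frac (y - x) = frac y - frac x"
      using 5 yx by (auto simp: frac_diff_pos)
    have e: "fps_exp (l * (1 + frac x - frac y)) * fps_exp ((1 + l) * frac y) = u * U * V"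
      "fps_exp (frac y - frac x) * fps_exp ((1 + l) * frac x) = U * V"
      unfolding u_def U_def V_def by (simp_all flip: E add: algebra_simps)
    show ?thesis
      unfolding periodic_fps_exp_def using 5 *
      apply (simp add: f e flip: u_def v_def w_def h_def U_def V_def)
      unfolding w by (simp add: algebra_simps)
  next
    case 6
    have *: "x - y \<notin> \<int>" "y - x \<notin> \<int>" using int_diff 6 by auto
    have f: "frac (x - y) = frac x - frac y" "frac (y - x) = 1 + frac y - frac x"
      using 6 yx by (auto simp: frac_diff_pos)
    have e: "fps_exp (l * (frac x - frac y)) * fps_exp ((1 + l) * frac y) = U * V"
      "fps_exp (1 + frac y - frac x) * fps_exp ((1 + l) * frac x) = v * U * V"
      unfolding v_def U_def V_def by (simp_all flip: E add: algebra_simps)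
    show ?thesis
      unfolding periodic_fps_exp_def using 6 *
      apply (simp add: f e flip: u_def v_def w_def h_def U_def V_def)
      unfolding w by (simp add: algebra_simps)
  qed
qed

text \<open>The partial fraction identity in the variables \<open>s = l X\<close> and \<open>t = X\<close>. Letting the
  number \<open>l\<close> vary recovers all coefficients of the series in two variables.\<close>

lemma bernoulli_fun_fps_product:
  fixes l x y :: real
  assumes "l \<noteq> 0" "l \<noteq> - 1"
  shows "fps_const (1 + l) * (scaled_bernoulli_fps l x * bernoulli_fun_fps y) +
      fps_const (if x \<in> \<int> \<and> y \<in> \<int> then l * (1 + l) / 4 else 0) * fps_X ^ 2 =
      fps_const l * (bernoulli_fun_fps (y - x) * scaled_bernoulli_fps (1 + l) x) +
      scaled_bernoulli_fps l (x - y) * scaled_bernoulli_fps (1 + l) y"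
    (is "?L = ?R")
proof -
  define u v w :: "real fps" where "u = fps_exp l - 1" and "v = fps_exp 1 - 1" and "w = fps_exp (1 + l) - 1"
  \<comment> \<open>\<open>u\<close> and \<open>w\<close> vanish exactly for l = 0 and l =
    -1.\<close>
  have nz: "u * v * w \<noteq> 0"
    using assms by (simp add: u_def v_def w_def)
  define c l' l'' :: "real fps" where "c = fps_const (if x \<in> \<int> \<and> y \<in> \<int> then 1/4 else 0)"
    and "l' = fps_const l" and "l'' = fps_const (1 + l)"
  have c: "fps_const (if x \<in> \<int> \<and> y \<in> \<int> then l * (1 + l) / 4 else 0) = l' * l'' * c"
    by (simp add: c_def l'_def l''_def)
  have c': "c = (if x \<in> \<int> \<and> y \<in> \<int> then fps_const (1/4) else 0)"
    by (simp add: c_def)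
  note S = scaled_bernoulli_fps_mult[where l = l, folded u_def l'_def]
    scaled_bernoulli_fps_mult[where l = "1 + l", folded w_def l''_def]
    bernoulli_fun_fps_mult[folded v_def]
  \<comment> \<open>Stated for arbitrary series P and F so that the ring calculation sees atoms:
    each denominator turns its F into a numerator P, and only the numerator identity
    remains.\<close>
  have "P1 * P2 * w + c * (u * v * w) = P3 * P4 * u + P5 * P6 * v \<Longrightarrow>
    F1 * u = l' * fps_X * P1 \<Longrightarrow> F2 * v = fps_X * P2 \<Longrightarrow> F3 * v = fps_X * P3 \<Longrightarrow>
    F4 * w = l'' * fps_X * P4 \<Longrightarrow> F5 * u = l' * fps_X * P5 \<Longrightarrow> F6 * w = l'' * fps_X * P6 \<Longrightarrow>
    (l'' * (F1 * F2) + l' * l'' * c * fps_X ^ 2) * (u * v * w) = (l' * (F3 * F4) + F5 * F6) * (u * v * w)"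
    for P1 P2 P3 P4 P5 P6 F1 F2 F3 F4 F5 F6
  proof -
    assume P: "P1 * P2 * w + c * (u * v * w) = P3 * P4 * u + P5 * P6 * v"
      and F: "F1 * u = l' * fps_X * P1" "F2 * v = fps_X * P2" "F3 * v = fps_X * P3"
      "F4 * w = l'' * fps_X * P4" "F5 * u = l' * fps_X * P5" "F6 * w = l'' * fps_X * P6"
    have "(l'' * (F1 * F2) + l' * l'' * c * fps_X ^ 2) * (u * v * w) =
        l'' * (F1 * u) * (F2 * v) * w + l' * l'' * fps_X ^ 2 * (c * (u * v * w))"
      by (simp only: algebra_simps)
    also have "\<dots> = l' * l'' * fps_X ^ 2 * (P1 * P2 * w + c * (u * v * w))"
      unfolding F by (simp only: algebra_simps power2_eq_square)
    also have "\<dots> = l' * (F3 * v) * (F4 * w) * u + (F5 * u) * (F6 * w) * v"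
      unfolding P F by (simp only: algebra_simps power2_eq_square)
    also have "\<dots> = (l' * (F3 * F4) + F5 * F6) * (u * v * w)"
      by (simp only: algebra_simps)
    finally show ?thesis .
  qed
  from this[OF periodic_fps_exp_product[of l x y, folded u_def v_def w_def c'] S(1) S(3) S(3) S(2) S(1) S(2)]
  have "?L * (u * v * w) = ?R * (u * v * w)"
    unfolding c l''_def[symmetric] l'_def[symmetric] .
  then show ?thesis using nz by simp
qed

text \<open>Substitute -t for t: multiplication by e^t turns e^(-t{x}) into e^(t(1-{x})), the
  numerator for -x. The mean (e^t + 1)/2 behaves in the same way, so integers are no
  exception.\<close>

lemma bernoulli_fun_minus: "bernoulli_fun n (- x) = (-1) ^ n * bernoulli_fun n x"
proof -
  let ?A = "scaled_bernoulli_fps (-1) x"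
  have e: "fps_exp (-1) * fps_exp 1 = (1 :: real fps)"
    by (simp flip: fps_exp_add_mult)
  have p: "periodic_fps_exp (-1) x * fps_exp 1 = periodic_fps_exp 1 (- x)"
    by (auto simp: periodic_fps_exp_def e algebra_simps frac_neg simp flip: fps_exp_add_mult)
  have "?A * (fps_exp 1 - 1) = - (?A * (fps_exp (-1) - 1) * fps_exp 1)"
    using e by (simp add: algebra_simps)
  also have "\<dots> = fps_X * (periodic_fps_exp (-1) x * fps_exp 1)"
    unfolding scaled_bernoulli_fps_mult by (simp add: mult.assoc flip: fps_const_neg)
  also have "\<dots> = bernoulli_fun_fps (- x) * (fps_exp 1 - 1)"
    by (simp add: p bernoulli_fun_fps_mult)
  finally have "?A = bernoulli_fun_fps (- x)" by simp
  then have "fps_nth ?A n = fps_nth (bernoulli_fun_fps (- x)) n" by simp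
  then show ?thesis by (simp add: bernoulli_fun_fps_def)
qed

lemma bernoulli_fun_0 [simp]: "bernoulli_fun 0 x = 1"
  by (simp add: bernoulli_fun_def)

lemma bernoulli_fun_add_int [simp]:
  "bernoulli_fun n (x + of_int k) = bernoulli_fun n x"
  "bernoulli_fun n (x - of_int k) = bernoulli_fun n x"
proof -
  show *: "bernoulli_fun n (x + of_int k) = bernoulli_fun n x" for x k
    by (simp add: bernoulli_fun_def)
  show "bernoulli_fun n (x - of_int k) = bernoulli_fun n x"
    using *[of x "- k"] by simp
qed

text \<open>Turns the binomial coefficients that come from expanding powers of 1 + l into the
  weights of the product formula.\<close>

lemma fact_binomial_quotient:
  assumes "m \<ge> 1" "j \<le> n"
  shows "fact m * fact n * real ((m + n - j - 1) choose (m - 1)) / (fact j * fact (m + n - j)) =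
    real m * real (n choose j) / real (m + n - j)"
proof -
  obtain m' where m: "m = Suc m'" using assms(1) by (cases m) auto
  obtain k where n: "n = j + k" using assms(2) le_Suc_ex by blast
  show ?thesis
    by (simp add: m n binomial_fact divide_simps)
qed

text \<open>This is the coefficient of s^m t^n in the partial fraction identity. With s = l t, the
  coefficient of t^(m+n) is a polynomial in l, and the power l^m is read off.\<close>

theorem bernoulli_fun_mult:
  fixes x y :: real
  assumes m: "m \<ge> 1" and n: "n \<ge> 1"
  shows "bernoulli_fun m x * bernoulli_fun n y =
    (\<Sum>j\<le>m. real n * real (m choose j) / real (m + n - j) * bernoulli_fun j (x - y) * bernoulli_fun (m + n - j) y) +
    (\<Sum>j\<le>n. real m * real (n choose j) / real (m + n - j) * bernoulli_fun j (y - x) * bernoulli_fun (m + n - j) x) +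
    (-1) ^ (n + 1) * fact m * fact n / fact (m + n) * bernoulli_fun (m + n) (x - y) -
    (if m = 1 \<and> n = 1 \<and> x \<in> \<int> \<and> y \<in> \<int> then 1 / 4 else 0)"
proof -
  define N where "N = m + n"
  define b where "b j z = bernoulli_fun j z / fact j" for j z
  define z where "z = x - y"
  define \<kappa> :: real where "\<kappa> = (if N = 2 \<and> x \<in> \<int> \<and> y \<in> \<int> then 1 / 4 else 0)"
  \<comment> \<open>The coefficient of t^N of the identity, divided by 1 + l. The two pieces with j
    = N are not divisible one by one; together they are \<open>b N z\<close> times l^N + (-1)^N l,
    whose quotient is the last sum and the source of the term in x - y alone. The monomial with
    \<open>\<kappa>\<close> is the correction, which is of order t^2 only.\<close>
  define Q :: "real poly" where "Q =
     (\<Sum>i\<le>N. Polynomial.monom (b i x * b (N - i) y) i) + Polynomial.monom \<kappa> 1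
     - (\<Sum>j<N. Polynomial.smult (b j (- z) * b (N - j) x) (Polynomial.monom 1 1 * [:1, 1:] ^ (N - j - 1)))
     - (\<Sum>j<N. Polynomial.smult (b j z * b (N - j) y) (Polynomial.monom 1 j * [:1, 1:] ^ (N - j - 1)))
     - Polynomial.smult (b N z) (\<Sum>i<N-1. Polynomial.monom ((-1) ^ (N - 2 - i)) (i + 1))"
  have bz: "b N (- z) = (-1) ^ N * b N z"
    by (simp add: b_def bernoulli_fun_minus)
  have N2: "N \<ge> 2" using m n by (simp add: N_def)
  have root: "poly Q l = 0" if l: "l \<noteq> 0" "l \<noteq> -1" for l
  proof -
    have geo: "(1 + l) * (\<Sum>i<N-1. (-1) ^ (N - 2 - i) * l ^ (i + 1)) = l ^ N + l * (-1) ^ N"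
    proof -
      obtain K where K: "N = Suc (Suc K)" using N2 by (metis Suc_diff_le add_2_eq_Suc le_Suc_ex)
      have "(l - (-1)) * (\<Sum>i<Suc K. l ^ i * (-1) ^ (K - i)) = l ^ Suc K - (-1) ^ Suc K"
        using diff_power_eq_sum[of l K "-1"] by (simp add: mult.commute)
      then have "l * ((1 + l) * (\<Sum>i<Suc K. l ^ i * (-1) ^ (K - i))) = l * (l ^ Suc K - (-1) ^ Suc K)"
        by (simp add: add.commute)
      then show ?thesis unfolding K
        by (simp add: sum_distrib_left algebra_simps del: sum.lessThan_Suc)
    qed
    have "fps_nth (fps_const (1 + l) * (scaled_bernoulli_fps l x * bernoulli_fun_fps y) +
      fps_const (if x \<in> \<int> \<and> y \<in> \<int> then l * (1 + l) / 4 else 0) * fps_X ^ 2) N =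
      fps_nth (fps_const l * (bernoulli_fun_fps (y - x) * scaled_bernoulli_fps (1 + l) x) +
      scaled_bernoulli_fps l (x - y) * scaled_bernoulli_fps (1 + l) y) N"
      using bernoulli_fun_fps_product[OF l] by simp
    moreover have "fps_nth (scaled_bernoulli_fps l x * bernoulli_fun_fps y) N =
        (\<Sum>i\<le>N. l ^ i * b i x * b (N - i) y)"
      "fps_nth (bernoulli_fun_fps (y - x) * scaled_bernoulli_fps (1 + l) x) N =
        (\<Sum>j\<le>N. b j (- z) * ((1 + l) ^ (N - j) * b (N - j) x))"
      "fps_nth (scaled_bernoulli_fps l (x - y) * scaled_bernoulli_fps (1 + l) y) N =
        (\<Sum>j\<le>N. l ^ j * b j z * ((1 + l) ^ (N - j) * b (N - j) y))"
      by (simp_all add: fps_mult_nth bernoulli_fun_fps_def b_def z_def atLeast0AtMost)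
    ultimately have eq: "(1 + l) * (\<Sum>i\<le>N. l ^ i * b i x * b (N - i) y) + l * (1 + l) * \<kappa> =
        l * (\<Sum>j\<le>N. b j (- z) * ((1 + l) ^ (N - j) * b (N - j) x)) +
        (\<Sum>j\<le>N. l ^ j * b j z * ((1 + l) ^ (N - j) * b (N - j) y))"
      by (auto simp: \<kappa>_def split: if_splits)
    have split: "(\<Sum>j\<le>N. f j * (1 + l) ^ (N - j)) = (1 + l) * (\<Sum>j<N. f j * (1 + l) ^ (N - j - 1)) + f N" for f
    proof -
      have "(\<Sum>j\<le>N. f j * (1 + l) ^ (N - j)) = (\<Sum>j<N. f j * (1 + l) ^ (N - j)) + f N"
        by (simp flip: lessThan_Suc_atMost)
      also have "(\<Sum>j<N. f j * (1 + l) ^ (N - j)) = (1 + l) * (\<Sum>j<N. f j * (1 + l) ^ (N - j - 1))"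
        unfolding sum_distrib_left
        by (intro sum.cong) (auto simp flip: power_Suc simp: Suc_diff_Suc)
      finally show ?thesis .
    qed
    have "(1 + l) * poly Q l = (1 + l) * (\<Sum>i\<le>N. l ^ i * b i x * b (N - i) y) + l * (1 + l) * \<kappa>
        - l * ((1 + l) * (\<Sum>j<N. (b j (- z) * b (N - j) x) * (1 + l) ^ (N - j - 1)))
        - (1 + l) * (\<Sum>j<N. (l ^ j * b j z * b (N - j) y) * (1 + l) ^ (N - j - 1))
        - b N z * ((1 + l) * (\<Sum>i<N-1. (-1) ^ (N - 2 - i) * l ^ (i + 1)))"
      unfolding Q_def
      by (simp add: poly_sum poly_monom sum_distrib_left sum_distrib_right algebra_simps)
    also have "\<dots> = 0"
      using eq split[of "\<lambda>j. b j (- z) * b (N - j) x"] split[of "\<lambda>j. l ^ j * b j z * b (N - j) y"]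
      unfolding geo
      by (simp add: bz b_def[of 0] algebra_simps)
    finally show ?thesis using l by simp
  qed
  have "Q = 0"
  proof (rule ccontr)
    assume "Q \<noteq> 0"
    then have "finite {l. poly Q l = 0}" by (rule poly_roots_finite)
    moreover have "UNIV - {0, -1} \<subseteq> {l. poly Q l = 0}" using root by auto
    ultimately have "finite (UNIV - {0, -1 :: real})" by (rule rev_finite_subset)
    then show False by (simp add: infinite_UNIV_char_0)
  qed
  then have "Polynomial.coeff Q m = 0" by simp
  have c1: "Polynomial.coeff ([:1, 1:] ^ k :: real poly) i = real (k choose i)" for k i
  proof (cases "i \<le> k")
    case False
    have "degree ([:1, 1:] ^ k :: real poly) \<le> k"
      using degree_power_le[of "[:1, 1 :: real:]" k] by simp
    then show ?thesis using False by (simp add: coeff_eq_0)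
  qed (simp add: coeff_linear_poly_power)
  have mN: "m \<le> N" "m \<noteq> N" "N - m = n" using n by (auto simp: N_def)
  have c0: "Polynomial.coeff (\<Sum>i\<le>N. Polynomial.monom (b i x * b (N - i) y) i) m = b m x * b n y"
    using mN by (simp add: coeff_sum)
  have c5: "Polynomial.coeff (Polynomial.monom \<kappa> 1) m = (if m = 1 then \<kappa> else 0)"
    by auto
  have c2: "Polynomial.coeff (\<Sum>j<N. Polynomial.smult (b j (- z) * b (N - j) x)
        (Polynomial.monom 1 1 * [:1, 1:] ^ (N - j - 1))) m =
      (\<Sum>j\<le>n. b j (- z) * b (N - j) x * real ((N - j - 1) choose (m - 1)))"
  proof -
    have "Polynomial.coeff (\<Sum>j<N. Polynomial.smult (b j (- z) * b (N - j) x)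
        (Polynomial.monom 1 1 * [:1, 1:] ^ (N - j - 1))) m =
      (\<Sum>j<N. b j (- z) * b (N - j) x * real ((N - j - 1) choose (m - 1)))"
      using m by (simp add: coeff_sum c1 coeff_monom_mult)
    also have "\<dots> = (\<Sum>j\<le>n. b j (- z) * b (N - j) x * real ((N - j - 1) choose (m - 1)))"
      using m by (intro sum.mono_neutral_right) (auto simp: N_def)
    finally show ?thesis .
  qed
  have c3: "Polynomial.coeff (\<Sum>j<N. Polynomial.smult (b j z * b (N - j) y)
        (Polynomial.monom 1 j * [:1, 1:] ^ (N - j - 1))) m =
      (\<Sum>j\<le>m. b j z * b (N - j) y * real ((N - j - 1) choose (n - 1)))"
  proof -
    have "Polynomial.coeff (\<Sum>j<N. Polynomial.smult (b j z * b (N - j) y)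
        (Polynomial.monom 1 j * [:1, 1:] ^ (N - j - 1))) m =
      (\<Sum>j<N. b j z * b (N - j) y * (if m < j then 0 else real ((N - j - 1) choose (m - j))))"
      by (simp add: coeff_sum c1 coeff_monom_mult cong: if_cong)
    also have "\<dots> = (\<Sum>j\<le>m. b j z * b (N - j) y * (if m < j then 0 else real ((N - j - 1) choose (m - j))))"
      using n by (intro sum.mono_neutral_right) (auto simp: N_def)
    also have "\<dots> = (\<Sum>j\<le>m. b j z * b (N - j) y * real ((N - j - 1) choose (n - 1)))"
    proof (intro sum.cong refl)
      fix j assume "j \<in> {..m}"
      then have "N - j - 1 - (m - j) = n - 1" "m - j \<le> N - j - 1" "\<not> m < j"
        using n by (auto simp: N_def)
      then show "b j z * b (N - j) y * (if m < j then 0 else real ((N - j - 1) choose (m - j))) =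
          b j z * b (N - j) y * real ((N - j - 1) choose (n - 1))"
        using binomial_symmetric[of "m - j" "N - j - 1"] by simp
    qed
    finally show ?thesis .
  qed
  have c4: "Polynomial.coeff (\<Sum>i<N-1. Polynomial.monom ((-1) ^ (N - 2 - i)) (i + 1)) m = ((-1) ^ (n + 1) :: real)"
  proof -
    have "Polynomial.coeff (\<Sum>i<N-1. Polynomial.monom ((-1) ^ (N - 2 - i)) (i + 1)) m =
      (\<Sum>i<N-1. if i = m - 1 then (-1) ^ (N - 2 - i) else (0::real))"
      unfolding coeff_sum coeff_monom using m by (intro sum.cong) auto
    also have "\<dots> = (-1) ^ (N - 2 - (m - 1))"
      using m n by (auto simp: N_def)
    also have "\<dots> = (-1) ^ (n + 1)"
      using m n by (cases n) (auto simp: N_def)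
    finally show ?thesis .
  qed
  have "b m x * b n y = (\<Sum>j\<le>n. b j (- z) * b (N - j) x * real ((N - j - 1) choose (m - 1)))
      + (\<Sum>j\<le>m. b j z * b (N - j) y * real ((N - j - 1) choose (n - 1)))
      + b N z * (-1) ^ (n + 1) - (if m = 1 then \<kappa> else 0)"
    using \<open>Polynomial.coeff Q m = 0\<close> unfolding Q_def coeff_add coeff_diff c0 c2 c3 coeff_smult c4 c5
    by linarith
  then have "fact m * fact n * (b m x * b n y) =
      fact m * fact n * (\<Sum>j\<le>n. b j (- z) * b (N - j) x * real ((N - j - 1) choose (m - 1)))
      + fact m * fact n * (\<Sum>j\<le>m. b j z * b (N - j) y * real ((N - j - 1) choose (n - 1)))
      + fact m * fact n * (b N z * (-1) ^ (n + 1)) - fact m * fact n * (if m = 1 then \<kappa> else 0)"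
    by (simp only: distrib_left right_diff_distrib)
  moreover have "fact m * fact n * (\<Sum>j\<le>n. b j (- z) * b (N - j) x * real ((N - j - 1) choose (m - 1))) =
      (\<Sum>j\<le>n. real m * real (n choose j) / real (m + n - j) * bernoulli_fun j (y - x) * bernoulli_fun (m + n - j) x)"
    unfolding sum_distrib_left
  proof (intro sum.cong refl)
    fix j assume "j \<in> {..n}"
    then show "fact m * fact n * (b j (- z) * b (N - j) x * real ((N - j - 1) choose (m - 1))) =
        real m * real (n choose j) / real (m + n - j) * bernoulli_fun j (y - x) * bernoulli_fun (m + n - j) x"
      by (subst fact_binomial_quotient[symmetric, OF m]) (auto simp: b_def z_def N_def)
  qed
  moreover have "fact m * fact n * (\<Sum>j\<le>m. b j z * b (N - j) y * real ((N - j - 1) choose (n - 1))) =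
      (\<Sum>j\<le>m. real n * real (m choose j) / real (m + n - j) * bernoulli_fun j (x - y) * bernoulli_fun (m + n - j) y)"
    unfolding sum_distrib_left
  proof (intro sum.cong refl)
    fix j assume j: "j \<in> {..m}"
    then show "fact m * fact n * (b j z * b (N - j) y * real ((N - j - 1) choose (n - 1))) =
        real n * real (m choose j) / real (m + n - j) * bernoulli_fun j (x - y) * bernoulli_fun (m + n - j) y"
      using fact_binomial_quotient[of n j m, OF n, symmetric]
      by (simp add: b_def z_def N_def add.commute[of n m] mult.commute[of "fact m"])
  qed
  moreover have "fact m * fact n * (if m = 1 then \<kappa> else 0) =
      (if m = 1 \<and> n = 1 \<and> x \<in> \<int> \<and> y \<in> \<int> then 1 / 4 else 0)"
    using n by (auto simp: \<kappa>_def N_def)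
  moreover have "fact m * fact n * (b m x * b n y) = bernoulli_fun m x * bernoulli_fun n y"
    by (simp add: b_def)
  moreover have "fact m * fact n * (b N z * (-1) ^ (n + 1)) =
      (-1) ^ (n + 1) * fact m * fact n / fact (m + n) * bernoulli_fun (m + n) (x - y)"
    by (simp add: b_def N_def z_def)
  ultimately show ?thesis by simp
qed

section \<open>Sums over residues\<close>

lemma periodic_add_mult:
  fixes g :: "int \<Rightarrow> 'a"
  assumes "\<And>i. g (i + n) = g i"
  shows "g (i + k * n) = g i"
proof -
  have *: "g (i + int k * n) = g i" for i k
  proof (induction k)
    case (Suc k)
    then show ?case using assms[of "i + int k * n"] by (simp add: algebra_simps)
  qed simp
  show ?thesis
    using *[of i "nat k"] *[of "i + k * n" "nat (- k)"] by (cases "k \<ge> 0") auto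
qed

lemma periodic_mod:
  fixes g :: "int \<Rightarrow> 'a"
  assumes "\<And>i. g (i + n) = g i"
  shows "g (i mod n) = g i"
  using periodic_add_mult[of g n "i mod n" "i div n", OF assms] by simp

lemma sum_residues_reindex:
  fixes g :: "int \<Rightarrow> 'a :: comm_monoid_add"
  assumes "n > 0" and g: "\<And>i. g (i + int n) = g i"
    and inj: "\<And>i j. [h i = h j] (mod int n) \<Longrightarrow> [i = j] (mod int n)"
  shows "(\<Sum>i<n. g (h (int i))) = (\<Sum>i<n. g (int i))"
proof -
  define f where "f i = nat (h (int i) mod int n)" for i
  have f_int: "int (f i) = h (int i) mod int n" for i
    using assms(1) by (simp add: f_def)
  have "inj_on f {..<n}"
  proof (rule inj_onI)
    fix i j assume ij: "i \<in> {..<n}" "j \<in> {..<n}" "f i = f j"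
    then have "[h (int i) = h (int j)] (mod int n)"
      unfolding cong_def by (metis f_int)
    then have "[int i = int j] (mod int n)" by (rule inj)
    then show "i = j" using ij by (simp add: cong_def flip: zmod_int)
  qed
  moreover have "f ` {..<n} \<subseteq> {..<n}"
    using assms(1) by (auto simp: f_def nat_less_iff)
  ultimately have "bij_betw f {..<n} {..<n}"
    by (simp add: bij_betw_def endo_inj_surj)
  then have "(\<Sum>i<n. g (int i)) = (\<Sum>i<n. g (int (f i)))"
    by (rule sum.reindex_bij_betw[symmetric])
  also have "\<dots> = (\<Sum>i<n. g (h (int i)))"
    unfolding f_int using periodic_mod[of g "int n", OF g] by simp
  finally show ?thesis ..
qed

lemma sum_residues_shift:
  fixes g :: "int \<Rightarrow> 'a :: comm_monoid_add"
  assumes "n > 0" "\<And>i. g (i + int n) = g i"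
  shows "(\<Sum>i<n. g (int i + k)) = (\<Sum>i<n. g (int i))"
  by (rule sum_residues_reindex[of n g "\<lambda>i. i + k"]) (use assms in \<open>auto simp: cong_add_rcancel\<close>)

lemma sum_residues_coprime:
  fixes g :: "int \<Rightarrow> 'a :: comm_monoid_add"
  assumes "n > 0" "\<And>i. g (i + int n) = g i" "coprime u (int n)"
  shows "(\<Sum>i<n. g (u * int i)) = (\<Sum>i<n. g (int i))"
  by (rule sum_residues_reindex[of n g "\<lambda>i. u * i"]) (use assms in \<open>auto simp: cong_mult_lcancel\<close>)

lemma sum_residues_uminus:
  fixes g :: "int \<Rightarrow> 'a :: comm_monoid_add"
  assumes "n > 0" "\<And>i. g (i + int n) = g i"
  shows "(\<Sum>i<n. g (- int i)) = (\<Sum>i<n. g (int i))"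
  using sum_residues_coprime[of n g "-1"] assms by simp

lemma sum_residues_split:
  fixes g :: "nat \<Rightarrow> 'a :: comm_monoid_add"
  shows "(\<Sum>i<a * b. g i) = (\<Sum>j<b. \<Sum>i<a. g (i + a * j))"
proof -
  have "(\<Sum>j<b. \<Sum>i<a. g (i + a * j)) = (\<Sum>j<b. sum g {j * a..<j * a + a})"
  proof (rule sum.cong[OF refl])
    fix j
    show "(\<Sum>i<a. g (i + a * j)) = sum g {j * a..<j * a + a}"
      by (rule sum.reindex_bij_witness[of _ "\<lambda>i. i - a * j" "\<lambda>i. i + a * j"]) (auto simp: mult.commute)
  qed
  then show ?thesis using sum.nat_group[of g a b] by (simp add: mult.commute)
qed

text \<open>Multiplication by \<open>k\<close> maps residues modulo \<open>n\<close> onto those modulo \<open>n div gcd k n\<close>,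
  each value being attained \<open>gcd k n\<close> times.\<close>

lemma sum_residues_mult:
  fixes g :: "int \<Rightarrow> 'a :: comm_semiring_1"
  assumes n: "n > 0" and k: "k > 0" and g: "\<And>i. g (i + int n) = g i"
  shows "(\<Sum>i<n. g (int (k * i))) = of_nat (gcd k n) * (\<Sum>i<n div gcd k n. g (int (gcd k n * i)))"
proof -
  define e where "e = gcd k n"
  have e: "e > 0" using n by (simp add: e_def)
  define k' n' where "k' = k div e" and "n' = n div e"
  have kn: "k = e * k'" "n = e * n'"
    unfolding e_def k'_def n'_def by simp_all
  have kn_coprime: "coprime k' n'"
    unfolding e_def k'_def n'_def using n by (intro div_gcd_coprime) auto
  have n': "n' > 0" using n kn(2) by (cases n') auto
  have per: "g (int e * (i + int n')) = g (int e * i)" for i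
    using g[of "int e * i"] by (simp add: kn algebra_simps)
  have "(\<Sum>i<n. g (int (k * i))) = (\<Sum>j<e. \<Sum>i<n'. g (int e * (int k' * int (i + n' * j))))"
    using sum_residues_split[of "\<lambda>i. g (int (k * i))" n' e] kn(2)
    by (simp add: kn(1) algebra_simps)
  also have "\<dots> = (\<Sum>j<e. \<Sum>i<n'. g (int e * (int k' * int i)))"
  proof (intro sum.cong refl)
    fix j i
    have "int k' * int (i + n' * j) = int k' * int i + (int k' * int j) * int n'"
      by (simp add: algebra_simps)
    then show "g (int e * (int k' * int (i + n' * j))) = g (int e * (int k' * int i))"
      using periodic_add_mult[of "\<lambda>i. g (int e * i)" "int n'", OF per] by metis
  qed
  also have "\<dots> = of_nat e * (\<Sum>i<n'. g (int e * int i))"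
    using sum_residues_coprime[of n' "\<lambda>i. g (int e * i)" "int k'", OF n' per] kn_coprime by simp
  finally show ?thesis
    unfolding e_def[symmetric] n'_def[symmetric] by simp
qed

section \<open>Distribution relations\<close>

text \<open>The exponentials over the points \<open>(\<theta> + i) / a\<close> form a geometric sum
  with ratio r = e^(t/a) and r^a = e^t. The factor a^(1-n) is written as a quotient so that n = 0 is
  covered.\<close>

theorem bernoulli_fun_distribution:
  assumes "a > 0"
  shows "(\<Sum>i<a. bernoulli_fun n (x + real i / real a)) = real a * bernoulli_fun n (real a * x) / real a ^ n"
proof -
  define \<theta> where "\<theta> = frac (real a * x)"
  define k where "k = \<lfloor>real a * x\<rfloor>"
  have ax: "real a * x = \<theta> + of_int k" by (simp add: \<theta>_def k_def frac_def)
  have \<theta>: "0 \<le> \<theta>" "\<theta> < 1" by (simp_all add: \<theta>_def frac_lt_1)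
  define r where "r = fps_exp (1 / real a)"
  have r: "r ^ i = fps_exp (real i / real a)" for i
    by (simp add: r_def fps_exp_power_mult)
  \<comment> \<open>Only \<open>\<theta> = 0\<close>, i = 0 hits an integer; there the averaged
    numerator exceeds the exponential by (e^t - 1)/2.\<close>
  have per: "periodic_fps_exp 1 ((\<theta> + real i) / real a) =
      fps_exp (\<theta> / real a) * r ^ i + (if \<theta> = 0 \<and> i = 0 then fps_const (1/2) * (fps_exp 1 - 1) else 0)"
    if "i < a" for i
  proof -
    have "real i + 1 \<le> real a" using that by simp
    then have "(\<theta> + real i) / real a < 1" "0 \<le> (\<theta> + real i) / real a" using \<theta> assms by auto
    then have "frac ((\<theta> + real i) / real a) = (\<theta> + real i) / real a" by (simp add: frac_eq)
    moreover from this have "(\<theta> + real i) / real a \<in> \<int> \<longleftrightarrow> \<theta> = 0 \<and> i = 0"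
      using \<theta> assms by (subst frac_eq_0_iff[symmetric]) auto
    moreover have "fps_const (1/2) * (fps_exp 1 + 1) = 1 + fps_const (1/2) * (fps_exp 1 - 1 :: real fps)"
    proof -
      have "fps_const (1/2) * (fps_exp 1 + 1) = (fps_const (1/2) + fps_const (1/2)) + fps_const (1/2) * (fps_exp 1 - 1 :: real fps)"
        by (simp only: algebra_simps) simp
      then show ?thesis by simp
    qed
    ultimately show ?thesis
      by (auto simp: periodic_fps_exp_def r add_divide_distrib simp flip: fps_exp_add_mult)
  qed
  have ra: "r ^ a = fps_exp 1" using assms by (simp add: r)
  have geo: "(\<Sum>i<a. r ^ i) * (r - 1) = fps_exp 1 - 1"
    using power_diff_1_eq[of r a] by (simp add: ra mult.commute)
  have "(\<Sum>i<a. periodic_fps_exp 1 ((\<theta> + real i) / real a)) =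
      fps_exp (\<theta> / real a) * (\<Sum>i<a. r ^ i) + (\<Sum>i<a. if i = 0 then (if \<theta> = 0 then fps_const (1/2) * (fps_exp 1 - 1) else 0) else 0)"
    unfolding sum_distrib_left sum.distrib[symmetric] by (intro sum.cong) (auto simp: per)
  also have "(\<Sum>i<a. if i = 0 then (if \<theta> = 0 then fps_const (1/2) * (fps_exp 1 - 1) else 0) else 0) =
     (if \<theta> = 0 then fps_const (1/2) * (fps_exp 1 - 1 :: real fps) else 0)"
    using assms by simp
  finally have "(\<Sum>i<a. periodic_fps_exp 1 ((\<theta> + real i) / real a)) * (r - 1) =
      fps_exp (\<theta> / real a) * (fps_exp 1 - 1) + (if \<theta> = 0 then fps_const (1/2) * (fps_exp 1 - 1) else 0) * (r - 1)"
    by (simp add: distrib_right mult.assoc geo)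
  also have "\<dots> = periodic_fps_exp (1 / real a) (real a * x) * (fps_exp 1 - 1)"
  proof (cases "\<theta> = 0")
    case True
    then have int: "real a * x \<in> \<int>" by (simp add: \<theta>_def)
    define h :: "real fps" where "h = fps_const (1/2)"
    have "h + h = 1" by (simp add: h_def)
    moreover have "h * (r + 1) = h * (r - 1) + (h + h)" by (simp add: algebra_simps)
    ultimately have "h * (r + 1) = h * (r - 1) + 1" by simp
    then show ?thesis using True int
      by (simp add: periodic_fps_exp_def distrib_right flip: r_def h_def)
  next
    case False
    then have "real a * x \<notin> \<int>" by (simp add: \<theta>_def)
    then show ?thesis using False by (simp add: periodic_fps_exp_def \<theta>_def)
  qed
  finally have P: "(\<Sum>i<a. periodic_fps_exp 1 ((\<theta> + real i) / real a)) * (r - 1) =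
    periodic_fps_exp (1 / real a) (real a * x) * (fps_exp 1 - 1)" .
  have "(\<Sum>i<a. bernoulli_fun_fps ((\<theta> + real i) / real a)) * (fps_exp 1 - 1) * (r - 1) =
      fps_X * ((\<Sum>i<a. periodic_fps_exp 1 ((\<theta> + real i) / real a)) * (r - 1))"
    by (simp add: sum_distrib_right bernoulli_fun_fps_mult sum_distrib_left mult.assoc)
  also have "\<dots> = fps_const (real a) * (fps_const (1 / real a) * fps_X * periodic_fps_exp (1 / real a) (real a * x)) * (fps_exp 1 - 1)"
    using assms unfolding P by (simp flip: mult.assoc)
  also have "\<dots> = fps_const (real a) * scaled_bernoulli_fps (1 / real a) (real a * x) * (fps_exp 1 - 1) * (r - 1)"
    unfolding scaled_bernoulli_fps_mult[symmetric] r_def by (simp only: mult_ac)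
  finally have "(\<Sum>i<a. bernoulli_fun_fps ((\<theta> + real i) / real a)) =
      fps_const (real a) * scaled_bernoulli_fps (1 / real a) (real a * x)"
    using assms by (simp add: r_def)
  then have "fps_nth (\<Sum>i<a. bernoulli_fun_fps ((\<theta> + real i) / real a)) n =
      fps_nth (fps_const (real a) * scaled_bernoulli_fps (1 / real a) (real a * x)) n" by simp
  then have "(\<Sum>i<a. bernoulli_fun n ((\<theta> + real i) / real a)) = real a * bernoulli_fun n (real a * x) / real a ^ n"
    by (simp add: fps_sum_nth bernoulli_fun_fps_def power_divide flip: sum_divide_distrib) (simp add: field_simps)
  \<comment> \<open>The integer part k of a x only shifts the summation index, which periodicity
    undoes.\<close>
  moreover have "(\<Sum>i<a. bernoulli_fun n (x + real i / real a)) = (\<Sum>i<a. bernoulli_fun n ((\<theta> + of_int (int i + k)) / real a))"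
    using assms ax by (intro sum.cong) (auto simp: field_simps)
  moreover have "\<dots> = (\<Sum>i<a. bernoulli_fun n ((\<theta> + of_int (int i)) / real a))"
  proof (rule sum_residues_shift[OF assms])
    fix i
    have "(\<theta> + of_int (i + int a)) / real a = (\<theta> + of_int i) / real a + of_int 1"
      using assms by (simp add: field_simps)
    then show "bernoulli_fun n ((\<theta> + of_int (i + int a)) / real a) = bernoulli_fun n ((\<theta> + of_int i) / real a)"
      by (simp only: bernoulli_fun_add_int)
  qed
  ultimately show ?thesis by simp
qed

text \<open>The distribution relation read backwards: a factor of slope a becomes a sum of factors
  of slope 1, to which the product formula applies.\<close>

lemma bernoulli_fun_scale:
  assumes "a > 0" "m \<ge> 1"
  shows "bernoulli_fun m (real a * x) = real a ^ (m - 1) * (\<Sum>i<a. bernoulli_fun m (x + real i / real a))"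
  unfolding bernoulli_fun_distribution[OF assms(1)] using assms by (cases m) auto

lemma delta_int_add_int [simp]:
  "delta_int (x + of_int k) = delta_int x"
  by (auto simp: delta_int_def)

text \<open>Among the points x + i/a with 0 <= i < a at most one is an integer, and there is one
  exactly when a x is an integer.\<close>

lemma delta_int_scale:
  assumes "a > 0"
  shows "(\<Sum>i<a. delta_int (x + real i / real a)) = delta_int (real a * x)"
proof (cases "real a * x \<in> \<int>")
  case False
  have "x + real i / real a \<notin> \<int>" for i
  proof
    assume "x + real i / real a \<in> \<int>"
    then have "real a * (x + real i / real a) - real i \<in> \<int>"
      by (intro Ints_diff Ints_mult) auto
    then show False using False assms by (simp add: distrib_left)
  qed
  then show ?thesis using False by (simp add: delta_int_def)
next
  case True
  then obtain k where k: "real a * x = of_int k" by (elim Ints_cases)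
  have "(\<Sum>i<a. delta_int (x + real i / real a)) = (\<Sum>i<a. delta_int (of_int (int i + k) / real a))"
    using assms by (intro sum.cong) (auto simp: k[symmetric] field_simps)
  also have "\<dots> = (\<Sum>i<a. delta_int (of_int (int i) / real a))"
  proof (rule sum_residues_shift[OF assms])
    fix i
    have "of_int (i + int a) / real a = of_int i / real a + of_int 1"
      using assms by (simp add: field_simps)
    then show "delta_int (of_int (i + int a) / real a) = delta_int (of_int i / real a)"
      by (simp only: delta_int_add_int)
  qed
  also have "\<dots> = (\<Sum>i<a. if i = 0 then 1 else 0)"
  proof (intro sum.cong refl)
    fix i assume "i \<in> {..<a}"
    then have "0 \<le> real i / real a" "real i / real a < 1" by auto
    then have "real i / real a \<in> \<int> \<longleftrightarrow> real i / real a = 0"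
      using frac_eq frac_eq_0_iff by metis
    then show "delta_int (of_int (int i) / real a) = (if i = 0 then 1 else 0)"
      using assms by (auto simp: delta_int_def)
  qed
  also have "\<dots> = 1" using assms by simp
  finally show ?thesis using True by (simp add: delta_int_def)
qed

text \<open>The sum over i leaves the argument a x - a l / b. The residues a l modulo b are the
  multiples of gcd(a,b), each taken gcd(a,b) times, so a second distribution relation over b /
  gcd(a,b) points produces the slope lcm(a,b).\<close>

lemma bernoulli_fun_double_sum:
  assumes "a > 0" "b > 0"
  shows "(\<Sum>i<a. \<Sum>l<b. bernoulli_fun n (x + real i / real a - real l / real b)) =
    real a * real b * real (gcd a b) ^ n / (real a * real b) ^ n *
      bernoulli_fun n (real (a * b div gcd a b) * x)"
proof -
  define e where "e = gcd a b"
  define b' where "b' = b div e"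
  have e: "e > 0" "b = e * b'" using assms by (simp_all add: e_def b'_def)
  have b': "b' > 0" using e assms by (cases b') auto
  have per: "bernoulli_fun n (y - of_int (i + int b) / real b) = bernoulli_fun n (y - of_int i / real b)"
    for y i
  proof -
    have "y - of_int (i + int b) / real b = y - of_int i / real b - of_int 1"
      using assms by (simp add: field_simps)
    then show ?thesis by (simp only: bernoulli_fun_add_int)
  qed
  have per': "bernoulli_fun n (y - of_int (int e * (i + int b')) / real b) = bernoulli_fun n (y - of_int (int e * i) / real b)"
    for y i
    using per[of y "int e * i"] by (simp add: e(2) algebra_simps)
  have "(\<Sum>i<a. \<Sum>l<b. bernoulli_fun n (x + real i / real a - real l / real b)) =
    (\<Sum>l<b. \<Sum>i<a. bernoulli_fun n ((x - real l / real b) + real i / real a))"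
    by (subst sum.swap) (simp add: algebra_simps)
  also have "\<dots> = real a / real a ^ n * (\<Sum>l<b. bernoulli_fun n (real a * x - of_int (int (a * l)) / real b))"
    by (simp add: bernoulli_fun_distribution[OF assms(1)] sum_distrib_left right_diff_distrib)
  also have "(\<Sum>l<b. bernoulli_fun n (real a * x - of_int (int (a * l)) / real b)) =
      real e * (\<Sum>l<b'. bernoulli_fun n (real a * x - of_int (int (e * l)) / real b))"
    using sum_residues_mult[of b a "\<lambda>i. bernoulli_fun n (real a * x - of_int i / real b)", OF assms(2,1) per]
    by (simp add: e_def b'_def)
  also have "(\<Sum>l<b'. bernoulli_fun n (real a * x - of_int (int (e * l)) / real b)) =
     (\<Sum>l<b'. bernoulli_fun n (real a * x - of_int (int e * - int l) / real b))"
    using sum_residues_uminus[of b' "\<lambda>i. bernoulli_fun n (real a * x - of_int (int e * i) / real b)", OF b' per']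
    by simp
  also have "\<dots> = (\<Sum>l<b'. bernoulli_fun n (real a * x + real l / real b'))"
    using e b' by (intro sum.cong) (auto simp: e(2))
  also have "\<dots> = real b' / real b' ^ n * bernoulli_fun n (real b' * (real a * x))"
    using bernoulli_fun_distribution[OF b'] by simp
  also have "real b' * (real a * x) = real (a * b div gcd a b) * x"
  proof -
    have "a * b div e = a * b'" using e(1) by (simp add: e(2))
    then show ?thesis by (simp add: e_def)
  qed
  also have "real a / real a ^ n * (real e * (real b' / real b' ^ n * bernoulli_fun n (real (a * b div gcd a b) * x))) =
    real a * real b * real e ^ n / (real a * real b) ^ n * bernoulli_fun n (real (a * b div gcd a b) * x)"
    using e b' by (simp add: e(2) power_mult_distrib)
  finally show ?thesis by (simp add: e_def)
qed

section \<open>The product formula with slopes, and its sum over residues\<close>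

text \<open>For d = 1 this is one half of the expansion of the product at a x and b y, namely the
  half in x - y and y; for general d it is the mean of that half over the common shifts of x and y
  by k/d. It is a generalised Dedekind sum.\<close>

definition recip_sum :: "nat \<Rightarrow> nat \<Rightarrow> nat \<Rightarrow> nat \<Rightarrow> nat \<Rightarrow> real \<Rightarrow> real \<Rightarrow> real" where
  "recip_sum m n d a b x y =
     (\<Sum>j\<le>m. real n * real (m choose j) / real (m + n - j) * real b ^ (n - 1) * real a ^ (m - j) / real d ^ (m + n - j) *
       (\<Sum>l<b. bernoulli_fun j (real a * (x - y - real l / real b)) *
          bernoulli_fun (m + n - j) (real d * (y + real l / real b))))"

text \<open>The term in the difference alone after summation over all shifts i/a and l/b;
  \<open>a * b div gcd a b\<close> is the least common multiple.\<close>

definition recip_const :: "nat \<Rightarrow> nat \<Rightarrow> nat \<Rightarrow> nat \<Rightarrow> real \<Rightarrow> real" where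
  "recip_const m n a b x = (-1) ^ (n + 1) * fact m * fact n / fact (m + n) *
     (real (gcd a b) ^ (m + n) / (real a ^ n * real b ^ m)) * bernoulli_fun (m + n) (real (a * b div gcd a b) * x)"

text \<open>The index i occurs only in the factor that contains the difference, so the distribution
  relation collapses the sum over i.\<close>

lemma recip_sum_aux:
  assumes "a > 0" "b > 0" "m \<ge> 1" "n \<ge> 1"
  shows "real a ^ (m - 1) * real b ^ (n - 1) * (\<Sum>i<a. \<Sum>l<b.
      (\<Sum>j\<le>m. real n * real (m choose j) / real (m + n - j) *
      bernoulli_fun j ((x + real i / real a) - (y + real l / real b)) * bernoulli_fun (m + n - j) (y + real l / real b))) =
    recip_sum m n 1 a b x y"
proof -
  have "(\<Sum>i<a. \<Sum>l<b.
      (\<Sum>j\<le>m. real n * real (m choose j) / real (m + n - j) *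
      bernoulli_fun j ((x + real i / real a) - (y + real l / real b)) * bernoulli_fun (m + n - j) (y + real l / real b))) =
    (\<Sum>j\<le>m. \<Sum>l<b. \<Sum>i<a. real n * real (m choose j) / real (m + n - j) *
      bernoulli_fun j ((x + real i / real a) - (y + real l / real b)) * bernoulli_fun (m + n - j) (y + real l / real b))"
    by (subst sum.swap, subst sum.swap[of _ _ "{..<a}"], subst sum.swap) (rule refl)
  also have "\<dots> = (\<Sum>j\<le>m. \<Sum>l<b. real n * real (m choose j) / real (m + n - j) * (real a / real a ^ j) *
      bernoulli_fun j (real a * (x - y - real l / real b)) * bernoulli_fun (m + n - j) (y + real l / real b))"
  proof (intro sum.cong refl)
    fix j l
    have "(\<Sum>i<a. bernoulli_fun j ((x + real i / real a) - (y + real l / real b))) =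
        real a / real a ^ j * bernoulli_fun j (real a * (x - y - real l / real b))"
      using bernoulli_fun_distribution[OF assms(1), of j "x - y - real l / real b"]
      by (simp add: algebra_simps)
    then show "(\<Sum>i<a. real n * real (m choose j) / real (m + n - j) *
      bernoulli_fun j ((x + real i / real a) - (y + real l / real b)) * bernoulli_fun (m + n - j) (y + real l / real b)) =
       real n * real (m choose j) / real (m + n - j) * (real a / real a ^ j) *
      bernoulli_fun j (real a * (x - y - real l / real b)) * bernoulli_fun (m + n - j) (y + real l / real b)"
      by (simp only: sum_distrib_left[symmetric] sum_distrib_right[symmetric] mult.assoc)
  qed
  finally have "real a ^ (m - 1) * real b ^ (n - 1) * (\<Sum>i<a. \<Sum>l<b.
      (\<Sum>j\<le>m. real n * real (m choose j) / real (m + n - j) *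
      bernoulli_fun j ((x + real i / real a) - (y + real l / real b)) * bernoulli_fun (m + n - j) (y + real l / real b))) =
     real a ^ (m - 1) * real b ^ (n - 1) * (\<Sum>j\<le>m. \<Sum>l<b. real n * real (m choose j) / real (m + n - j) * (real a / real a ^ j) *
      bernoulli_fun j (real a * (x - y - real l / real b)) * bernoulli_fun (m + n - j) (y + real l / real b))"
    by simp
  also have "\<dots> = recip_sum m n 1 a b x y"
    unfolding recip_sum_def sum_distrib_left
  proof (intro sum.cong refl)
    fix j l assume "j \<in> {..m}"
    then have "real a ^ (m - 1) * (real a / real a ^ j) = real a ^ (m - j)"
      using assms by (cases m) (auto simp: power_diff)
    then show "real a ^ (m - 1) * real b ^ (n - 1) * (real n * real (m choose j) / real (m + n - j) * (real a / real a ^ j) *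
      bernoulli_fun j (real a * (x - y - real l / real b)) * bernoulli_fun (m + n - j) (y + real l / real b)) =
      real n * real (m choose j) / real (m + n - j) * real b ^ (n - 1) * real a ^ (m - j) / real 1 ^ (m + n - j) *
       (bernoulli_fun j (real a * (x - y - real l / real b)) * bernoulli_fun (m + n - j) (real 1 * (y + real l / real b)))"
      by (simp only: flip: \<open>real a ^ (m - 1) * (real a / real a ^ j) = real a ^ (m - j)\<close>) simp
  qed
  finally show ?thesis .
qed

text \<open>Both factors are spread over shifts, the slope-one formula is applied to each pair, and
  every part is collapsed again: one half over i, the other over l, the difference term by the
  double sum, the correction by \<open>delta_int_scale\<close>.\<close>

theorem bernoulli_fun_mult_scaled:
  assumes "a > 0" "b > 0" "m \<ge> 1" "n \<ge> 1"
  shows "bernoulli_fun m (real a * x) * bernoulli_fun n (real b * y) =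
    recip_sum m n 1 a b x y + recip_sum n m 1 b a y x + recip_const m n a b (x - y) -
    (if m = 1 \<and> n = 1 then delta_int (real a * x) * delta_int (real b * y) / 4 else 0)"
proof -
  let ?X = "\<lambda>i. x + real i / real a" and ?Y = "\<lambda>l. y + real l / real b"
  let ?K = "real a ^ (m - 1) * real b ^ (n - 1)"
  have "bernoulli_fun m (real a * x) * bernoulli_fun n (real b * y) =
     ?K * (\<Sum>i<a. \<Sum>l<b. bernoulli_fun m (?X i) * bernoulli_fun n (?Y l))"
    using assms by (simp add: bernoulli_fun_scale sum_product)
  also have "\<dots> = ?K * ((\<Sum>i<a. \<Sum>l<b. (\<Sum>j\<le>m. real n * real (m choose j) / real (m + n - j) *
      bernoulli_fun j (?X i - ?Y l) * bernoulli_fun (m + n - j) (?Y l))) +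
      (\<Sum>i<a. \<Sum>l<b. (\<Sum>j\<le>n. real m * real (n choose j) / real (m + n - j) *
      bernoulli_fun j (?Y l - ?X i) * bernoulli_fun (m + n - j) (?X i))) +
      (\<Sum>i<a. \<Sum>l<b. (-1) ^ (n + 1) * fact m * fact n / fact (m + n) * bernoulli_fun (m + n) (?X i - ?Y l)) -
      (\<Sum>i<a. \<Sum>l<b. (if m = 1 \<and> n = 1 \<and> ?X i \<in> \<int> \<and> ?Y l \<in> \<int> then 1 / 4 else 0)))"
    by (simp only: bernoulli_fun_mult[OF assms(3,4)] sum.distrib sum_subtractf)
  also have "\<dots> = ?K * (\<Sum>i<a. \<Sum>l<b. (\<Sum>j\<le>m. real n * real (m choose j) / real (m + n - j) *
      bernoulli_fun j (?X i - ?Y l) * bernoulli_fun (m + n - j) (?Y l))) +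
      ?K * (\<Sum>l<b. \<Sum>i<a. (\<Sum>j\<le>n. real m * real (n choose j) / real (m + n - j) *
      bernoulli_fun j (?Y l - ?X i) * bernoulli_fun (m + n - j) (?X i))) +
      ?K * ((-1) ^ (n + 1) * fact m * fact n / fact (m + n) * (\<Sum>i<a. \<Sum>l<b. bernoulli_fun (m + n) (?X i - ?Y l))) -
      ?K * (\<Sum>i<a. \<Sum>l<b. (if m = 1 \<and> n = 1 \<and> ?X i \<in> \<int> \<and> ?Y l \<in> \<int> then 1 / 4 else 0))"
    by (subst sum.swap[of _ "{..<b}"]) (simp only: distrib_left right_diff_distrib sum_distrib_left)
  also have "?K * (\<Sum>i<a. \<Sum>l<b. (\<Sum>j\<le>m. real n * real (m choose j) / real (m + n - j) *
      bernoulli_fun j (?X i - ?Y l) * bernoulli_fun (m + n - j) (?Y l))) = recip_sum m n 1 a b x y"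
    using recip_sum_aux[OF assms] .
  also have "?K * (\<Sum>l<b. \<Sum>i<a. (\<Sum>j\<le>n. real m * real (n choose j) / real (m + n - j) *
      bernoulli_fun j (?Y l - ?X i) * bernoulli_fun (m + n - j) (?X i))) = recip_sum n m 1 b a y x"
    using recip_sum_aux[OF assms(2,1,4,3), of y x] by (simp only: add.commute[of n m] mult.commute[of "real b ^ (n - 1)"])
  also have "?K * ((-1) ^ (n + 1) * fact m * fact n / fact (m + n) * (\<Sum>i<a. \<Sum>l<b. bernoulli_fun (m + n) (?X i - ?Y l))) =
      recip_const m n a b (x - y)"
  proof -
    have k1: "?K * (real a * real b * real (gcd a b) ^ (m + n) / (real a * real b) ^ (m + n)) =
        real (gcd a b) ^ (m + n) / (real a ^ n * real b ^ m)"
      using assms by (cases m; cases n) (auto simp: power_add power_mult_distrib field_simps)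
    have "(\<Sum>i<a. \<Sum>l<b. bernoulli_fun (m + n) (?X i - ?Y l)) =
       real a * real b * real (gcd a b) ^ (m + n) / (real a * real b) ^ (m + n) *
      bernoulli_fun (m + n) (real (a * b div gcd a b) * (x - y))"
      using bernoulli_fun_double_sum[OF assms(1,2), of "m + n" "x - y"] by (simp add: algebra_simps)
    then show ?thesis
      unfolding recip_const_def by (simp only: mult_ac flip: k1)
  qed
  also have "?K * (\<Sum>i<a. \<Sum>l<b. (if m = 1 \<and> n = 1 \<and> ?X i \<in> \<int> \<and> ?Y l \<in> \<int> then 1 / 4 else 0)) =
      (if m = 1 \<and> n = 1 then delta_int (real a * x) * delta_int (real b * y) / 4 else 0)"
  proof (cases "m = 1 \<and> n = 1")
    case True
    have "(\<Sum>i<a. \<Sum>l<b. (if ?X i \<in> \<int> \<and> ?Y l \<in> \<int> then 1 / 4 else 0)) =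
        (\<Sum>i<a. \<Sum>l<b. delta_int (?X i) * delta_int (?Y l)) / (4::real)"
      unfolding sum_divide_distrib by (intro sum.cong) (auto simp: delta_int_def)
    also have "\<dots> = delta_int (real a * x) * delta_int (real b * y) / 4"
      using assms by (simp add: delta_int_scale flip: sum_product)
    finally show ?thesis using True by simp
  qed auto
  finally show ?thesis .
qed

text \<open>A common shift k/d does not change x - y, so the sum over k reaches only the second
  factor and gives it the slope d.\<close>

lemma sum_recip_sum:
  assumes "d > 0"
  shows "(\<Sum>k<d. recip_sum m n 1 a b (real k / real d + x) (real k / real d + y)) =
    real d * recip_sum m n d a b x y"
proof -
  have "(\<Sum>k<d. recip_sum m n 1 a b (real k / real d + x) (real k / real d + y)) =
    (\<Sum>j\<le>m. real n * real (m choose j) / real (m + n - j) * real b ^ (n - 1) * real a ^ (m - j) *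
       (\<Sum>l<b. bernoulli_fun j (real a * (x - y - real l / real b)) *
         (\<Sum>k<d. bernoulli_fun (m + n - j) ((y + real l / real b) + real k / real d))))"
    unfolding recip_sum_def sum_distrib_left
    by (subst sum.swap, rule sum.cong[OF refl], subst sum.swap) (simp add: algebra_simps)
  also have "\<dots> = real d * recip_sum m n d a b x y"
    unfolding recip_sum_def sum_distrib_left bernoulli_fun_distribution[OF assms]
    by (intro sum.cong refl) (simp add: mult_ac)
  finally show ?thesis .
qed

text \<open>The single tool behind all expansions below: it serves for the index pairs (m2, m3),
  (m1, j) and (m1, m2 + m3).\<close>

theorem sum_bernoulli_fun_mult:
  assumes "a > 0" "b > 0" "d > 0" "m \<ge> 1" "n \<ge> 1"
  shows "(\<Sum>k<d. bernoulli_fun m (real a * (real k / real d + x)) * bernoulli_fun n (real b * (real k / real d + y))) =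
    real d * (recip_sum m n d a b x y + recip_sum n m d b a y x + recip_const m n a b (x - y)) -
    (if m = 1 \<and> n = 1 then (\<Sum>k<d. delta_int (real a * (real k / real d + x)) * delta_int (real b * (real k / real d + y))) / 4 else 0)"
  unfolding bernoulli_fun_mult_scaled[OF assms(1,2,4,5)] sum.distrib sum_subtractf sum_recip_sum[OF assms(3)]
  by (auto simp: distrib_left sum_divide_distrib)

lemma bernoulli_fun_add_of_nat [simp]:
  "bernoulli_fun n (x + real k) = bernoulli_fun n x"
  "bernoulli_fun n (real k + x) = bernoulli_fun n x"
  using bernoulli_fun_add_int(1)[of n x "int k"] by (simp_all add: add.commute)

lemma recip_sum_translate:
  assumes "d > 0"
  shows "recip_sum m n d a b (x + real k / real d) (y + real k / real d) = recip_sum m n d a b x y"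
proof -
  have "real d * (y + real k / real d + z) = real d * (y + z) + real k" for z
    using assms by (simp add: field_simps)
  then show ?thesis by (simp add: recip_sum_def)
qed

text \<open>Reflect l to -l; the signs \<open>(-1) ^ j\<close> and \<open>(-1) ^ (m + n - j)\<close>
  combine to one that is independent of j.\<close>

lemma recip_sum_uminus:
  assumes "b > 0"
  shows "recip_sum m n d a b (- x) (- y) = (-1) ^ (m + n) * recip_sum m n d a b x y"
  unfolding recip_sum_def sum_distrib_left[where A = "{..m}"]
proof (rule sum.cong[OF refl], goal_cases)
  case (1 j)
  then have j: "j \<le> m" by simp
  define g :: "int \<Rightarrow> real" where
    "g i = bernoulli_fun j (real a * (x - y - of_int i / real b)) *
           bernoulli_fun (m + n - j) (real d * (y + of_int i / real b))" for i
  have per: "g (i + int b) = g i" for i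
  proof -
    have "real a * (x - y - of_int (i + int b) / real b) = real a * (x - y - of_int i / real b) - of_int (int a)"
      "real d * (y + of_int (i + int b) / real b) = real d * (y + of_int i / real b) + of_int (int d)"
      using assms by (simp_all add: field_simps)
    then show ?thesis unfolding g_def by (simp only: bernoulli_fun_add_int)
  qed
  have sgn: "(-1) ^ j * (-1) ^ (m + n - j) = ((-1) ^ (m + n) :: real)"
    using j by (simp flip: power_add)
  have "bernoulli_fun j (real a * (- x - - y - real l / real b)) *
      bernoulli_fun (m + n - j) (real d * (- y + real l / real b)) =
      (-1) ^ (m + n) * g (- int l)" for l
  proof -
    have "real a * (- x - - y - real l / real b) = - (real a * (x - y - of_int (- int l) / real b))"
      "real d * (- y + real l / real b) = - (real d * (y + of_int (- int l) / real b))"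
      by (simp_all add: algebra_simps)
    then show ?thesis
      unfolding g_def sgn[symmetric] by (simp only: bernoulli_fun_minus mult_ac)
  qed
  then have "(\<Sum>l<b. bernoulli_fun j (real a * (- x - - y - real l / real b)) *
      bernoulli_fun (m + n - j) (real d * (- y + real l / real b))) = (-1) ^ (m + n) * (\<Sum>l<b. g (- int l))"
    by (simp add: sum_distrib_left)
  also have "(\<Sum>l<b. g (- int l)) = (\<Sum>l<b. g (int l))"
    by (rule sum_residues_uminus[of b g, OF assms per])
  finally show ?case
    by (simp add: g_def mult_ac)
qed

section \<open>The terms of the formula for a single divisor d\<close>

text \<open>The part of \<open>A_term\<close> that belongs to one divisor d, without its Moebius
  weight; likewise for the next four definitions. Sums start at 0 instead of 1, which periodicity
  allows and which suits residues.\<close>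

definition A_div :: "nat \<Rightarrow> nat \<Rightarrow> nat \<Rightarrow> nat \<Rightarrow> nat \<Rightarrow> nat \<Rightarrow> nat \<Rightarrow> real" where
  "A_div m1 m2 m3 d a b c =
     real m3 * real b ^ (m2 - 1) * real c ^ (m3 - 1) *
     (\<Sum>j = 1..m2. real (m2 choose j) * ((-1) ^ j * real j / real (m2 + m3 - j)) *
        (\<Sum>j1 = 0..m1. real (m1 choose j1) * ((-1) ^ j1 * real a ^ (m1 - j1) / real (m1 + j - j1)) *
           (\<Sum>l<c. \<Sum>l1<b.
              bernoulli_fun j1 (real a * real l1 / real b + real a * real l / real c) *
              (real d ^ j1 * bernoulli_fun (m2 + m3 - j) (real d * real l / real c) *
                 bernoulli_fun (m1 + j - j1) (real d * real l1 / real b + real d * real l / real c)))))"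

definition B_div :: "nat \<Rightarrow> nat \<Rightarrow> nat \<Rightarrow> nat \<Rightarrow> nat \<Rightarrow> nat \<Rightarrow> nat \<Rightarrow> real" where
  "B_div m1 m2 m3 d a b c =
     real m1 * real m2 * real a ^ (m1 - 1) * real b ^ (m2 - 1) *
     (\<Sum>j = 1..m3. real (m3 choose j) * (1 / real (m2 + m3 - j)) *
        (\<Sum>j1 = 0..j. real (j choose j1) * ((-1) ^ j1 * real c ^ (m3 - j1) / real (m1 + j - j1)) *
           (\<Sum>l<b. \<Sum>l1<a.
              bernoulli_fun j1 (real c * real l1 / real a + real c * real l / real b) *
              (real d ^ j1 * bernoulli_fun (m2 + m3 - j) (real d * real l / real b) *
                 bernoulli_fun (m1 + j - j1) (real d * real l1 / real a)))))"

definition C_div :: "nat \<Rightarrow> nat \<Rightarrow> nat \<Rightarrow> nat \<Rightarrow> nat \<Rightarrow> nat \<Rightarrow> nat \<Rightarrow> real" where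
  "C_div m1 m2 m3 d a b c =
     - (real m2 * fact m1 * real b ^ (m2 - 1) * real (gcd a c) ^ m1 / real c ^ m1) *
     (\<Sum>j = 1..m3. real (m3 choose j) *
          ((-1) ^ j * real (gcd a c) ^ j * real c ^ (m3 - j) * fact j /
             (real a ^ j * real (m2 + m3 - j) * fact (m1 + j))) *
        (\<Sum>l<b.
           bernoulli_fun (m1 + j) (real a * real c * real l / (real (gcd a c) * real b)) *
           (real d ^ (m1 + j) * bernoulli_fun (m2 + m3 - j) (real d * real l / real b))))"

definition D_div :: "nat \<Rightarrow> nat \<Rightarrow> nat \<Rightarrow> nat \<Rightarrow> nat \<Rightarrow> nat \<Rightarrow> real" where
  "D_div m1 m2 m3 d b c =
     kronecker_delta 1 m1 * real m2 * real m3 * real b ^ (m2 - 1) * real c ^ (m3 - 1) /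
       (4 * real (m2 + m3 - 1)) *
     (real d ^ m1 * (\<Sum>l<b. bernoulli_fun (m2 + m3 - 1) (real d * real l / real b) *
           delta_int (real c * real l / real b)))"

definition R_div :: "nat \<Rightarrow> nat \<Rightarrow> nat \<Rightarrow> nat \<Rightarrow> nat \<Rightarrow> real" where
  "R_div m n d a b =
     real n * real b ^ (n - 1) *
     (\<Sum>j = 0..m. real (m choose j) * ((-1) ^ j * real a ^ (m - j) / real (m + n - j)) *
        (\<Sum>l<b. bernoulli_fun j (real a * real l / real b) *
           (real d ^ j * bernoulli_fun (m + n - j) (real d * real l / real b))))"

text \<open>The coefficient that the product formula for \<open>B\<^bsub>m2\<^esub> B\<^bsub>m3\<^esub>\<close>, summed over residues modulo
  \<open>d\<close>, attaches to its \<open>j\<close>-th term.\<close>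

definition outer_coeff :: "nat \<Rightarrow> nat \<Rightarrow> nat \<Rightarrow> nat \<Rightarrow> nat \<Rightarrow> nat \<Rightarrow> real" where
  "outer_coeff m2 m3 d b c j = (-1) ^ j * (real m3 * real (m2 choose j) / real (m2 + m3 - j) *
     real c ^ (m3 - 1) * real b ^ (m2 - j) / real d ^ (m2 + m3 - j))"

lemma recip_sum_swap_order:
  "(\<Sum>l<c. f l * recip_sum m n d a b (x l) (y l)) =
     (\<Sum>j\<le>m. real n * real (m choose j) / real (m + n - j) * real b ^ (n - 1) * real a ^ (m - j) / real d ^ (m + n - j) *
       (\<Sum>l<c. \<Sum>l1<b. f l * (bernoulli_fun j (real a * (x l - y l - real l1 / real b)) *
          bernoulli_fun (m + n - j) (real d * (y l + real l1 / real b)))))"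
  unfolding recip_sum_def sum_distrib_left
  by (subst sum.swap) (simp only: mult_ac)

text \<open>The half of the second expansion in which the sum over residues acts on the factor of
  slope b. The factor j of A is the weight \<open>real n\<close> of \<open>recip_sum\<close> at n =
  j, \<open>(-1) ^ j1\<close> comes from negating the difference, and of d^(m1+m2+m3) only d^j1
  survives the denominators.\<close>

lemma A_div_eq:
  assumes "a > 0" "b > 0" "c > 0" "d > 0" "m1 \<ge> 1" "m2 \<ge> 1" "m3 \<ge> 1"
  shows "real d ^ (m1 + m2 + m3) * (\<Sum>j=1..m2. outer_coeff m2 m3 d b c j *
      (\<Sum>l<c. bernoulli_fun (m2 + m3 - j) (real d * real l / real c) *
        recip_sum m1 j d a b 0 (real l / real c))) = A_div m1 m2 m3 d a b c"
  unfolding A_div_def recip_sum_swap_order sum_distrib_left atLeast0AtMost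
proof (intro sum.cong refl, goal_cases)
  case (1 j j1 l l1)
  then have j: "1 \<le> j" "j \<le> m2" "j1 \<le> m1" by auto
  let ?z = "real a * real l1 / real b + real a * real l / real c"
  have arg: "real a * (0 - real l / real c - real l1 / real b) = - ?z"
    "real d * (real l / real c + real l1 / real b) = real d * real l1 / real b + real d * real l / real c"
    by (simp_all add: algebra_simps)
  have "m1 + m2 + m3 = j1 + (m2 + m3 - j) + (m1 + j - j1)" using j by simp
  then have dp: "real d ^ (m1 + m2 + m3) = real d ^ j1 * real d ^ (m2 + m3 - j) * real d ^ (m1 + j - j1)"
    by (metis power_add)
  have "m2 - 1 = (m2 - j) + (j - 1)" using j by simp
  then have bp: "real b ^ (m2 - 1) = real b ^ (m2 - j) * real b ^ (j - 1)" by (metis power_add)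
  show ?case
    unfolding arg bernoulli_fun_minus dp bp outer_coeff_def using assms by simp
qed

text \<open>The other half, with l1 running modulo a. Reflection contributes
  \<open>(-1) ^ (m1 + j)\<close>, which cancels the outer \<open>(-1) ^ j\<close> and leaves
  \<open>(-1) ^ m1\<close>; hence the order (m2, m3) of the first expansion yields B with m2, m3 and
  b, c interchanged.\<close>

lemma B_div_eq:
  assumes "a > 0" "b > 0" "c > 0" "d > 0" "m1 \<ge> 1" "m2 \<ge> 1" "m3 \<ge> 1"
  shows "real d ^ (m1 + m2 + m3) * (\<Sum>j=1..m2. outer_coeff m2 m3 d b c j *
      (\<Sum>l<c. bernoulli_fun (m2 + m3 - j) (real d * real l / real c) *
        recip_sum j m1 d b a (real l / real c) 0)) = (-1) ^ m1 * B_div m1 m3 m2 d a c b"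
proof -
  have "recip_sum j m1 d b a (real l / real c) 0 = (-1) ^ (m1 + j) * recip_sum j m1 d b a (- (real l / real c)) 0" for j l
    using recip_sum_uminus[OF assms(1), of j m1 d b "- (real l / real c)" 0]
    by (simp add: add.commute)
  then have "real d ^ (m1 + m2 + m3) * (\<Sum>j=1..m2. outer_coeff m2 m3 d b c j *
      (\<Sum>l<c. bernoulli_fun (m2 + m3 - j) (real d * real l / real c) *
        recip_sum j m1 d b a (real l / real c) 0)) =
     real d ^ (m1 + m2 + m3) * (\<Sum>j=1..m2. outer_coeff m2 m3 d b c j *
      (\<Sum>l<c. ((-1) ^ (m1 + j) * bernoulli_fun (m2 + m3 - j) (real d * real l / real c)) *
        recip_sum j m1 d b a (- (real l / real c)) 0))"
    by (simp add: mult_ac)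
  also have "\<dots> = (-1) ^ m1 * B_div m1 m3 m2 d a c b"
    unfolding B_div_def recip_sum_swap_order sum_distrib_left atLeast0AtMost
  proof (intro sum.cong refl, goal_cases)
    case (1 j j1 l l1)
    then have j: "1 \<le> j" "j \<le> m2" "j1 \<le> j" by auto
    let ?z = "real b * real l1 / real a + real b * real l / real c"
    have arg: "real b * (- (real l / real c) - 0 - real l1 / real a) = - ?z"
      "real d * (0 + real l1 / real a) = real d * real l1 / real a"
      by (simp_all add: algebra_simps)
    have "m1 + m2 + m3 = j1 + (m2 + m3 - j) + (j + m1 - j1)" using j by simp
    then have dp: "real d ^ (m1 + m2 + m3) = real d ^ j1 * real d ^ (m2 + m3 - j) * real d ^ (j + m1 - j1)"
      by (metis power_add)
    have "m2 - j1 = (m2 - j) + (j - j1)" using j by simp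
    then have bp: "real b ^ (m2 - j1) = real b ^ (m2 - j) * real b ^ (j - j1)" by (metis power_add)
    have sgn: "(-1) ^ j * (-1) ^ (m1 + j) = ((-1) ^ m1 :: real)"
      by (simp add: power_add mult_ac)
    show ?case
      unfolding arg bernoulli_fun_minus dp bp outer_coeff_def sgn[symmetric] using assms
      by (simp add: add.commute[of m3 m2] add.commute[of m1 j])
  qed
  finally show ?thesis .
qed

text \<open>The difference term of the second expansion. Its sign \<open>(-1) ^ (j + 1)\<close> and
  the parity of the factor of index m1 + j combine to \<open>- ((-1) ^ m1)\<close>, so the outer
  \<open>(-1) ^ j\<close> remains, as in C.\<close>

lemma C_div_eq:
  assumes "a > 0" "b > 0" "c > 0" "d > 0" "m1 \<ge> 1" "m2 \<ge> 1" "m3 \<ge> 1"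
  shows "real d ^ (m1 + m2 + m3) * (\<Sum>j=1..m2. outer_coeff m2 m3 d b c j *
      (\<Sum>l<c. bernoulli_fun (m2 + m3 - j) (real d * real l / real c) *
        recip_const m1 j a b (0 - real l / real c))) = (-1) ^ m1 * C_div m1 m3 m2 d a c b"
  unfolding C_div_def sum_distrib_left
proof (intro sum.cong refl, goal_cases)
  case (1 j l)
  then have j: "1 \<le> j" "j \<le> m2" by auto
  have arg: "real (a * b div gcd a b) * (0 - real l / real c) = - (real a * real b * real l / (real (gcd a b) * real c))"
    by (simp add: real_of_nat_div)
  have "m1 + m2 + m3 = (m1 + j) + (m2 + m3 - j)" using j by simp
  then have dp: "real d ^ (m1 + m2 + m3) = real d ^ (m1 + j) * real d ^ (m2 + m3 - j)"
    by (metis power_add)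
  have sgn: "(-1) ^ (j + 1) * (-1) ^ (m1 + j) = (- ((-1) ^ m1) :: real)"
    by (simp add: power_add mult_ac)
  have "(-1) ^ (j + 1) * bernoulli_fun (m1 + j) (- z) = - ((-1) ^ m1) * bernoulli_fun (m1 + j) z" for z
    unfolding bernoulli_fun_minus sgn[symmetric] by simp
  then have rc: "recip_const m1 j a b (0 - real l / real c) = - ((-1) ^ m1) * fact m1 * fact j / fact (m1 + j) *
     (real (gcd a b) ^ (m1 + j) / (real a ^ j * real b ^ m1)) * bernoulli_fun (m1 + j) (real a * real b * real l / (real (gcd a b) * real c))"
    unfolding recip_const_def arg by (simp add: mult_ac)
  show ?case
    unfolding rc dp outer_coeff_def using assms
    by (simp add: add.commute[of m3 m2] power_add mult_ac)
qed

text \<open>As a is coprime to d, a k / d is an integer only for k = 0, so the sum over k reduces to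
  one indicator. The power of d is one lower than for the other terms because the correction carries
  no factor d; the sign is \<open>(-1) ^ j\<close> at j = 1.\<close>

lemma D_div_eq:
  assumes "a > 0" "b > 0" "c > 0" "d > 0" "m1 \<ge> 1" "m2 \<ge> 1" "m3 \<ge> 1" "coprime a d"
  shows "real d ^ (m1 + m2 + m3 - 1) * (\<Sum>j=1..m2. outer_coeff m2 m3 d b c j *
      (\<Sum>l<c. bernoulli_fun (m2 + m3 - j) (real d * real l / real c) *
        (if m1 = 1 \<and> j = 1 then (\<Sum>k<d. delta_int (real a * (real k / real d + 0)) * delta_int (real b * (real k / real d + real l / real c))) / 4 else 0)))
    = - D_div m1 m3 m2 d c b"
proof (cases "m1 = 1")
  case False
  then show ?thesis by (simp add: D_div_def kronecker_delta_def)
next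
  case True
  have "delta_int (real a * (real k / real d + 0)) = (if k = 0 then 1 else 0)" if "k < d" for k
  proof -
    have "real a * (real k / real d) \<in> \<int> \<longleftrightarrow> k = 0"
    proof
      assume "real a * (real k / real d) \<in> \<int>"
      then obtain z where "real a * (real k / real d) = of_int z" by (elim Ints_cases)
      then have "real_of_int (int (a * k)) = real_of_int (z * int d)" using assms by (simp add: field_simps)
      then have "int (a * k) = z * int d" by linarith
      then have "int d dvd int (a * k)" by simp
      then have "d dvd a * k" by (simp only: int_dvd_int_iff)
      then have "d dvd k" using assms(8) by (simp add: coprime_dvd_mult_right_iff coprime_commute)
      then show "k = 0" using that by (auto dest: dvd_imp_le)
    qed auto
    then show ?thesis by (simp add: delta_int_def)
  qed
  then have S: "(\<Sum>k<d. delta_int (real a * (real k / real d + 0)) * delta_int (real b * (real k / real d + z))) =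
      delta_int (real b * z)" for z
  proof -
    assume *: "\<And>k. k < d \<Longrightarrow> delta_int (real a * (real k / real d + 0)) = (if k = 0 then 1 else 0)"
    have "(\<Sum>k<d. delta_int (real a * (real k / real d + 0)) * delta_int (real b * (real k / real d + z))) =
      (\<Sum>k<d. if k = 0 then delta_int (real b * z) else 0)"
    proof (intro sum.cong refl)
      fix k assume "k \<in> {..<d}"
      then show "delta_int (real a * (real k / real d + 0)) * delta_int (real b * (real k / real d + z)) =
        (if k = 0 then delta_int (real b * z) else 0)"
        using *[of k] by (cases "k = 0") simp_all
    qed
    then show ?thesis using assms by simp
  qed
  have "(\<Sum>j=1..m2. outer_coeff m2 m3 d b c j *
      (\<Sum>l<c. bernoulli_fun (m2 + m3 - j) (real d * real l / real c) *
        (if m1 = 1 \<and> j = 1 then (\<Sum>k<d. delta_int (real a * (real k / real d + 0)) * delta_int (real b * (real k / real d + real l / real c))) / 4 else 0)))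
    = (\<Sum>j=1..m2. if j = 1 then outer_coeff m2 m3 d b c 1 *
      (\<Sum>l<c. bernoulli_fun (m2 + m3 - 1) (real d * real l / real c) *
         delta_int (real b * (real l / real c)) / 4) else 0)"
    unfolding S by (intro sum.cong) (auto simp: True)
  also have "\<dots> = outer_coeff m2 m3 d b c 1 *
      (\<Sum>l<c. bernoulli_fun (m2 + m3 - 1) (real d * real l / real c) *
         delta_int (real b * (real l / real c)) / 4)"
    using assms by simp
  finally have E: "(\<Sum>j=1..m2. outer_coeff m2 m3 d b c j *
      (\<Sum>l<c. bernoulli_fun (m2 + m3 - j) (real d * real l / real c) *
        (if m1 = 1 \<and> j = 1 then (\<Sum>k<d. delta_int (real a * (real k / real d + 0)) * delta_int (real b * (real k / real d + real l / real c))) / 4 else 0))) =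
      outer_coeff m2 m3 d b c 1 *
      (\<Sum>l<c. bernoulli_fun (m2 + m3 - 1) (real d * real l / real c) *
         delta_int (real b * (real l / real c)) / 4)" .
  have dp: "real d ^ (m1 + m2 + m3 - 1) = real d * real d ^ (m2 + m3 - 1)"
    using True assms by (simp flip: power_Suc)
  show ?thesis
    unfolding E dp using assms
    by (simp add: D_div_def kronecker_delta_def True outer_coeff_def
         sum_divide_distrib[symmetric] add.commute[of m3 m2] mult_ac)
qed

lemma R_div_eq:
  assumes "a > 0" "b > 0" "d > 0" "m \<ge> 1" "n \<ge> 1"
  shows "real d ^ (m + n) * recip_sum m n d a b 0 0 = R_div m n d a b"
  unfolding R_div_def recip_sum_def sum_distrib_left atLeast0AtMost
proof (intro sum.cong refl, goal_cases)
  case (1 j l)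
  then have j: "j \<le> m" by auto
  have arg: "real a * (0 - 0 - real l / real b) = - (real a * real l / real b)"
    "real d * (0 + real l / real b) = real d * real l / real b"
    by simp_all
  have "m + n = j + (m + n - j)" using j by simp
  then have dp: "real d ^ (m + n) = real d ^ j * real d ^ (m + n - j)"
    by (metis power_add)
  show ?case
    unfolding arg bernoulli_fun_minus dp using assms by simp
qed

lemma sum_bernoulli_fun_coprime:
  assumes "n > 0" "coprime u n"
  shows "(\<Sum>i<n. bernoulli_fun N (real u * real i / real n)) = real n / real n ^ N * bernoulli_fun N 0"
proof -
  define g :: "int \<Rightarrow> real" where "g i = bernoulli_fun N (of_int i / real n)" for i
  have per: "g (i + int n) = g i" for i
  proof -
    have "of_int (i + int n) / real n = of_int i / real n + of_int 1"
      using assms by (simp add: field_simps)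
    then show ?thesis by (simp only: g_def bernoulli_fun_add_int)
  qed
  have "(\<Sum>i<n. bernoulli_fun N (real u * real i / real n)) = (\<Sum>i<n. g (int u * int i))"
    by (simp add: g_def)
  also have "\<dots> = (\<Sum>i<n. g (int i))"
    using sum_residues_coprime[of n g "int u", OF assms(1) per] assms(2) by simp
  also have "\<dots> = real n / real n ^ N * bernoulli_fun N 0"
    using bernoulli_fun_distribution[OF assms(1), of N 0] by (simp add: g_def)
  finally show ?thesis .
qed

section \<open>Second expansion and evaluation of the triple sum for one divisor\<close>

text \<open>In the factor of slope d the shift k/d becomes the integer k and disappears. Thus k
  survives only in the factor of index j, ready to be multiplied by the factor of index m1.\<close>

lemma recip_sum_outer:
  assumes "d > 0"
  shows "recip_sum m2 m3 d b c 0 (real k / real d) = (\<Sum>j\<le>m2. outer_coeff m2 m3 d b c j *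
     (\<Sum>l<c. bernoulli_fun (m2 + m3 - j) (real d * real l / real c) *
      bernoulli_fun j (real b * (real k / real d + real l / real c))))"
  unfolding recip_sum_def sum_distrib_left
proof (intro sum.cong refl, goal_cases)
  case (1 j l)
  have arg: "real b * (0 - real k / real d - real l / real c) = - (real b * (real k / real d + real l / real c))"
    "real d * (real k / real d + real l / real c) = real k + real d * real l / real c"
    using assms by (simp_all add: field_simps)
  show ?case
    unfolding arg bernoulli_fun_minus bernoulli_fun_add_of_nat outer_coeff_def by (simp add: mult_ac)
qed

text \<open>The contribution of j = 0, where the factor of index j is 1 and no second expansion
  takes place. What matters is that d does not occur.\<close>

definition reduction_const :: "nat \<Rightarrow> nat \<Rightarrow> nat \<Rightarrow> nat \<Rightarrow> nat \<Rightarrow> real" where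
  "reduction_const m1 m2 m3 b c = real m3 / real (m2 + m3) * real c ^ (m3 - 1) * real b ^ m2 *
     (real c / real c ^ (m2 + m3) * bernoulli_fun (m2 + m3) 0) * bernoulli_fun m1 0"

lemma recip_sum_reduction:
  assumes "a > 0" "b > 0" "c > 0" "d > 0" "m1 \<ge> 1" "m2 \<ge> 1" "m3 \<ge> 1" "coprime a d" "coprime c d"
  shows "real d ^ (m1 + m2 + m3 - 1) *
      (\<Sum>k<d. bernoulli_fun m1 (real a * (real k / real d)) * recip_sum m2 m3 d b c 0 (real k / real d)) =
    reduction_const m1 m2 m3 b c + A_div m1 m2 m3 d a b c + (-1) ^ m1 * B_div m1 m3 m2 d a c b +
      (-1) ^ m1 * C_div m1 m3 m2 d a c b + D_div m1 m3 m2 d c b"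
proof -
  define M where "M = m1 + m2 + m3"
  define q where "q = outer_coeff m2 m3 d b c"
  define f where "f j l = bernoulli_fun (m2 + m3 - j) (real d * real l / real c)" for j l
  define S where "S j l = (\<Sum>k<d. bernoulli_fun m1 (real a * (real k / real d + 0)) *
      bernoulli_fun j (real b * (real k / real d + real l / real c)))" for j l
  define V where "V j l = (if m1 = 1 \<and> j = 1 then (\<Sum>k<d. delta_int (real a * (real k / real d + 0)) *
      delta_int (real b * (real k / real d + real l / real c))) / 4 else 0)" for j l :: nat
  have dM: "real d ^ (M - 1) * real d = real d ^ M"
    using assms by (cases M) (auto simp: M_def)
  have "(\<Sum>k<d. bernoulli_fun m1 (real a * (real k / real d)) * recip_sum m2 m3 d b c 0 (real k / real d)) =
      (\<Sum>k<d. \<Sum>j\<le>m2. \<Sum>l<c. q j * (f j l * (bernoulli_fun m1 (real a * (real k / real d + 0)) *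
      bernoulli_fun j (real b * (real k / real d + real l / real c)))))"
    unfolding recip_sum_outer[OF assms(4)] sum_distrib_left q_def f_def
    by (intro sum.cong refl) (simp add: mult_ac)
  also have "\<dots> = (\<Sum>j\<le>m2. q j * (\<Sum>l<c. f j l * S j l))"
    unfolding S_def sum_distrib_left
    by (subst sum.swap, rule sum.cong[OF refl], subst sum.swap) (rule refl)
  \<comment> \<open>The product formula requires positive indices, so j = 0 is treated
    apart.\<close>
  also have "{..m2} = insert 0 {1..m2}" by auto
  also have "(\<Sum>j\<in>insert 0 {1..m2}. q j * (\<Sum>l<c. f j l * S j l)) =
      q 0 * (\<Sum>l<c. f 0 l * S 0 l) + (\<Sum>j=1..m2. q j * (\<Sum>l<c. f j l * S j l))"
    by simp
  also have "(\<Sum>j=1..m2. q j * (\<Sum>l<c. f j l * S j l)) =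
      (\<Sum>j=1..m2. q j * (\<Sum>l<c. f j l * (real d * (recip_sum m1 j d a b 0 (real l / real c) +
         recip_sum j m1 d b a (real l / real c) 0 + recip_const m1 j a b (0 - real l / real c)) - V j l)))"
    unfolding S_def V_def
  proof (intro sum.cong refl, goal_cases)
    case (1 j)
    then show ?case using assms by (subst sum_bernoulli_fun_mult) auto
  qed
  also have "\<dots> = real d * (\<Sum>j=1..m2. q j * (\<Sum>l<c. f j l * recip_sum m1 j d a b 0 (real l / real c))) +
      real d * (\<Sum>j=1..m2. q j * (\<Sum>l<c. f j l * recip_sum j m1 d b a (real l / real c) 0)) +
      real d * (\<Sum>j=1..m2. q j * (\<Sum>l<c. f j l * recip_const m1 j a b (0 - real l / real c))) -
      (\<Sum>j=1..m2. q j * (\<Sum>l<c. f j l * V j l))"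
    unfolding sum_distrib_left sum.distrib[symmetric] sum_subtractf[symmetric]
    by (intro sum.cong refl) (simp add: algebra_simps)
  finally have W: "(\<Sum>k<d. bernoulli_fun m1 (real a * (real k / real d)) * recip_sum m2 m3 d b c 0 (real k / real d)) =
      q 0 * (\<Sum>l<c. f 0 l * S 0 l) + \<dots>" .
  \<comment> \<open>For j = 0 the sum over k meets only the factor of index m1 and the sum over l
    only that of index m2 + m3. They are evaluated by coprimality of d to a and to c, and the powers
    of d balance exactly.\<close>
  have K: "real d ^ (M - 1) * (q 0 * (\<Sum>l<c. f 0 l * S 0 l)) = reduction_const m1 m2 m3 b c"
  proof -
    have S0: "S 0 l = real d / real d ^ m1 * bernoulli_fun m1 0" for l
      using sum_bernoulli_fun_coprime[OF assms(4,8), of m1] by (simp add: S_def)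
    have f0: "(\<Sum>l<c. f 0 l) = real c / real c ^ (m2 + m3) * bernoulli_fun (m2 + m3) 0"
      using sum_bernoulli_fun_coprime[OF assms(3), of d "m2 + m3"] assms(9)
      by (simp add: f_def coprime_commute)
    have one: "real d ^ (M - 1) * (real d / real d ^ m1) / real d ^ (m2 + m3) = 1"
      using dM assms(4) by (simp add: M_def power_add)
    have pull: "real d ^ (M - 1) * (q 0 * (X * (real d / real d ^ m1 * Y))) =
        (real d ^ (M - 1) * (real d / real d ^ m1) / real d ^ (m2 + m3)) *
        (real m3 / real (m2 + m3) * real c ^ (m3 - 1) * real b ^ m2 * X * Y)" for X Y
      by (simp add: q_def outer_coeff_def mult_ac)
    show ?thesis
      unfolding S0 sum_distrib_right[symmetric] f0 pull one by (simp add: reduction_const_def)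
  qed
  note eqs = A_div_eq[OF assms(1-7)] B_div_eq[OF assms(1-7)] C_div_eq[OF assms(1-7)]
    D_div_eq[OF assms(1-8)]
  note eqs' = eqs[folded M_def q_def f_def, folded V_def]
  have dM': "real d ^ (M - 1) * (real d * X) = real d ^ M * X" for X
    by (simp flip: dM)
  show ?thesis
    unfolding M_def[symmetric] W distrib_left right_diff_distrib dM' K eqs' by simp
qed

text \<open>The sum over k2 is expanded first, with the base points 0 and k1/d, and then the sum
  over k1. Each expansion supplies one factor d, which raises the exponent from M - 2 to M.\<close>

theorem triple_sum:
  assumes "a > 0" "b > 0" "c > 0" "d > 0" "m1 \<ge> 1" "m2 \<ge> 1" "m3 \<ge> 2" "even (m1 + m2 + m3)"
    and "coprime a d" "coprime b d" "coprime c d"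
  defines "L \<equiv> b * c div gcd b c" and "n \<equiv> m2 + m3"
  shows "real d ^ (m1 + m2 + m3 - 2) *
      (\<Sum>k1<d. \<Sum>k2<d. bernoulli_fun m1 (real a * (real k1 / real d)) *
        (bernoulli_fun m2 (real b * (real k2 / real d)) *
      bernoulli_fun m3 (real c * (real k2 / real d + real k1 / real d)))) =
    reduction_const m1 m2 m3 b c + (-1) ^ m1 * reduction_const m1 m3 m2 c b
    + A_div m1 m2 m3 d a b c + (-1) ^ m1 * A_div m1 m3 m2 d a c b
    + B_div m1 m2 m3 d a b c + (-1) ^ m1 * B_div m1 m3 m2 d a c b
    + C_div m1 m2 m3 d a b c + (-1) ^ m1 * C_div m1 m3 m2 d a c b
    - D_div m1 m2 m3 d b c + D_div m1 m3 m2 d c b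
    - (-1) ^ m2 * (fact m2 * fact m3 / fact n) * (real (gcd b c) ^ n / (real b ^ m3 * real c ^ m2)) *
      (R_div m1 n d a L + R_div n m1 d L a + real d ^ (m1 + n) * recip_const m1 n a L 0)"
proof -
  define M where "M = m1 + m2 + m3"
  define E where "E k = bernoulli_fun m1 (real a * (real k / real d))" for k
  \<comment> \<open>Coefficient of the difference term of the first expansion; negating the argument
    turns the sign \<open>(-1) ^ (m3 + 1)\<close> into \<open>(-1) ^ (m2 + 1)\<close>.\<close>
  define \<rho> where "\<rho> = (-1) ^ (m2 + 1) * (fact m2 * fact m3 / fact n) * (real (gcd b c) ^ n / (real b ^ m3 * real c ^ m2))"
  have M: "M = Suc (Suc (M - 2))" "M - 1 = Suc (M - 2)" using assms by (simp_all add: M_def)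
  have dM: "real d ^ (M - 2) * (real d * X) = real d ^ (M - 1) * X"
    "real d ^ (M - 1) * (real d * X) = real d ^ M * X" for X
    by (subst M(2), simp) (subst M(1), subst M(2), simp)
  have dist: "real d ^ (M - 2) * (real d * (X1 + s * X2 + \<rho> * (real d * Y))) =
      real d ^ (M - 1) * X1 + s * (real d ^ (M - 1) * X2) + \<rho> * (real d ^ M * Y)" for X1 X2 Y s
    unfolding dM(1) dM(2)[symmetric] by (simp add: algebra_simps)
  \<comment> \<open>D vanishes unless m1 = 1, where the sign is -1. This is why the two D terms
    enter the formula with opposite signs.\<close>
  have D: "(-1) ^ m1 * D_div m1 m2 m3 d b c = - D_div m1 m2 m3 d b c"
    by (cases "m1 = 1") (simp_all add: D_div_def kronecker_delta_def)
  have sq: "(-1) ^ m1 * ((-1) ^ m1 * X) = X" for X :: real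
    by (simp flip: mult.assoc power_add)
  have L: "L > 0"
    using assms by (simp add: L_def div_greater_zero_iff) (meson dvd_imp_le dvd_mult2 gcd_dvd1 nat_0_less_mult_iff)
  have sgn: "(-1) ^ (m2 + m3) = ((-1) ^ m1 :: real)"
    using assms(8) by (auto simp: minus_one_power_iff)
  have inner: "(\<Sum>k2<d. bernoulli_fun m2 (real b * (real k2 / real d)) *
      bernoulli_fun m3 (real c * (real k2 / real d + real k1 / real d))) =
      real d * (recip_sum m2 m3 d b c 0 (real k1 / real d) + (-1) ^ m1 * recip_sum m3 m2 d c b 0 (real k1 / real d) +
        \<rho> * bernoulli_fun n (real L * (real k1 / real d)))" for k1
  proof -
    \<comment> \<open>A reflection followed by a translation by k1/d moves the base points (k1/d, 0)
      of the second half to (0, k1/d), so that \<open>recip_sum_reduction\<close> serves both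
      halves. The parity of m1 + m2 + m3 rewrites the sign.\<close>
    have "recip_sum m3 m2 d c b (real k1 / real d) 0 = (-1) ^ (m3 + m2) * recip_sum m3 m2 d c b (- (real k1 / real d)) 0"
      using recip_sum_uminus[OF assms(2), of m3 m2 d c "- (real k1 / real d)" 0] by simp
    also have "recip_sum m3 m2 d c b (- (real k1 / real d)) 0 = recip_sum m3 m2 d c b 0 (real k1 / real d)"
      using recip_sum_translate[OF assms(4), of m3 m2 c b "- (real k1 / real d)" k1 0] by simp
    also have "(-1) ^ (m3 + m2) = ((-1) ^ m1 :: real)" using sgn by (simp add: add.commute)
    finally have r: "recip_sum m3 m2 d c b (real k1 / real d) 0 = (-1) ^ m1 * recip_sum m3 m2 d c b 0 (real k1 / real d)" .
    have neg: "real (b * c div gcd b c) * (0 - z) = - (real L * z)" for z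
      by (simp add: L_def)
    have sg: "(-1) ^ (m3 + 1) * (-1) ^ (m2 + m3) = ((-1) ^ (m2 + 1) :: real)"
      by (simp add: power_add mult_ac)
    have rc: "recip_const m2 m3 b c (0 - real k1 / real d) = \<rho> * bernoulli_fun n (real L * (real k1 / real d))"
      unfolding recip_const_def neg bernoulli_fun_minus \<rho>_def sg[symmetric] n_def by (simp add: mult_ac)
    show ?thesis
      using sum_bernoulli_fun_mult[OF assms(2,3,4,6), of m3 0 "real k1 / real d"] assms(7)
      unfolding r rc by simp
  qed
  have third: "(\<Sum>k<d. E k * bernoulli_fun n (real L * (real k / real d))) =
      real d * (recip_sum m1 n d a L 0 0 + recip_sum n m1 d L a 0 0 + recip_const m1 n a L 0)"
    using sum_bernoulli_fun_mult[OF assms(1) L assms(4,5), of n 0 0] assms(6,7)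
    by (simp add: E_def n_def)
  have "real d ^ (M - 2) * (\<Sum>k1<d. \<Sum>k2<d. E k1 *
        (bernoulli_fun m2 (real b * (real k2 / real d)) *
      bernoulli_fun m3 (real c * (real k2 / real d + real k1 / real d)))) =
     real d ^ (M - 2) * (\<Sum>k1<d. E k1 * (real d * (recip_sum m2 m3 d b c 0 (real k1 / real d) +
        (-1) ^ m1 * recip_sum m3 m2 d c b 0 (real k1 / real d) +
        \<rho> * bernoulli_fun n (real L * (real k1 / real d)))))"
    by (simp only: sum_distrib_left[symmetric] inner)
  also have "\<dots> = real d ^ (M - 2) * (real d * ((\<Sum>k<d. E k * recip_sum m2 m3 d b c 0 (real k / real d)) +
      (-1) ^ m1 * (\<Sum>k<d. E k * recip_sum m3 m2 d c b 0 (real k / real d)) +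
      \<rho> * (\<Sum>k<d. E k * bernoulli_fun n (real L * (real k / real d)))))"
    unfolding sum_distrib_left sum.distrib[symmetric]
    by (simp only: sum_distrib_left[symmetric] sum.distrib[symmetric] algebra_simps)
  also have "\<dots> = real d ^ (M - 1) * (\<Sum>k<d. E k * recip_sum m2 m3 d b c 0 (real k / real d)) +
      (-1) ^ m1 * (real d ^ (M - 1) * (\<Sum>k<d. E k * recip_sum m3 m2 d c b 0 (real k / real d))) +
      \<rho> * (real d ^ M * (recip_sum m1 n d a L 0 0 + recip_sum n m1 d L a 0 0 + recip_const m1 n a L 0))"
    unfolding third by (rule dist)
  also have "real d ^ M * (recip_sum m1 n d a L 0 0 + recip_sum n m1 d L a 0 0 + recip_const m1 n a L 0) =
      R_div m1 n d a L + R_div n m1 d L a + real d ^ (m1 + n) * recip_const m1 n a L 0"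
  proof -
    have "M = m1 + n" "n \<ge> 1" using assms by (simp_all add: M_def n_def)
    then show ?thesis
      using R_div_eq[OF assms(1) L assms(4,5), of n] R_div_eq[OF L assms(1,4) _ assms(5), of n]
      by (simp add: distrib_left add.commute[of n m1])
  qed
  also have "real d ^ (M - 1) * (\<Sum>k<d. E k * recip_sum m2 m3 d b c 0 (real k / real d)) =
    reduction_const m1 m2 m3 b c + A_div m1 m2 m3 d a b c + (-1) ^ m1 * B_div m1 m3 m2 d a c b +
      (-1) ^ m1 * C_div m1 m3 m2 d a c b + D_div m1 m3 m2 d c b"
    unfolding M_def E_def by (rule recip_sum_reduction) (use assms in auto)
  also have "real d ^ (M - 1) * (\<Sum>k<d. E k * recip_sum m3 m2 d c b 0 (real k / real d)) =
    reduction_const m1 m3 m2 c b + A_div m1 m3 m2 d a c b + (-1) ^ m1 * B_div m1 m2 m3 d a b c +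
      (-1) ^ m1 * C_div m1 m2 m3 d a b c + D_div m1 m2 m3 d b c"
    using recip_sum_reduction[of a c b d m1 m3 m2] assms unfolding M_def E_def
    by (simp add: add.assoc add.commute[of m3 m2])
  finally show ?thesis
    unfolding M_def E_def distrib_left D sq \<rho>_def by simp
qed

section \<open>Moebius sums\<close>

text \<open>Only squarefree divisors count. They are the products over sets of prime divisors of n,
  and complete multiplicativity turns the sum into the expanded product.\<close>

theorem sum_moebius:
  fixes f :: "nat \<Rightarrow> 'a :: comm_ring_1"
  assumes n: "n > 0" and f1: "f 1 = 1" and f: "\<And>x y. f (x * y) = f x * f y"
  shows "(\<Sum>d | d dvd n. of_int (moebius d) * f d) = (\<Prod>p\<in>prime_factors n. 1 - f p)"
proof -
  let ?P = "prime_factors n"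
  have pr: "prime p" if "p \<in> X" "X \<subseteq> ?P" for p X using that by auto
  have pf: "prime_factors (\<Prod>X) = X" if "X \<subseteq> ?P" for X
  proof -
    have "finite X" using that finite_subset by blast
    then have "prime_factors (\<Prod>X) = \<Union>((prime_factors \<circ> (\<lambda>x. x)) ` X)"
      using pr[OF _ that] by (intro prime_factors_prod) (auto dest: prime_gt_0_nat)
    also have "\<dots> = X" using pr[OF _ that] by (auto simp: prime_factorization_prime)
    finally show ?thesis .
  qed
  have sq: "squarefree (\<Prod>X)" if "X \<subseteq> ?P" for X
    using pr[OF _ that] by (intro squarefree_prod_coprime) (auto intro: primes_coprime squarefree_prime)
  have dv: "\<Prod>X dvd n" if "X \<subseteq> ?P" for X
  proof -
    have "\<Prod>X dvd \<Prod>?P" using that by (intro prod_dvd_prod_subset) auto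
    also have "\<dots> dvd (\<Prod>p\<in>?P. p ^ multiplicity p n)"
      by (intro prod_dvd_prod) (auto simp: prime_factors_multiplicity intro: dvd_power)
    also have "\<dots> = n" using n by (simp add: prod_prime_factors)
    finally show ?thesis .
  qed
  have inv: "\<Prod>(prime_factors d) = d" if "squarefree d" for d :: nat
  proof -
    have "d \<noteq> 0" using that by (metis not_squarefree_0)
    then have "(\<Prod>p\<in>prime_factors d. p ^ multiplicity p d) = d" by (simp add: prod_prime_factors)
    moreover have "(\<Prod>p\<in>prime_factors d. p ^ multiplicity p d) = \<Prod>(prime_factors d)"
      using that \<open>d \<noteq> 0\<close> by (intro prod.cong) (auto simp: squarefree_factorial_semiring')
    ultimately show ?thesis by simp
  qed
  have fprod: "f (\<Prod>X) = (\<Prod>x\<in>X. f x)" if "finite X" for X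
    using that by induction (use f1 in \<open>auto simp: f\<close>)
  have "(\<Sum>d | d dvd n. of_int (moebius d) * f d) = (\<Sum>d | d dvd n \<and> squarefree d. of_int (moebius d) * f d)"
    using n by (intro sum.mono_neutral_right) (auto simp: moebius_def)
  also have "\<dots> = (\<Sum>X\<in>Pow ?P. (-1) ^ card X * (\<Prod>x\<in>X. f x))"
  proof (rule sum.reindex_bij_witness[of _ "\<lambda>X. \<Prod>X" prime_factors], goal_cases)
    case (1 d) then show ?case using inv by auto
  next
    case (2 d) then show ?case using n by (auto intro: dvd_prime_factors[THEN subsetD])
  next
    case (3 X) then show ?case using pf by auto
  next
    case (4 X) then show ?case using dv sq by auto
  next
    case (5 d)
    then show ?case using fprod[of "prime_factors d"] inv[of d] by (simp add: moebius_def)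
  qed
  also have "\<dots> = (\<Prod>p\<in>?P. 1 - f p)"
    using prod_diff_conv_sum[of ?P "\<lambda>_. 1" f] by simp
  finally show ?thesis .
qed

lemma prime_factors_nonempty: "n \<ge> 2 \<Longrightarrow> prime_factors (n :: nat) \<noteq> {}"
  using prime_factor_nat[of n] by (auto simp: prime_factors_dvd)

lemma sum_moebius_eq_0:
  "n \<ge> 2 \<Longrightarrow> (\<Sum>d | d dvd n. of_int (moebius d)) = (0 :: 'a :: comm_ring_1)"
proof -
  assume n: "n \<ge> 2"
  then have "card (prime_factors n) > 0" using prime_factors_nonempty by (simp add: card_gt_0_iff)
  then show ?thesis
    using sum_moebius[of n "\<lambda>_. 1 :: 'a"] n by (simp add: zero_power)
qed

lemma sum_divisors_flip:
  fixes f :: "nat \<Rightarrow> nat \<Rightarrow> 'a :: comm_monoid_add"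
  assumes "n > 0"
  shows "(\<Sum>d | d dvd n. f (n div d) d) = (\<Sum>d | d dvd n. f d (n div d))"
  using assms by (intro sum.reindex_bij_witness[of _ "\<lambda>d. n div d" "\<lambda>d. n div d"]) (auto simp: div_mult_swap elim!: dvdE)

text \<open>Exchange d with q div d and take f(d) = d^(-m) in the Euler product. This is the origin
  of the Jordan function in C2.\<close>

lemma sum_moebius_power:
  assumes "q > 0"
  shows "(\<Sum>d | d dvd q. of_int (moebius (q div d)) * complex_of_nat d ^ m) = jordan_J (of_nat m) q"
proof -
  have "(\<Sum>d | d dvd q. of_int (moebius (q div d)) * complex_of_nat d ^ m) =
      (\<Sum>d | d dvd q. of_int (moebius d) * complex_of_nat (q div d) ^ m)"
    using sum_divisors_flip[OF assms, of "\<lambda>e d. of_int (moebius e) * complex_of_nat d ^ m"] .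
  also have "\<dots> = (\<Sum>d | d dvd q. of_nat q ^ m * (of_int (moebius d) * inverse (complex_of_nat d ^ m)))"
    using assms by (intro sum.cong refl) (auto simp: field_simps elim!: dvdE)
  also have "\<dots> = of_nat q ^ m * (\<Prod>p\<in>prime_factors q. 1 - inverse (of_nat p ^ m))"
    unfolding sum_distrib_left[symmetric]
    by (subst sum_moebius) (use assms in \<open>auto simp: power_mult_distrib field_simps\<close>)
  also have "\<dots> = jordan_J (of_nat m) q"
  proof -
    have "inverse (of_nat p ^ m) = complex_of_nat p powr (- of_nat m)" if "p \<in> prime_factors q" for p
    proof -
      have "p > 0" using that by (auto dest: prime_factors_gt_0_nat)
      then show ?thesis by (simp add: powr_minus powr_nat')
    qed
    moreover have "of_nat q ^ m = complex_of_nat q powr of_nat m"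
      using assms by (simp add: powr_nat')
    ultimately show ?thesis by (simp add: jordan_J_def)
  qed
  finally show ?thesis .
qed

text \<open>Coprimality is detected by summing mu over the common divisors of r and q. The final
  exchange of d with q div d makes d the modulus of the inner sum.\<close>

lemma sum_coprime_residues:
  fixes F :: "nat \<Rightarrow> 'a :: comm_ring_1"
  assumes "q > 0"
  shows "(\<Sum>r | r < q \<and> coprime r q. F r) =
    (\<Sum>d | d dvd q. of_int (moebius (q div d)) * (\<Sum>i<d. F (q div d * i)))"
proof -
  have ind: "(\<Sum>d | d dvd q \<and> d dvd r. of_int (moebius d)) = (if coprime r q then 1 else 0 :: 'a)" for r
  proof -
    have "{d. d dvd q \<and> d dvd r} = {d. d dvd gcd r q}" by auto
    moreover have "gcd r q \<ge> 2" if "\<not> coprime r q"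
      using that assms by (metis One_nat_def Suc_1 coprime_iff_gcd_eq_1 gcd_eq_0_iff less_2_cases not_less neq0_conv)
    moreover have "{d. d dvd Suc 0} = {1}" by auto
    ultimately show ?thesis
      using sum_moebius_eq_0[of "gcd r q", where 'a = 'a] by (cases "coprime r q") (auto simp: moebius_def)
  qed
  have "(\<Sum>r | r < q \<and> coprime r q. F r) = (\<Sum>r<q. (if coprime r q then 1 else 0) * F r)"
    by (intro sum.mono_neutral_cong_left) auto
  also have "\<dots> = (\<Sum>r<q. \<Sum>d | d dvd q \<and> d dvd r. of_int (moebius d) * F r)"
    unfolding ind[symmetric] sum_distrib_right ..
  also have "\<dots> = (\<Sum>r<q. \<Sum>d | d dvd q. if d dvd r then of_int (moebius d) * F r else 0)"
    using assms by (intro sum.cong refl sum.mono_neutral_cong_left) auto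
  also have "\<dots> = (\<Sum>d | d dvd q. \<Sum>r<q. if d dvd r then of_int (moebius d) * F r else 0)"
    by (rule sum.swap)
  also have "\<dots> = (\<Sum>d | d dvd q. of_int (moebius d) * (\<Sum>i<q div d. F (d * i)))"
  proof (rule sum.cong[OF refl])
    fix d assume "d \<in> {d. d dvd q}"
    then obtain e where q: "q = d * e" by auto
    then have d: "d > 0" using assms by auto
    have "(\<Sum>r<q. if d dvd r then of_int (moebius d) * F r else 0) = (\<Sum>r | r < q \<and> d dvd r. of_int (moebius d) * F r)"
      by (intro sum.mono_neutral_cong_right) auto
    also have "\<dots> = (\<Sum>i<e. of_int (moebius d) * F (d * i))"
      using d by (intro sum.reindex_bij_witness[of _ "\<lambda>i. d * i" "\<lambda>r. r div d"]) (auto simp: q)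
    finally show "(\<Sum>r<q. if d dvd r then of_int (moebius d) * F r else 0) = of_int (moebius d) * (\<Sum>i<q div d. F (d * i))"
      using d by (simp add: q sum_distrib_left)
  qed
  also have "\<dots> = (\<Sum>d | d dvd q. of_int (moebius (q div d)) * (\<Sum>i<d. F (q div d * i)))"
    using sum_divisors_flip[OF assms, of "\<lambda>e d. of_int (moebius e) * (\<Sum>i<d. F (e * i))"] by simp
  finally show ?thesis .
qed

lemma sum_atLeast1_lessThan:
  fixes F :: "nat \<Rightarrow> 'a :: comm_monoid_add"
  assumes "F c = F 0"
  shows "sum F {1..c} = sum F {..<c}"
proof (cases c)
  case (Suc n)
  have "sum F {1..c} = sum F {1..n} + F 0" by (simp add: Suc flip: assms)
  also have "\<dots> = sum F {..n}" by (simp add: sum.atMost_shift atLeast0LessThan sum.atLeast1_atMost_eq add.commute)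
  finally show ?thesis by (simp add: Suc lessThan_Suc_atMost)
qed simp

section \<open>Assembling the terms of the formula as Moebius sums\<close>

lemma weighted_sum_pull:
  fixes w :: "nat \<Rightarrow> real"
  shows "(\<Sum>d\<in>Q. w d * (K * f d)) = K * (\<Sum>d\<in>Q. w d * f d)"
    and "(\<Sum>d\<in>Q. w d * (\<Sum>j\<in>J. g d j)) = (\<Sum>j\<in>J. \<Sum>d\<in>Q. w d * g d j)"
proof -
  show "(\<Sum>d\<in>Q. w d * (K * f d)) = K * (\<Sum>d\<in>Q. w d * f d)"
    by (simp add: sum_distrib_left mult_ac)
  show "(\<Sum>d\<in>Q. w d * (\<Sum>j\<in>J. g d j)) = (\<Sum>j\<in>J. \<Sum>d\<in>Q. w d * g d j)"
    unfolding sum_distrib_left by (rule sum.swap)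
qed

lemma bernoulli_fun_of_nat [simp]: "bernoulli_fun n (real k) = bernoulli_fun n 0"
  using bernoulli_fun_add_of_nat(1)[of n 0 k] by simp

lemma A_term_eq:
  assumes "b > 0" "c > 0"
  shows "A_term m1 m2 m3 q a b c = (\<Sum>d | d dvd q. of_int (moebius (q div d)) * A_div m1 m2 m3 d a b c)"
  unfolding A_div_def weighted_sum_pull[where w = "\<lambda>d. real_of_int (moebius (q div d))" and Q = "{d. d dvd q}"]
  using assms by (simp add: A_term_def sum_atLeast1_lessThan[unfolded One_nat_def] mult.assoc)

lemma B_term_eq:
  assumes "a > 0" "b > 0"
  shows "B_term m1 m2 m3 q a b c = (\<Sum>d | d dvd q. of_int (moebius (q div d)) * B_div m1 m2 m3 d a b c)"
  unfolding B_div_def weighted_sum_pull[where w = "\<lambda>d. real_of_int (moebius (q div d))" and Q = "{d. d dvd q}"]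
  using assms by (simp add: B_term_def sum_atLeast1_lessThan[unfolded One_nat_def] mult.assoc)

lemma C_term_eq:
  assumes "a > 0" "b > 0"
  shows "C_term m1 m2 m3 q a b c = (\<Sum>d | d dvd q. of_int (moebius (q div d)) * C_div m1 m2 m3 d a b c)"
proof -
  \<comment> \<open>The slope ac/gcd(a,c) has to be recognised as an integer: only then do l = b and
    l = 0 give the same summand.\<close>
  define k where "k = a * (c div gcd a c)"
  have arg: "real a * real c * real l / (real (gcd a c) * real b) = real k * real l / real b" for l
    by (simp add: k_def real_of_nat_div)
  show ?thesis
    unfolding C_div_def weighted_sum_pull[where w = "\<lambda>d. real_of_int (moebius (q div d))" and Q = "{d. d dvd q}"]
      C_term_def arg
    using assms by (simp add: sum_atLeast1_lessThan[unfolded One_nat_def] mult.assoc)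
qed

lemma D_term_eq:
  assumes "b > 0"
  shows "D_term m1 m2 m3 q b c = (\<Sum>d | d dvd q. of_int (moebius (q div d)) * D_div m1 m2 m3 d b c)"
  unfolding D_div_def weighted_sum_pull(1)[where w = "\<lambda>d. real_of_int (moebius (q div d))" and Q = "{d. d dvd q}"]
  using assms by (simp add: D_term_def sum_atLeast1_lessThan[unfolded One_nat_def] mult.assoc delta_int_def)

lemma R_term_eq:
  assumes "b > 0"
  shows "R_term m n q a b = (\<Sum>d | d dvd q. of_int (moebius (q div d)) * R_div m n d a b)"
  unfolding R_div_def weighted_sum_pull[where w = "\<lambda>d. real_of_int (moebius (q div d))" and Q = "{d. d dvd q}"]
  using assms by (simp add: R_term_def sum_atLeast1_lessThan[unfolded One_nat_def] mult.assoc)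

text \<open>The sum over k1 + k2 + k3 = 0 modulo d with k3 eliminated. The sign
  \<open>(-1) ^ m3\<close> from replacing -k1 - k2 by k1 + k2 is left out.\<close>

definition triple_bernoulli_sum :: "nat \<Rightarrow> nat \<Rightarrow> nat \<Rightarrow> nat \<Rightarrow> nat \<Rightarrow> nat \<Rightarrow> nat \<Rightarrow> real" where
  "triple_bernoulli_sum m1 m2 m3 d a b c = (\<Sum>k1<d. \<Sum>k2<d. bernoulli_fun m1 (real a * (real k1 / real d)) *
        (bernoulli_fun m2 (real b * (real k2 / real d)) *
      bernoulli_fun m3 (real c * (real k2 / real d + real k1 / real d))))"

theorem moebius_triple_sum:
  assumes "a > 0" "b > 0" "c > 0" "q \<ge> 2" "m1 \<ge> 1" "m2 \<ge> 1" "m3 \<ge> 2" "even (m1 + m2 + m3)"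
    and "coprime a q" "coprime b q" "coprime c q"
  shows "(\<Sum>d | d dvd q. of_int (moebius (q div d)) *
      of_real (real d ^ (m1 + m2 + m3 - 2) * triple_bernoulli_sum m1 m2 m3 d a b c)) =
    of_real (A_term m1 m2 m3 q a b c) + (-1) ^ m1 * of_real (A_term m1 m3 m2 q a c b)
    + of_real (B_term m1 m2 m3 q a b c) + (-1) ^ m1 * of_real (B_term m1 m3 m2 q a c b)
    + of_real (C_term m1 m2 m3 q a b c) + (-1) ^ m1 * of_real (C_term m1 m3 m2 q a c b)
    - of_real (D_term m1 m2 m3 q b c) + of_real (D_term m1 m3 m2 q c b) + C2_term m1 m2 m3 q a b c
    - (-1) ^ m2 * (fact m2 * fact m3 / fact (m2 + m3)) * (of_nat (gcd b c) ^ (m2 + m3) / (of_nat b ^ m3 * of_nat c ^ m2)) *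
      (of_real (R_term m1 (m2 + m3) q a (b * c div gcd b c)) +
       of_real (R_term (m2 + m3) m1 q (b * c div gcd b c) a))"
proof -
  define L where "L = b * c div gcd b c"
  define n where "n = m2 + m3"
  define M where "M = m1 + m2 + m3"
  define \<sigma> where "\<sigma> = (-1) ^ m2 * (fact m2 * fact m3 / fact n) * (real (gcd b c) ^ n / (real b ^ m3 * real c ^ m2))"
  define w :: "nat \<Rightarrow> real" where "w d = of_int (moebius (q div d))" for d
  \<comment> \<open>Independent of d, hence annihilated by \<open>sum_w\<close>; this is where q >=
    2 enters.\<close>
  define \<kappa> where "\<kappa> = reduction_const m1 m2 m3 b c + (-1) ^ m1 * reduction_const m1 m3 m2 c b"
  have L: "L > 0"
    using assms by (simp add: L_def div_greater_zero_iff) (meson dvd_imp_le dvd_mult2 gcd_dvd1 nat_0_less_mult_iff)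
  have sum_w: "(\<Sum>d | d dvd q. w d) = 0"
    using sum_divisors_flip[of q "\<lambda>e d. of_int (moebius e) :: real"] sum_moebius_eq_0[OF assms(4)] assms(4)
    by (simp add: w_def)
  have "(\<Sum>d | d dvd q. w d * (real d ^ (M - 2) * triple_bernoulli_sum m1 m2 m3 d a b c)) =
     (\<Sum>d | d dvd q. w d * (\<kappa> + A_div m1 m2 m3 d a b c + (-1) ^ m1 * A_div m1 m3 m2 d a c b
    + B_div m1 m2 m3 d a b c + (-1) ^ m1 * B_div m1 m3 m2 d a c b
    + C_div m1 m2 m3 d a b c + (-1) ^ m1 * C_div m1 m3 m2 d a c b
    - D_div m1 m2 m3 d b c + D_div m1 m3 m2 d c b
    - \<sigma> * (R_div m1 n d a L + R_div n m1 d L a + real d ^ M * recip_const m1 n a L 0)))"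
  proof (intro sum.cong refl, goal_cases)
    case (1 d)
    then have dq: "d dvd q" by simp
    then have d: "d > 0" using assms(4) by (cases d) auto
    have cop: "coprime a d" "coprime b d" "coprime c d"
      using assms(9-11) dq coprime_divisors[of a a d q] coprime_divisors[of b b d q] coprime_divisors[of c c d q]
      by simp_all
    have m1n: "m1 + n = M" by (simp add: M_def n_def)
    note t = triple_sum[OF assms(1-3) d assms(5-8) cop, folded n_def L_def,
        folded triple_bernoulli_sum_def \<sigma>_def \<kappa>_def M_def, unfolded m1n]
    show ?case by (simp only: t)
  qed
  also have "\<dots> = \<kappa> * (\<Sum>d | d dvd q. w d) + A_term m1 m2 m3 q a b c + (-1) ^ m1 * A_term m1 m3 m2 q a c b
    + B_term m1 m2 m3 q a b c + (-1) ^ m1 * B_term m1 m3 m2 q a c b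
    + C_term m1 m2 m3 q a b c + (-1) ^ m1 * C_term m1 m3 m2 q a c b
    - D_term m1 m2 m3 q b c + D_term m1 m3 m2 q c b
    - \<sigma> * (R_term m1 n q a L + R_term n m1 q L a + (\<Sum>d | d dvd q. w d * real d ^ M) * recip_const m1 n a L 0)"
    unfolding A_term_eq[OF assms(2,3)] A_term_eq[OF assms(3,2)] B_term_eq[OF assms(1,2)] B_term_eq[OF assms(1,3)]
      C_term_eq[OF assms(1,2)] C_term_eq[OF assms(1,3)] D_term_eq[OF assms(2)] D_term_eq[OF assms(3)]
      R_term_eq[OF L] R_term_eq[OF assms(1)] w_def[symmetric]
    by (simp only: sum_distrib_left sum_distrib_right sum.distrib[symmetric] sum_subtractf[symmetric])
       (intro sum.cong refl, simp add: algebra_simps)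
  finally have main: "(\<Sum>d | d dvd q. w d * (real d ^ (M - 2) * triple_bernoulli_sum m1 m2 m3 d a b c)) = \<dots>" .
  \<comment> \<open>The difference terms of both expansions multiplied together:
    \<open>\<sigma>\<close> comes from (m2, m3), \<open>recip_const\<close> from (m1, n).\<close>
  have C2: "C2_term m1 m2 m3 q a b c =
    - (complex_of_real \<sigma> * (of_real (\<Sum>d | d dvd q. w d * real d ^ M) * of_real (recip_const m1 n a L 0)))"
  proof -
    define e where "e = gcd b c"
    have e: "e > 0" using assms by (simp add: e_def)
    have Le: "L * e = b * c" by (simp add: L_def e_def)
    have J: "jordan_J (of_nat M) q = of_real (\<Sum>d | d dvd q. w d * real d ^ M)"
      using sum_moebius_power[of q M] assms(4) by (simp add: w_def)
    have B: "bernoulli_num M = bernoulli_fun M 0"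
      using assms by (simp add: bernoulli_num_def bernoulli_fun_def M_def)
    \<comment> \<open>Since b c = L e, the factor e = gcd(b,c) splits off; this explains the unusual
      gcd in C2.\<close>
    have g: "gcd (a * e) (b * c) = gcd a L * e"
      by (simp add: gcd_mult_distrib_nat mult.commute flip: Le)
    have sgn: "(-1) ^ (m1 + m2) = - ((-1) ^ m2 * (-1) ^ (n + 1) :: real)"
    proof -
      have "(-1) ^ (m1 + m2) = ((-1) ^ m3 :: real)" using assms(8) by (auto simp: minus_one_power_iff)
      then show ?thesis by (simp add: n_def power_add)
    qed
    have "real (gcd a L * e) ^ M / (real a ^ (m2 + m3) * real b ^ (m1 + m3) * real c ^ (m1 + m2)) =
        (real e ^ n / (real b ^ m3 * real c ^ m2)) * (real (gcd a L) ^ M / (real a ^ n * real L ^ m1))"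
    proof -
      have "real L ^ m1 * real e ^ m1 = real b ^ m1 * real c ^ m1"
        by (simp only: Le flip: power_mult_distrib of_nat_mult)
      moreover have "real e ^ m1 \<noteq> 0" "real L ^ m1 \<noteq> 0" using e L by auto
      ultimately have "real L ^ m1 = real b ^ m1 * real c ^ m1 / real e ^ m1"
        by (simp add: field_simps)
      then show ?thesis using assms e
        by (simp add: M_def n_def power_add power_mult_distrib mult_ac)
    qed
    then have "(-1) ^ (m1 + m2) * fact m1 * fact m2 * fact m3 * real (gcd a L * e) ^ M * bernoulli_fun M 0 * X /
        (real a ^ (m2 + m3) * real b ^ (m1 + m3) * real c ^ (m1 + m2) * fact M) =
       - (\<sigma> * (X * recip_const m1 n a L 0))" for X
    proof -
      assume *: "real (gcd a L * e) ^ M / (real a ^ (m2 + m3) * real b ^ (m1 + m3) * real c ^ (m1 + m2)) =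
        (real e ^ n / (real b ^ m3 * real c ^ m2)) * (real (gcd a L) ^ M / (real a ^ n * real L ^ m1))"
      have "(-1) ^ (m1 + m2) * fact m1 * fact m2 * fact m3 * real (gcd a L * e) ^ M * bernoulli_fun M 0 * X /
        (real a ^ (m2 + m3) * real b ^ (m1 + m3) * real c ^ (m1 + m2) * fact M) =
        (-1) ^ (m1 + m2) * fact m1 * fact m2 * fact m3 * (real (gcd a L * e) ^ M / (real a ^ (m2 + m3) * real b ^ (m1 + m3) * real c ^ (m1 + m2))) * bernoulli_fun M 0 * X / fact M"
        by simp
      moreover have "m1 + n = M" by (simp add: M_def n_def)
      ultimately show ?thesis
        unfolding * sgn by (simp add: \<sigma>_def recip_const_def e_def mult_ac)
    qed
    then have "complex_of_real ((-1) ^ (m1 + m2) * fact m1 * fact m2 * fact m3 * real (gcd a L * e) ^ M * bernoulli_fun M 0 *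
          (\<Sum>d | d dvd q. w d * real d ^ M) /
        (real a ^ (m2 + m3) * real b ^ (m1 + m3) * real c ^ (m1 + m2) * fact M)) =
       of_real (- (\<sigma> * ((\<Sum>d | d dvd q. w d * real d ^ M) * recip_const m1 n a L 0)))"
      by simp
    then show ?thesis
      unfolding C2_term_def M_def[symmetric] J B e_def[symmetric] g by simp
  qed
  have "(\<Sum>d | d dvd q. of_int (moebius (q div d)) *
      of_real (real d ^ (m1 + m2 + m3 - 2) * triple_bernoulli_sum m1 m2 m3 d a b c)) =
    complex_of_real (\<Sum>d | d dvd q. w d * (real d ^ (M - 2) * triple_bernoulli_sum m1 m2 m3 d a b c))"
    by (simp add: w_def M_def)
  moreover have "(-1) ^ m2 * (fact m2 * fact m3 / fact n) * (of_nat (gcd b c) ^ n / (of_nat b ^ m3 * of_nat c ^ m2)) =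
      complex_of_real \<sigma>"
    by (simp add: \<sigma>_def)
  ultimately show ?thesis
    unfolding main sum_w C2 n_def[symmetric] L_def[symmetric] by (simp add: algebra_simps)
qed

section \<open>Characters\<close>

definition unit_root :: "nat \<Rightarrow> int \<Rightarrow> complex" where
  "unit_root q n = cis (2 * pi * of_int n / of_nat q)"

lemma unit_root_add: "unit_root q (m + n) = unit_root q m * unit_root q n"
  by (simp add: unit_root_def cis_mult distrib_left add_divide_distrib)

lemma unit_root_0 [simp]: "unit_root q 0 = 1"
  by (simp add: unit_root_def)

lemma unit_root_eq_1_iff:
  assumes "q > 0"
  shows "unit_root q n = 1 \<longleftrightarrow> int q dvd n"
proof -
  have "unit_root q n = 1 \<longleftrightarrow> (\<exists>k::int. 2 * pi * of_int n / of_nat q = of_int (2 * k) * pi)"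
    by (simp add: unit_root_def cis_conv_exp exp_eq_1)
  also have "\<dots> \<longleftrightarrow> (\<exists>k::int. of_int n = (of_int (int q * k) :: real))"
    using assms by (intro ex_cong1) (auto simp: field_simps)
  also have "\<dots> \<longleftrightarrow> int q dvd n"
    unfolding of_int_eq_iff by (auto simp: dvd_def)
  finally show ?thesis .
qed

lemma unit_root_mult_self [simp]: "q > 0 \<Longrightarrow> unit_root q (int q * n) = 1"
  by (simp add: unit_root_eq_1_iff)

lemma unit_root_mult: "unit_root q (int k * n) = unit_root q n ^ k"
  by (simp add: unit_root_def Complex.DeMoivre mult_ac)

lemma sum_unit_root:
  assumes "q > 0"
  shows "(\<Sum>k<q. unit_root q (int k * n)) = (if int q dvd n then of_nat q else 0)"
proof (cases "int q dvd n")
  case True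
  then have "unit_root q n = 1" using unit_root_eq_1_iff assms by blast
  then show ?thesis using True by (simp add: unit_root_mult)
next
  case False
  then have ne: "unit_root q n \<noteq> 1" using unit_root_eq_1_iff assms by blast
  have "(\<Sum>k<q. unit_root q (int k * n)) = (\<Sum>k<q. unit_root q n ^ k)"
    by (simp add: unit_root_mult)
  also have "\<dots> = (1 - unit_root q n ^ q) / (1 - unit_root q n)"
    using ne by (simp add: sum_gp_strict)
  also have "unit_root q n ^ q = 1"
    using assms by (simp flip: unit_root_mult)
  finally show ?thesis using False by simp
qed

lemma euler_theorem_int:
  assumes "coprime x (int q)"
  shows "[x ^ totient q = 1] (mod int q)"
proof (cases "q = 0")
  case True then show ?thesis by simp
next
  case False
  define n where "n = nat (x mod int q)"
  have n: "int n = x mod int q" using False by (simp add: n_def)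
  have "coprime (int n) (int q)" unfolding n using assms by (simp add: coprime_mod_left_iff False)
  then have "[n ^ totient q = 1] (mod q)" by (intro euler_theorem) simp
  then have "[int (n ^ totient q) = int 1] (mod int q)" by (simp only: cong_int_iff)
  then have "[int n ^ totient q = 1] (mod int q)" by simp
  moreover have "[int n ^ totient q = x ^ totient q] (mod int q)"
    unfolding n by (intro cong_pow) (simp add: cong_def)
  ultimately show ?thesis by (metis cong_sym cong_trans)
qed

text \<open>Projecting the indicator of the class of 1 successively onto eigenspaces of the
  translations by the units produces, as long as the value at \<open>x\<close> is kept different from
  the value at 1, a common eigenfunction; that is a character.\<close>

lemma exists_common_eigenfunction:
  assumes q: "q > 0" and x: "\<not> [x = 1] (mod int q)"
    and G: "finite G" "\<And>g. g \<in> G \<Longrightarrow> coprime g (int q)"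
  shows "\<exists>f :: int \<Rightarrow> complex. (\<forall>y. f (y + int q) = f y) \<and> f 1 \<noteq> f x \<and>
    (\<forall>g\<in>G. \<exists>l. \<forall>y. f (g * y) = l * f y)"
  using G
proof (induction G rule: finite_induct)
  case empty
  show ?case
    using x by (intro exI[of _ "\<lambda>y. if [y = 1] (mod int q) then 1 else 0"]) (auto simp: cong_def)
next
  case (insert g G)
  have "\<exists>f :: int \<Rightarrow> complex. (\<forall>y. f (y + int q) = f y) \<and> f 1 \<noteq> f x \<and>
      (\<forall>g\<in>G. \<exists>l. \<forall>y. f (g * y) = l * f y)"
    by (rule insert.IH) (use insert.prems in auto)
  then obtain f :: "int \<Rightarrow> complex" where f: "\<And>y. f (y + int q) = f y" "f 1 \<noteq> f x"
      "\<And>h. h \<in> G \<Longrightarrow> \<exists>l. \<forall>y. f (h * y) = l * f y"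
    by blast
  define k where "k = totient q"
  have k: "k > 0" using q by (simp add: k_def)
  \<comment> \<open>Up to the factor k, \<open>F j\<close> is the projection of f onto the functions
    that multiplication of the argument by g scales by \<open>unit_root k j\<close>. By Euler's
    theorem the k-th iterate of this multiplication acts trivially on f.\<close>
  define F where "F j y = (\<Sum>i<k. unit_root k (int i * - int j) * f (g ^ i * y))" for j y
  have mod_eq: "f y = f z" if "[y = z] (mod int q)" for y z
    using that periodic_mod[of f "int q", OF f(1)] unfolding cong_def by metis
  have sumF: "(\<Sum>j<k. F j y) = of_nat k * f y" for y
  proof -
    have "(\<Sum>j<k. F j y) = (\<Sum>i<k. (\<Sum>j<k. unit_root k (int j * - int i)) * f (g ^ i * y))"
      unfolding F_def by (subst sum.swap) (simp add: sum_distrib_left mult.commute)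
    also have "\<dots> = (\<Sum>i<k. if i = 0 then of_nat k * f y else 0)"
      unfolding sum_unit_root[OF k]
    proof (intro sum.cong refl)
      fix i assume "i \<in> {..<k}"
      then have "int k dvd - int i \<longleftrightarrow> i = 0" by (auto dest: nat_dvd_not_less)
      then show "(if int k dvd - int i then of_nat k else 0) * f (g ^ i * y) = (if i = 0 then of_nat k * f y else 0)"
        by simp
    qed
    finally show ?thesis using k by simp
  qed
  \<comment> \<open>The projections add up to k f, so one of them still separates 1 from x.\<close>
  have "\<exists>j<k. F j 1 \<noteq> F j x"
  proof (rule ccontr)
    assume "\<not> ?thesis"
    then have "(\<Sum>j<k. F j 1) = (\<Sum>j<k. F j x)" by (intro sum.cong) auto
    then show False using f(2) k by (simp add: sumF)
  qed
  then obtain j where j: "F j 1 \<noteq> F j x" by blast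
  have Fg: "F j (g * y) = unit_root k (int j) * F j y" for y
  proof -
    define t where "t i = unit_root k (int i * - int j) * f (g ^ i * y)" for i
    have "t k = t 0"
    proof -
      have "[g ^ k * y = 1 * y] (mod int q)"
        unfolding k_def using insert.prems by (intro cong_mult euler_theorem_int) auto
      then have "f (g ^ k * y) = f (1 * y)" by (rule mod_eq)
      then show ?thesis unfolding t_def unit_root_mult_self[OF k] by simp
    qed
    have "unit_root k (int j) * (unit_root k (int (Suc i) * - int j) * f (g ^ Suc i * y)) =
        unit_root k (int i * - int j) * f (g ^ i * (g * y))" for i
    proof -
      have "int j + int (Suc i) * - int j = int i * - int j" by (simp add: algebra_simps)
      then have "unit_root k (int j) * unit_root k (int (Suc i) * - int j) = unit_root k (int i * - int j)"
        by (metis unit_root_add)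
      moreover have "g ^ Suc i * y = g ^ i * (g * y)" by (simp add: mult_ac)
      ultimately show ?thesis by (metis mult.assoc)
    qed
    then have "F j (g * y) = (\<Sum>i<k. unit_root k (int j) * t (Suc i))"
      unfolding F_def t_def by simp
    also have "\<dots> = unit_root k (int j) * (\<Sum>i<k. t (Suc i))" by (simp add: sum_distrib_left)
    also have "(\<Sum>i<k. t (Suc i)) = (\<Sum>i<k. t i)"
      using sum.lessThan_Suc_shift[of t k] sum.lessThan_Suc[of t k] \<open>t k = t 0\<close> by simp
    finally show ?thesis by (simp add: F_def t_def)
  qed
  \<comment> \<open>Multiplications by g and h commute, so eigenfunction properties already gained
    survive the projection.\<close>
  have FG: "\<exists>l. \<forall>y. F j (h * y) = l * F j y" if "h \<in> G" for h
  proof -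
    obtain l where "\<And>y. f (h * y) = l * f y" using f(3) \<open>h \<in> G\<close> by blast
    then have "f (g ^ i * (h * y)) = l * f (g ^ i * y)" for i y by (metis mult.left_commute)
    then have "F j (h * y) = l * F j y" for y
      unfolding F_def by (simp add: sum_distrib_left mult.left_commute)
    then show ?thesis by blast
  qed
  have Fper: "F j (y + int q) = F j y" for y
  proof -
    have "f (g ^ i * (y + int q)) = f (g ^ i * y)" for i
      by (rule mod_eq) (simp add: cong_def distrib_left)
    then show ?thesis by (simp add: F_def)
  qed
  show ?case
    using j Fg FG Fper by (intro exI[of _ "F j"]) auto
qed

text \<open>Take a common eigenfunction f for all units. Comparing its equation at y and at 1 gives
  f(g y) f(1) = f(g) f(y), so f / f(1) on the units, extended by 0, is a character.\<close>

lemma dchars_separate: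
  assumes q: "q > 0" and x: "coprime x (int q)" "\<not> [x = 1] (mod int q)"
  shows "\<exists>chi \<in> dchars q. chi x \<noteq> 1"
proof -
  define G where "G = {g \<in> {0..<int q}. coprime g (int q)}"
  have "\<exists>f :: int \<Rightarrow> complex. (\<forall>y. f (y + int q) = f y) \<and> f 1 \<noteq> f x \<and>
      (\<forall>g\<in>G. \<exists>l. \<forall>y. f (g * y) = l * f y)"
  proof (rule exists_common_eigenfunction[OF q x(2)])
    show "finite G" unfolding G_def by (rule finite_subset[of _ "{0..<int q}"]) auto
  qed (simp add: G_def)
  then obtain f :: "int \<Rightarrow> complex" where f: "\<And>y. f (y + int q) = f y" "f 1 \<noteq> f x"
      "\<And>g. g \<in> G \<Longrightarrow> \<exists>l. \<forall>y. f (g * y) = l * f y"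
    by blast
  have mod_eq: "f y = f z" if "[y = z] (mod int q)" for y z
    using that periodic_mod[of f "int q", OF f(1)] unfolding cong_def by metis
  have mult: "f (g * y) * f 1 = f g * f y" if "coprime g (int q)" for g y
  proof -
    have "g mod int q \<in> G" using that q by (simp add: G_def coprime_mod_left_iff)
    then obtain l where l: "\<And>y. f (g mod int q * y) = l * f y" using f(3) by blast
    have "f (g mod int q * y) = f (g * y)" for y by (rule mod_eq) (simp add: cong_def mod_mult_left_eq)
    then have "f (g * y) = l * f y" for y using l by simp
    from this[of y] this[of 1] show ?thesis by simp
  qed
  have f1: "f 1 \<noteq> 0"
  proof
    assume "f 1 = 0"
    moreover have "f x * f x = 0" using mult[OF x(1), of x] \<open>f 1 = 0\<close> by simp
    ultimately show False using f(2) by simp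
  qed
  define chi where "chi y = (if coprime y (int q) then f y / f 1 else 0)" for y
  have nz: "f y \<noteq> 0" if y: "coprime y (int q)" for y
  proof -
    have "[y * y ^ (totient q - 1) = 1] (mod int q)"
      using euler_theorem_int[OF y] q by (simp flip: power_Suc)
    then have "f (y * y ^ (totient q - 1)) = f 1" by (rule mod_eq)
    then show ?thesis using mult[OF y, of "y ^ (totient q - 1)"] f1 by auto
  qed
  have "chi \<in> dchars q"
    unfolding dchars_def
  proof (intro CollectI conjI allI)
    show "chi (y + int q) = chi y" for y
      using f(1) by (simp add: chi_def coprime_iff_gcd_eq_1)
    show "chi (y * z) = chi y * chi z" for y z
      using mult[of y z] f1 by (auto simp: chi_def field_simps)
    show "(chi y \<noteq> 0) = coprime y (int q)" for y
      using nz f1 by (simp add: chi_def)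
  qed
  moreover have "chi x \<noteq> 1" using f(2) f1 x(1) by (simp add: chi_def)
  ultimately show ?thesis by blast
qed

lemma dcharsD:
  assumes "chi \<in> dchars q"
  shows "chi (x + int q) = chi x" "chi (x * y) = chi x * chi y" "chi x \<noteq> 0 \<longleftrightarrow> coprime x (int q)"
  using assms by (auto simp: dchars_def)

lemma dchars_1 [simp]: "chi \<in> dchars q \<Longrightarrow> chi 1 = 1"
  using dcharsD(2)[of chi q 1 1] dcharsD(3)[of chi q 1] by simp

lemma dchars_cong: "chi \<in> dchars q \<Longrightarrow> [x = y] (mod int q) \<Longrightarrow> chi x = chi y"
  unfolding cong_def using dchars_mod by metis

lemma dchars_power: "chi \<in> dchars q \<Longrightarrow> chi (x ^ k) = chi x ^ k"
  by (induction k) (auto simp: dcharsD)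

lemma dchars_norm:
  assumes "q > 0" "chi \<in> dchars q" "coprime x (int q)"
  shows "norm (chi x) = 1"
proof -
  have "chi x ^ totient q = 1"
    using dchars_cong[OF assms(2) euler_theorem_int[OF assms(3)]] assms(2) by (simp add: dchars_power)
  then have "norm (chi x) ^ totient q = 1" by (simp flip: norm_power)
  then show ?thesis
    using power_eq_iff_eq_base[of "totient q" "norm (chi x)" 1] assms(1) by simp
qed

lemma card_coprime_residues:
  assumes "q \<ge> 2"
  shows "card {r. r < q \<and> coprime r q} = totient q"
proof -
  have "{r. r < q \<and> coprime r q} = totatives q"
    using assms by (auto simp: totatives_def intro: Nat.gr0I le_neq_implies_less)
  then show ?thesis by (simp add: totient_def)
qed

text \<open>Multiplication by a character that is not 1 at x permutes \<open>dchars q\<close> and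
  rescales the sum.\<close>

lemma sum_dchars_unit_nontrivial:
  assumes "q > 0" "coprime x (int q)" "\<not> [x = 1] (mod int q)"
  shows "(\<Sum>chi\<in>dchars q. chi x) = 0"
proof -
  obtain psi where psi: "psi \<in> dchars q" "psi x \<noteq> 1"
    using dchars_separate[OF assms] by blast
  define T where "T chi = (\<lambda>y. psi y * chi y)" for chi :: "int \<Rightarrow> complex"
  have "T ` dchars q \<subseteq> dchars q"
    using psi(1) by (auto simp: dchars_def T_def)
  moreover have "inj_on T (dchars q)"
  proof (rule inj_onI)
    fix chi1 chi2 assume chi: "chi1 \<in> dchars q" "chi2 \<in> dchars q" "T chi1 = T chi2"
    show "chi1 = chi2"
    proof
      fix y
      have "psi y * chi1 y = psi y * chi2 y" using fun_cong[OF chi(3), of y] by (simp add: T_def)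
      then show "chi1 y = chi2 y"
        using dcharsD(3)[OF psi(1), of y] dcharsD(3)[OF chi(1), of y] dcharsD(3)[OF chi(2), of y] by auto
    qed
  qed
  ultimately have "bij_betw T (dchars q) (dchars q)"
    using finite_dchars[OF assms(1)] by (simp add: bij_betw_def endo_inj_surj)
  then have "(\<Sum>chi\<in>dchars q. chi x) = (\<Sum>chi\<in>dchars q. T chi x)"
    by (rule sum.reindex_bij_betw[of T _ _ "\<lambda>chi. chi x", symmetric])
  also have "\<dots> = psi x * (\<Sum>chi\<in>dchars q. chi x)"
    by (simp add: T_def sum_distrib_left)
  finally show ?thesis using psi(2) by (simp add: algebra_simps)
qed

text \<open>The sum of chi(r) over all chi and r is counted twice: for fixed r only r = 1
  contributes, for fixed chi only the principal character.\<close>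

lemma card_dchars:
  assumes "q \<ge> 2"
  shows "card (dchars q) = totient q"
proof -
  have q: "q > 0" using assms by simp
  define chi0 :: "int \<Rightarrow> complex" where "chi0 y = (if coprime y (int q) then 1 else 0)" for y
  have chi0: "chi0 \<in> dchars q"
    by (auto simp: dchars_def chi0_def coprime_iff_gcd_eq_1[of "_ + _"])
  have "(\<Sum>r<q. \<Sum>chi\<in>dchars q. chi (int r)) = (\<Sum>r<q. if r = 1 then of_nat (card (dchars q)) else 0)"
  proof (intro sum.cong refl)
    fix r assume r: "r \<in> {..<q}"
    have one: "[int r = 1] (mod int q) \<longleftrightarrow> r = 1"
      using r assms by (metis One_nat_def cong_int_iff cong_less_modulus_unique_nat lessThan_iff numeral_2_eq_2 of_nat_1 Suc_le_lessD cong_refl)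
    show "(\<Sum>chi\<in>dchars q. chi (int r)) = (if r = 1 then of_nat (card (dchars q)) else 0)"
    proof (cases "coprime (int r) (int q)")
      case True
      then show ?thesis using sum_dchars_unit_nontrivial[OF q True] one by auto
    next
      case False
      then have "chi (int r) = 0" if "chi \<in> dchars q" for chi using dcharsD(3)[OF that] by blast
      moreover have "r \<noteq> 1" using False by auto
      ultimately show ?thesis by (auto intro: sum.neutral)
    qed
  qed
  also have "\<dots> = of_nat (card (dchars q))" using assms by simp
  finally have 1: "(\<Sum>r<q. \<Sum>chi\<in>dchars q. chi (int r)) = of_nat (card (dchars q))" .
  have "(\<Sum>r<q. \<Sum>chi\<in>dchars q. chi (int r)) = (\<Sum>chi\<in>dchars q. \<Sum>r<q. chi (int r))"
    by (rule sum.swap)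
  also have "\<dots> = (\<Sum>chi\<in>dchars q. if chi = chi0 then of_nat (totient q) else 0)"
  proof (intro sum.cong refl)
    fix chi assume chi: "chi \<in> dchars q"
    show "(\<Sum>r<q. chi (int r)) = (if chi = chi0 then of_nat (totient q) else 0)"
    proof (cases "chi = chi0")
      case True
      have "(\<Sum>r<q. chi0 (int r)) = (\<Sum>r | r < q \<and> coprime r q. 1)"
        by (intro sum.mono_neutral_cong_right) (auto simp: chi0_def)
      then show ?thesis using True card_coprime_residues[OF assms] by simp
    next
      case False
      then obtain g where g: "chi g \<noteq> chi0 g" by blast
      then have cop: "coprime g (int q)" using dcharsD(3)[OF chi, of g] by (auto simp: chi0_def split: if_splits)
      then have g1: "chi g \<noteq> 1" using g by (simp add: chi0_def)
      have "(\<Sum>r<q. chi (g * int r)) = (\<Sum>r<q. chi (int r))"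
        by (rule sum_residues_coprime[OF q _ cop]) (rule dcharsD(1)[OF chi])
      then have "chi g * (\<Sum>r<q. chi (int r)) = (\<Sum>r<q. chi (int r))"
        by (simp add: dcharsD(2)[OF chi] sum_distrib_left)
      then show ?thesis using g1 False by simp
    qed
  qed
  also have "\<dots> = of_nat (totient q)"
    using chi0 finite_dchars[OF q] by simp
  finally show ?thesis using 1 by (metis of_nat_eq_iff)
qed

theorem dchars_orthogonality:
  assumes "q \<ge> 2" "coprime y (int q)"
  shows "(\<Sum>chi\<in>dchars q. chi x * cnj (chi y)) = (if [x = y] (mod int q) then of_nat (totient q) else 0)"
proof -
  have q: "q > 0" using assms by simp
  define y' where "y' = y ^ (totient q - 1)"
  have yy': "[y * y' = 1] (mod int q)"
    using euler_theorem_int[OF assms(2)] q by (simp add: y'_def flip: power_Suc)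
  have inv: "cnj (chi y) = chi y'" if "chi \<in> dchars q" for chi
  proof -
    have "chi y * chi y' = 1" using dchars_cong[OF that yy'] that by (simp add: dcharsD(2)[OF that])
    moreover have "chi y * cnj (chi y) = 1"
      using dchars_norm[OF q that assms(2)] by (simp add: complex_norm_square[symmetric])
    moreover have "chi y \<noteq> 0" using calculation by auto
    ultimately show ?thesis by (metis mult_left_cancel)
  qed
  have "(\<Sum>chi\<in>dchars q. chi x * cnj (chi y)) = (\<Sum>chi\<in>dchars q. chi (x * y'))"
    by (intro sum.cong) (simp_all add: inv dcharsD(2))
  also have "\<dots> = (if [x = y] (mod int q) then of_nat (totient q) else 0)"
  proof (cases "coprime x (int q)")
    case True
    have cop': "coprime (x * y') (int q)" using True assms(2) by (simp add: y'_def)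
    have iff: "[x * y' = 1] (mod int q) \<longleftrightarrow> [x = y] (mod int q)"
    proof
      assume "[x * y' = 1] (mod int q)"
      then have "[x * y' * y = 1 * y] (mod int q)" by (intro cong_mult) auto
      moreover have "[x * (y * y') = x * 1] (mod int q)" using yy' by (intro cong_mult) auto
      ultimately show "[x = y] (mod int q)" by (simp add: cong_def mult_ac)
    next
      assume "[x = y] (mod int q)"
      then have "[x * y' = y * y'] (mod int q)" by (intro cong_mult) auto
      then show "[x * y' = 1] (mod int q)" using yy' by (rule cong_trans)
    qed
    show ?thesis
    proof (cases "[x * y' = 1] (mod int q)")
      case True
      then have "chi (x * y') = 1" if "chi \<in> dchars q" for chi
        using dchars_cong[OF that True] that by simp
      then have "(\<Sum>chi\<in>dchars q. chi (x * y')) = (\<Sum>chi\<in>dchars q. 1)"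
        by (intro sum.cong refl)
      then show ?thesis using True iff card_dchars[OF assms(1)] by simp
    next
      case False
      then show ?thesis using sum_dchars_unit_nontrivial[OF q cop' False] iff by simp
    qed
  next
    case False
    then have "chi (x * y') = 0" if "chi \<in> dchars q" for chi
      using dcharsD(2)[OF that, of x y'] dcharsD(3)[OF that, of x] by simp
    moreover have "\<not> [x = y] (mod int q)" using False assms(2) cong_imp_coprime cong_sym by blast
    ultimately show ?thesis by (auto intro: sum.neutral)
  qed
  finally show ?thesis .
qed

section \<open>Fourier series of the Bernoulli functions\<close>

lemma bernoulli_poly_expansion:
  "bernoulli_poly n x = fact n * (\<Sum>i\<le>n. bernoulli_poly i 0 / fact i * (x ^ (n - i) / fact (n - i)))"
proof -
  have "Abs_fps (\<lambda>n. bernoulli_poly n x / fact n) * (fps_exp 1 - 1) =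
      (Abs_fps (\<lambda>n. bernoulli_poly n 0 / fact n) * fps_exp x) * (fps_exp 1 - 1)"
    using bernoulli_poly_fps[of 0] by (simp add: bernoulli_poly_fps mult.assoc mult.left_commute[of _ "fps_exp x"])
  then have "Abs_fps (\<lambda>n. bernoulli_poly n x / fact n) = Abs_fps (\<lambda>n. bernoulli_poly n 0 / fact n) * fps_exp x"
    by simp
  then have "fps_nth (Abs_fps (\<lambda>n. bernoulli_poly n x / fact n)) n =
      fps_nth (Abs_fps (\<lambda>n. bernoulli_poly n 0 / fact n) * fps_exp x) n" by simp
  then have "bernoulli_poly n x / fact n = (\<Sum>i\<le>n. bernoulli_poly i 0 / fact i * (x ^ (n - i) / fact (n - i)))"
    by (simp add: fps_mult_nth atLeast0AtMost)
  then show ?thesis by (simp add: field_simps)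
qed

lemma has_field_derivative_bernoulli_poly:
  "(bernoulli_poly (Suc n) has_real_derivative real (Suc n) * bernoulli_poly n x) (at x within S)"
proof -
  have eq: "bernoulli_poly (Suc n) = (\<lambda>x. fact (Suc n) * (\<Sum>i\<le>Suc n. bernoulli_poly i 0 / fact i * (x ^ (Suc n - i) / fact (Suc n - i))))"
    using bernoulli_poly_expansion by blast
  have "((\<lambda>x. bernoulli_poly i 0 / fact i * (x ^ (Suc n - i) / fact (Suc n - i))) has_real_derivative
     (if i \<le> n then bernoulli_poly i 0 / fact i * (x ^ (n - i) / fact (n - i)) else 0)) (at x within S)" if "i \<le> Suc n" for i
  proof (cases "i \<le> n")
    case True
    then have eq: "Suc n - i = Suc (n - i)" by simp
    have "((\<lambda>x. c / fact (Suc k) * x ^ Suc k) has_real_derivative c / fact (Suc k) * (real (Suc k) * x ^ (Suc k - Suc 0))) (at x within S)" for c k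
      by (intro DERIV_cmult DERIV_pow)
    from this[of "bernoulli_poly i 0 / fact i" "n - i"] show ?thesis
      using True unfolding eq by (simp del: of_nat_Suc)
  next
    case False
    then have "i = Suc n" using that by simp
    then show ?thesis by simp
  qed
  then have "((\<lambda>x. \<Sum>i\<le>Suc n. bernoulli_poly i 0 / fact i * (x ^ (Suc n - i) / fact (Suc n - i))) has_real_derivative
     (\<Sum>i\<le>Suc n. if i \<le> n then bernoulli_poly i 0 / fact i * (x ^ (n - i) / fact (n - i)) else 0)) (at x within S)"
    by (intro DERIV_sum) auto
  moreover have "(\<Sum>i\<le>Suc n. if i \<le> n then bernoulli_poly i 0 / fact i * (x ^ (n - i) / fact (n - i)) else 0) =
      bernoulli_poly n x / fact n"
    unfolding bernoulli_poly_expansion[of n x] by simp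
  ultimately have "(bernoulli_poly (Suc n) has_real_derivative fact (Suc n) * (bernoulli_poly n x / fact n)) (at x within S)"
    unfolding eq by (intro DERIV_cmult) simp
  moreover have "fact (Suc n) * (bernoulli_poly n x / fact n) = real (Suc n) * bernoulli_poly n x"
    by (simp del: of_nat_Suc)
  ultimately show ?thesis by simp
qed

lemma dirichlet_kernel:
  fixes x :: real
  shows "sin (pi * x) * (2 * (\<Sum>n<N. cos (2 * pi * real (Suc n) * x)) + 1) = sin ((2 * real N + 1) * pi * x)"
proof (induction N)
  case (Suc N)
  have "sin (pi * x) * (2 * (\<Sum>n<Suc N. cos (2 * pi * real (Suc n) * x)) + 1) =
      sin ((2 * real N + 1) * pi * x) + 2 * cos (2 * pi * real (Suc N) * x) * sin (pi * x)"
    using Suc.IH by (simp add: algebra_simps)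
  also have "2 * cos (2 * pi * real (Suc N) * x) * sin (pi * x) =
      sin (2 * pi * real (Suc N) * x + pi * x) - sin (2 * pi * real (Suc N) * x - pi * x)"
    by (simp add: sin_add sin_diff)
  also have "2 * pi * real (Suc N) * x - pi * x = (2 * real N + 1) * pi * x"
    by (simp add: algebra_simps)
  also have "2 * pi * real (Suc N) * x + pi * x = (2 * real (Suc N) + 1) * pi * x"
    by (simp add: algebra_simps)
  finally show ?case by simp
qed (simp add: mult.commute)

text \<open>The expected sum of the Fourier series inside the unit interval, normalised so that
  differentiation lowers m with the factor 2 pi, exactly as for \<open>fourier_term\<close>.\<close>

definition bernoulli_fourier_value :: "nat \<Rightarrow> real \<Rightarrow> real" where
  "bernoulli_fourier_value m x = - ((2 * pi) ^ m / (2 * fact m)) * bernoulli_poly m x"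

text \<open>The phase m pi / 2 merges the cosine series for even m and the sine series for odd m.
  The index is shifted: term n is the harmonic n + 1.\<close>

definition fourier_term :: "nat \<Rightarrow> nat \<Rightarrow> real \<Rightarrow> real" where
  "fourier_term m n x = cos (2 * pi * real (Suc n) * x - real m * pi / 2) / real (Suc n) ^ m"

lemma fourier_term_deriv:
  "(fourier_term (Suc m) n has_real_derivative 2 * pi * fourier_term m n x) (at x within S)"
proof -
  have "cos (2 * pi * real (Suc n) * x - real m * pi / 2) = - sin (2 * pi * real (Suc n) * x - real (Suc m) * pi / 2)"
  proof -
    have "2 * pi * real (Suc n) * x - real m * pi / 2 = (2 * pi * real (Suc n) * x - real (Suc m) * pi / 2) + pi / 2"
      by (simp add: algebra_simps add_divide_distrib)
    then show ?thesis by (simp only: cos_add) simp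
  qed
  moreover have "((\<lambda>x. cos (2 * pi * r * x - b) / r ^ Suc m) has_real_derivative
      2 * pi * (- sin (2 * pi * r * x - b) / r ^ m)) (at x within S)" if "r \<noteq> 0" for r b
    using that by (auto intro!: derivative_eq_intros)
  ultimately show ?thesis
    unfolding fourier_term_def by (simp del: of_nat_Suc)
qed

lemma fourier_value_deriv:
  "(bernoulli_fourier_value (Suc m) has_real_derivative 2 * pi * bernoulli_fourier_value m x) (at x within S)"
proof -
  have "((\<lambda>x. - ((2 * pi) ^ Suc m / (2 * fact (Suc m))) * bernoulli_poly (Suc m) x) has_real_derivative
    - ((2 * pi) ^ Suc m / (2 * fact (Suc m))) * (real (Suc m) * bernoulli_poly m x)) (at x within S)"
    by (intro DERIV_cmult has_field_derivative_bernoulli_poly)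
  moreover have "bernoulli_fourier_value (Suc m) = (\<lambda>x. - ((2 * pi) ^ Suc m / (2 * fact (Suc m))) * bernoulli_poly (Suc m) x)"
    by (auto simp: bernoulli_fourier_value_def)
  moreover have "- ((2 * pi) ^ Suc m / (2 * fact (Suc m))) * (real (Suc m) * bernoulli_poly m x) = 2 * pi * bernoulli_fourier_value m x"
    by (simp add: bernoulli_fourier_value_def divide_simps)
  ultimately show ?thesis by simp
qed

text \<open>By the formula for the Dirichlet kernel, the function \<open>H\<close> in the proof, which vanishes at
  \<open>1/2\<close>, has a derivative of size \<open>O(1/N)\<close> away from the integers.\<close>

lemma sawtooth_bound:
  fixes x \<delta> :: real
  assumes \<delta>: "0 < \<delta>" "\<delta> < 1/2" and x: "x \<in> {\<delta>..1-\<delta>}"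
  shows "\<bar>(\<Sum>n<N. fourier_term 1 n x) - bernoulli_fourier_value 1 x\<bar> \<le>
    (2 * pi / (2 * sin (pi * \<delta>) ^ 2) + 1 / sin (pi * \<delta>)) / (2 * real N + 1)"
proof -
  define s where "s = sin (pi * \<delta>)"
  define K where "K = 2 * real N + 1"
  have K: "K > 0" by (simp add: K_def)
  have s: "s > 0" unfolding s_def using \<delta> by (intro sin_gt_zero) (auto simp: mult_less_cancel_left1)
  have sin_ge: "sin (pi * t) \<ge> s" if "t \<in> {\<delta>..1-\<delta>}" for t
  proof (cases "t \<le> 1/2")
    case True
    then show ?thesis unfolding s_def using that \<delta>
      by (intro sin_monotone_2pi_le) (auto intro: order_trans[of _ 0])
  next
    case False
    have "sin (pi * t) = sin (pi * (1 - t))" by (simp add: right_diff_distrib sin_diff)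
    also have "\<dots> \<ge> s" unfolding s_def using that \<delta> False
      by (intro sin_monotone_2pi_le) (auto intro: order_trans[of _ 0])
    finally show ?thesis .
  qed
  \<comment> \<open>The linear part is minus the expected sum. The last part is chosen to cancel the
    derivative pi sin(K pi t) / sin(pi t) of the first two, leaving only \<open>H'\<close>, which
    has a factor 1/K.\<close>
  define H where "H t = (\<Sum>n<N. fourier_term 1 n t) + pi * (t - 1/2) + cos (K * pi * t) / (K * sin (pi * t))" for t
  define H' where "H' t = - (pi * cos (K * pi * t) * cos (pi * t) / (K * sin (pi * t) ^ 2))" for t
  have ft: "fourier_term 0 n t = cos (2 * pi * real (Suc n) * t)" for n t
    by (simp add: fourier_term_def)
  have der: "(H has_real_derivative H' t) (at t within {\<delta>..1-\<delta>})" if "t \<in> {\<delta>..1-\<delta>}" for t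
  proof -
    have nz: "sin (pi * t) \<noteq> 0" using sin_ge[OF that] s by auto
    have D: "2 * pi * (\<Sum>n<N. fourier_term 0 n t) + pi = pi * sin (K * pi * t) / sin (pi * t)"
    proof -
      have "2 * pi * S + pi = pi * (sin (pi * t) * (2 * S + 1)) / sin (pi * t)" for S
        using nz by (simp add: field_simps)
      then show ?thesis unfolding K_def dirichlet_kernel[symmetric] ft .
    qed
    define G where "G t = (\<Sum>n<N. fourier_term 1 n t)" for t
    have DG: "((\<lambda>t. \<Sum>n<N. fourier_term 1 n t) has_real_derivative (\<Sum>n<N. 2 * pi * fourier_term 0 n t)) (at t within {\<delta>..1-\<delta>})"
      using fourier_term_deriv[of 0] by (intro DERIV_sum) auto
    have "(H has_real_derivative (\<Sum>n<N. 2 * pi * fourier_term 0 n t) + pi +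
       (- (sin (K * pi * t) * (K * pi)) * (K * sin (pi * t)) - cos (K * pi * t) * (K * (cos (pi * t) * pi))) /
          ((K * sin (pi * t)) * (K * sin (pi * t)))) (at t within {\<delta>..1-\<delta>})"
      unfolding H_def G_def[symmetric] using nz K
      by (auto intro!: derivative_eq_intros DG[folded G_def])
    moreover have "(\<Sum>n<N. 2 * pi * fourier_term 0 n t) + pi +
       (- (sin (K * pi * t) * (K * pi)) * (K * sin (pi * t)) - cos (K * pi * t) * (K * (cos (pi * t) * pi))) /
          ((K * sin (pi * t)) * (K * sin (pi * t))) = H' t"
      unfolding sum_distrib_left[symmetric] D H'_def using nz K
      by (simp add: divide_simps power2_eq_square)
    ultimately show ?thesis by simp
  qed
  have bound: "norm (H' t) \<le> pi / (K * s ^ 2)" if "t \<in> {\<delta>..1-\<delta>}" for t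
  proof -
    have "s ^ 2 \<le> sin (pi * t) ^ 2" using sin_ge[OF that] s by (intro power_mono) auto
    moreover have "\<bar>cos (K * pi * t) * cos (pi * t)\<bar> \<le> 1 * 1"
      unfolding abs_mult by (intro mult_mono) auto
    ultimately have "pi * \<bar>cos (K * pi * t) * cos (pi * t)\<bar> / (K * sin (pi * t) ^ 2) \<le> pi * 1 / (K * s ^ 2)"
      using K s by (intro frac_le mult_left_mono mult_pos_pos) auto
    then show ?thesis using K by (simp add: H'_def abs_mult)
  qed
  have "H (1/2) = 0"
  proof -
    have "cos (2 * pi * real (Suc n) * (1/2) - real 1 * pi / 2) = 0" for n
      using sin_npi[of "Suc n"] by (simp add: cos_diff mult.commute)
    then have "fourier_term 1 n (1/2) = 0" for n by (simp add: fourier_term_def)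
    moreover have "cos (K * pi * (1/2)) = 0"
    proof -
      have "K * pi * (1/2) = real N * pi + pi / 2" by (simp add: K_def field_simps)
      then show ?thesis by (simp only: cos_add) simp
    qed
    ultimately show ?thesis by (simp add: H_def)
  qed
  moreover have "norm (H x - H (1/2)) \<le> pi / (K * s ^ 2) * norm (x - 1/2)"
    by (rule field_differentiable_bound[of "{\<delta>..1-\<delta>}" H H']) (use der bound x \<delta> in auto)
  moreover have "pi / (K * s ^ 2) * norm (x - 1/2) \<le> pi / (K * s ^ 2) * 1"
    using x \<delta> K by (intro mult_left_mono) auto
  ultimately have "\<bar>H x\<bar> \<le> pi / (K * s ^ 2)" by simp
  moreover have "\<bar>cos (K * pi * x) / (K * sin (pi * x))\<bar> \<le> 1 / (K * s)"
    unfolding abs_divide abs_mult using sin_ge[OF x] s K by (intro frac_le mult_mono) auto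
  moreover have "(\<Sum>n<N. fourier_term 1 n x) - bernoulli_fourier_value 1 x = H x - cos (K * pi * x) / (K * sin (pi * x))"
    by (simp add: H_def bernoulli_fourier_value_def bernoulli_poly_low[unfolded One_nat_def] algebra_simps)
  ultimately have "\<bar>(\<Sum>n<N. fourier_term 1 n x) - bernoulli_fourier_value 1 x\<bar> \<le> pi / (K * s ^ 2) + 1 / (K * s)"
    by linarith
  also have "\<dots> = (2 * pi / (2 * s ^ 2) + 1 / s) / K"
    using K s by (simp add: field_simps)
  finally show ?thesis by (simp add: s_def K_def)
qed

lemma uniform_limit_sawtooth:
  assumes \<delta>: "0 < \<delta>" "\<delta> < 1/2"
  shows "uniform_limit {\<delta>..1-\<delta>} (\<lambda>N x. \<Sum>n<N. fourier_term 1 n x) (bernoulli_fourier_value 1) sequentially"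
proof (rule uniform_limitI)
  fix e :: real assume "e > 0"
  define C where "C = 2 * pi / (2 * sin (pi * \<delta>) ^ 2) + 1 / sin (pi * \<delta>)"
  have "(\<lambda>N. C / (2 * real N + 1)) \<longlonglongrightarrow> 0" by real_asymp
  then have "\<forall>\<^sub>F N in sequentially. C / (2 * real N + 1) < e"
    using \<open>e > 0\<close> order_tendstoD(2) by blast
  then show "\<forall>\<^sub>F N in sequentially. \<forall>x\<in>{\<delta>..1-\<delta>}. dist (\<Sum>n<N. fourier_term 1 n x) (bernoulli_fourier_value 1 x) < e"
  proof (rule eventually_mono)
    fix N assume "C / (2 * real N + 1) < e"
    then show "\<forall>x\<in>{\<delta>..1-\<delta>}. dist (\<Sum>n<N. fourier_term 1 n x) (bernoulli_fourier_value 1 x) < e"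
      using sawtooth_bound[OF \<delta>, of _ N] unfolding C_def dist_real_def by (meson le_less_trans)
  qed
qed

lemma uniform_limit_fourier_abs:
  assumes "m \<ge> 2"
  shows "uniform_limit A (\<lambda>N x. \<Sum>n<N. fourier_term m n x) (\<lambda>x. \<Sum>n. fourier_term m n x) sequentially"
proof (rule Weierstrass_m_test)
  show "norm (fourier_term m n x) \<le> inverse (real (Suc n) ^ m)" for n x
    by (simp add: fourier_term_def divide_simps del: of_nat_Suc)
  have "summable (\<lambda>n. inverse (real n ^ m))"
    using inverse_power_summable[OF assms, where 'a = real] by simp
  then show "summable (\<lambda>n. inverse (real (Suc n) ^ m))"
    by (subst summable_Suc_iff)
qed

lemma sums_fourier_term:
  assumes "m \<ge> 2"
  shows "(\<lambda>n. fourier_term m n x) sums (\<Sum>n. fourier_term m n x)"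
  using tendsto_uniform_limitI[OF uniform_limit_fourier_abs[OF assms, of UNIV], of x] by (simp add: sums_def)

text \<open>Between 0 and 1/2 the odd harmonics cancel and the even ones double. With
  \<open>fourier_value_half\<close>, the same relation for Bernoulli polynomials, it fixes the
  constant of integration in the next induction.\<close>

lemma fourier_sum_half:
  assumes "m \<ge> 2"
  shows "(\<Sum>n. fourier_term m n 0) + (\<Sum>n. fourier_term m n (1/2)) = 2 / 2 ^ m * (\<Sum>n. fourier_term m n 0)"
proof -
  have "(\<lambda>n. fourier_term m n 0 + fourier_term m n (1/2)) sums
      ((\<Sum>n. fourier_term m n 0) + (\<Sum>n. fourier_term m n (1/2)))"
    by (intro sums_add sums_fourier_term[OF assms])
  moreover have "(\<lambda>n. fourier_term m n 0 + fourier_term m n (1/2)) sums (2 / 2 ^ m * (\<Sum>n. fourier_term m n 0))"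
  proof (rule sums_mono_reindex[of "\<lambda>k. 2 * k + 1", THEN iffD1])
    show "strict_mono (\<lambda>k::nat. 2 * k + 1)" by (simp add: strict_mono_def)
    have half: "cos (2 * pi * real (Suc n) * (1/2) - real m * pi / 2) = (-1) ^ Suc n * cos (real m * pi / 2)" for n
    proof -
      have "2 * pi * real (Suc n) * (1/2) = real (Suc n) * pi" by simp
      then show ?thesis by (simp only: cos_diff cos_npi sin_npi)
    qed
    have z: "fourier_term m n 0 = cos (real m * pi / 2) / real (Suc n) ^ m" for n
      by (simp add: fourier_term_def)
    show "fourier_term m n 0 + fourier_term m n (1/2) = 0" if "n \<notin> range (\<lambda>k::nat. 2 * k + 1)" for n
    proof -
      have "even n" using that by (metis oddE rangeI)
      then show ?thesis unfolding z unfolding fourier_term_def half by simp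
    qed
    have "fourier_term m (2 * k + 1) 0 + fourier_term m (2 * k + 1) (1/2) = 2 / 2 ^ m * fourier_term m k 0" for k
    proof -
      have "real (Suc (2 * k + 1)) = 2 * real (Suc k)" by simp
      then show ?thesis unfolding z unfolding fourier_term_def half
        by (simp add: power_mult_distrib del: of_nat_Suc)
    qed
    then show "(\<lambda>k. fourier_term m (2 * k + 1) 0 + fourier_term m (2 * k + 1) (1/2)) sums (2 / 2 ^ m * (\<Sum>n. fourier_term m n 0))"
      using sums_mult[OF sums_fourier_term[OF assms, of 0], of "2 / 2 ^ m"] by simp
  qed
  ultimately show ?thesis by (rule sums_unique2)
qed

lemma fourier_value_half:
  assumes "m \<ge> 2"
  shows "bernoulli_fourier_value m 0 + bernoulli_fourier_value m (1/2) = 2 / 2 ^ m * bernoulli_fourier_value m 0"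
proof -
  have "frac (1/2 :: real) = 1/2" by (simp add: frac_eq)
  then have "bernoulli_poly m 0 + bernoulli_poly m (1/2) = 2 / 2 ^ m * bernoulli_poly m 0"
    using bernoulli_fun_distribution[of 2 m 0] assms by (simp add: numeral_2_eq_2 bernoulli_fun_def)
  then show ?thesis
    unfolding bernoulli_fourier_value_def distrib_left[symmetric] by simp
qed

text \<open>Induction by termwise differentiation. For m = 1 the series does not converge to this
  polynomial at the end points, so the induction carries uniform convergence on inner intervals;
  equality on the closed interval is claimed from m = 2 on.\<close>

lemma fourier_limit:
  assumes "m \<ge> 1"
  shows "(\<forall>\<delta>. 0 < \<delta> \<longrightarrow> \<delta> < 1/2 \<longrightarrow>
      uniform_limit {\<delta>..1-\<delta>} (\<lambda>N x. \<Sum>n<N. fourier_term m n x) (bernoulli_fourier_value m) sequentially) \<and>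
    (m \<ge> 2 \<longrightarrow> (\<forall>x\<in>{0..1}. (\<Sum>n. fourier_term m n x) = bernoulli_fourier_value m x))"
  using assms
proof (induction m rule: dec_induct)
  case base
  then show ?case using uniform_limit_sawtooth by simp
next
  case (step m)
  define M where "M = Suc m"
  have M: "M \<ge> 2" using step by (simp add: M_def)
  define F where "F x = (\<Sum>n. fourier_term M n x)" for x
  define D where "D x = F x - bernoulli_fourier_value M x" for x
  have F_deriv: "(F has_real_derivative 2 * pi * bernoulli_fourier_value m x) (at x)" if x: "0 < x" "x < 1" for x
  proof -
    define \<delta> where "\<delta> = min x (1 - x) / 2"
    have \<delta>: "0 < \<delta>" "\<delta> < 1/2" "\<delta> < x" "x < 1 - \<delta>" using x by (auto simp: \<delta>_def min_def field_simps)
    have "uniform_limit {\<delta>..1-\<delta>} (\<lambda>N x. \<Sum>n<N. fourier_term m n x) (bernoulli_fourier_value m) sequentially"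
      using step.IH \<delta> by blast
    then have "uniform_limit {\<delta>..1-\<delta>} (\<lambda>N x. 2 * pi * (\<Sum>n<N. fourier_term m n x)) (\<lambda>x. 2 * pi * bernoulli_fourier_value m x) sequentially"
      by (rule bounded_linear.uniform_limit[OF bounded_linear_mult_right])
    then have u: "uniform_limit {\<delta>..1-\<delta>} (\<lambda>N x. \<Sum>n<N. 2 * pi * fourier_term m n x) (\<lambda>x. 2 * pi * bernoulli_fourier_value m x) sequentially"
      by (simp add: sum_distrib_left)
    have "\<exists>g. \<forall>x\<in>{\<delta>..1-\<delta>}. (\<lambda>n. fourier_term M n x) sums g x \<and>
        (g has_real_derivative 2 * pi * bernoulli_fourier_value m x) (at x within {\<delta>..1-\<delta>})"
    proof (rule has_field_derivative_series[OF _ _ u])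
      show "(fourier_term M n has_real_derivative 2 * pi * fourier_term m n x) (at x within {\<delta>..1-\<delta>})" for n x
        unfolding M_def by (rule fourier_term_deriv)
      show "x \<in> {\<delta>..1-\<delta>}" using \<delta> by simp
      show "summable (\<lambda>n. fourier_term M n x)" using sums_fourier_term[OF M] sums_summable by blast
    qed auto
    then obtain g where g: "\<And>x. x \<in> {\<delta>..1-\<delta>} \<Longrightarrow> (\<lambda>n. fourier_term M n x) sums g x"
        "\<And>x. x \<in> {\<delta>..1-\<delta>} \<Longrightarrow> (g has_real_derivative 2 * pi * bernoulli_fourier_value m x) (at x within {\<delta>..1-\<delta>})"
      by blast
    have "(g has_real_derivative 2 * pi * bernoulli_fourier_value m x) (at x within {\<delta><..<1-\<delta>})"
      using g(2)[of x] \<delta> by (auto intro: has_field_derivative_subset)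
    then have "(g has_real_derivative 2 * pi * bernoulli_fourier_value m x) (at x)"
      using \<delta> by (subst (asm) at_within_open) auto
    moreover have "\<forall>\<^sub>F y in nhds x. g y = F y"
      unfolding eventually_nhds
    proof (intro exI[of _ "{\<delta><..<1-\<delta>}"] conjI ballI)
      fix y assume "y \<in> {\<delta><..<1-\<delta>}"
      then have "(\<lambda>n. fourier_term M n y) sums g y" by (intro g(1)) auto
      then show "g y = F y" by (simp add: F_def sums_iff)
    qed (use \<delta> in auto)
    ultimately show ?thesis using DERIV_cong_ev[of x x g F] by simp
  qed
  have cont: "continuous_on {0..1} D"
  proof -
    have "continuous_on {0..1} (fourier_term M n)" for n
      unfolding M_def using fourier_term_deriv by (rule DERIV_continuous_on)
    then have "continuous_on {0..1} F"
      unfolding F_def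
      by (intro uniform_limit_theorem[OF _ uniform_limit_fourier_abs[OF M]] always_eventually allI continuous_on_sum) auto
    moreover have "continuous_on {0..1} (bernoulli_fourier_value M)"
      unfolding M_def using fourier_value_deriv by (rule DERIV_continuous_on)
    ultimately show ?thesis unfolding D_def by (intro continuous_on_diff)
  qed
  have const: "D x = D 0" if "0 \<le> x" "x \<le> 1" for x
  proof (rule DERIV_isconst2[OF _ cont])
    fix y :: real assume y: "0 < y" "y < 1"
    have "(D has_real_derivative 2 * pi * bernoulli_fourier_value m y - 2 * pi * bernoulli_fourier_value m y) (at y)"
      unfolding D_def M_def
      by (intro DERIV_diff F_deriv[unfolded M_def] fourier_value_deriv y)
    then show "(D has_real_derivative 0) (at y)" by simp
  qed (use that in auto)
  \<comment> \<open>The difference D is constant, and the duplication relation forces 2 D = (2 /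
    2^M) D, hence D = 0, without any zeta value.\<close>
  have "D 0 + D (1/2) = 2 / 2 ^ M * D 0"
    using fourier_sum_half[OF M] fourier_value_half[OF M] by (simp add: D_def F_def algebra_simps)
  then have "2 * D 0 * (1 - 1 / 2 ^ M) = 0" using const[of "1/2"] by (simp add: algebra_simps)
  moreover have "(1::real) < 2 ^ M" using M by (intro one_less_power) auto
  ultimately have "D 0 = 0" by auto
  then have FV: "F x = bernoulli_fourier_value M x" if "x \<in> {0..1}" for x
    using const[of x] that by (simp add: D_def)
  show ?case
    unfolding M_def[symmetric]
  proof (intro conjI allI impI ballI)
    fix \<delta> :: real assume \<delta>: "0 < \<delta>" "\<delta> < 1/2"
    have "uniform_limit {\<delta>..1-\<delta>} (\<lambda>N x. \<Sum>n<N. fourier_term M n x) F sequentially"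
      unfolding F_def by (rule uniform_limit_fourier_abs[OF M])
    then show "uniform_limit {\<delta>..1-\<delta>} (\<lambda>N x. \<Sum>n<N. fourier_term M n x) (bernoulli_fourier_value M) sequentially"
      by (rule uniform_limit_cong'[THEN iffD1, rotated 2]) (use FV \<delta> in auto)
  qed (use FV in \<open>auto simp: F_def\<close>)
qed

theorem bernoulli_fun_fourier:
  assumes "m \<ge> 1"
  shows "(\<lambda>n. fourier_term m n x) sums (- ((2 * pi) ^ m / (2 * fact m)) * bernoulli_fun m x)"
proof -
  have per: "fourier_term m n x = fourier_term m n (frac x)" for n
  proof -
    have "2 * pi * real (Suc n) * x - real m * pi / 2 =
        (2 * pi * real (Suc n) * frac x - real m * pi / 2) + 2 * pi * of_int (int (Suc n) * \<lfloor>x\<rfloor>)"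
      by (simp add: frac_def algebra_simps)
    then show ?thesis
      unfolding fourier_term_def by (simp only: cos_add cos_int_2pin sin_int_2pin) simp
  qed
  have "(\<lambda>n. fourier_term m n (frac x)) sums (- ((2 * pi) ^ m / (2 * fact m)) * bernoulli_fun m x)"
  proof (cases "m = 1 \<and> x \<in> \<int>")
    case True
    then have f0: "frac x = 0" by simp
    have "fourier_term m n (frac x) = 0" for n using True unfolding f0 by (simp add: fourier_term_def)
    then show ?thesis using True by (simp add: bernoulli_fun_def)
  next
    case False
    then have B: "bernoulli_fun m x = bernoulli_poly m (frac x)" using assms by (auto simp: bernoulli_fun_def)
    show ?thesis
    proof (cases "m \<ge> 2")
      case True
      have "(\<Sum>n. fourier_term m n (frac x)) = bernoulli_fourier_value m (frac x)"
        using fourier_limit[OF assms] True frac_lt_1[of x] by (simp add: less_imp_le)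
      then show ?thesis
        using sums_fourier_term[OF True, of "frac x"] by (simp add: bernoulli_fourier_value_def B)
    next
      case m: False
      then have "x \<notin> \<int>" using False assms by auto
      then have fx: "0 < frac x" "frac x < 1" by (simp_all add: frac_lt_1)
      define \<delta> where "\<delta> = min (frac x) (1 - frac x) / 2"
      have \<delta>: "0 < \<delta>" "\<delta> < 1/2" "frac x \<in> {\<delta>..1-\<delta>}" using fx by (auto simp: \<delta>_def min_def field_simps)
      then have "uniform_limit {\<delta>..1-\<delta>} (\<lambda>N x. \<Sum>n<N. fourier_term m n x) (bernoulli_fourier_value m) sequentially"
        using fourier_limit[OF assms] by blast
      from tendsto_uniform_limitI[OF this \<delta>(3)] show ?thesis
        by (simp add: sums_def bernoulli_fourier_value_def B)
    qed
  qed
  then show ?thesis by (simp add: per)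
qed

section \<open>Character sums\<close>

definition bernoulli_dft :: "nat \<Rightarrow> nat \<Rightarrow> nat \<Rightarrow> int \<Rightarrow> complex" where
  "bernoulli_dft q m a r =
     (\<Sum>k<q. unit_root q (- (int k * r)) * of_real (bernoulli_fun m (real a * real k / real q)))"

lemma unit_root_periodic [simp]: "q > 0 \<Longrightarrow> unit_root q (n + int q * k) = unit_root q n"
  by (simp add: unit_root_add)

lemma unit_root_periodic_diff [simp]: "q > 0 \<Longrightarrow> unit_root q (n - int q * k) = unit_root q n"
  using unit_root_periodic[of q n "- k"] by simp

lemma unit_root_cong:
  assumes "q > 0" "[m = n] (mod int q)"
  shows "unit_root q m = unit_root q n"
proof -
  obtain k where "m - n = int q * k" using assms(2) unfolding cong_iff_dvd_diff by (elim dvdE)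
  then have "m = n + int q * k" by simp
  then show ?thesis using assms(1) by simp
qed

lemma bernoulli_fun_periodic_nat:
  assumes "q > 0"
  shows "bernoulli_fun m (real a * of_int (i + int q) / real q) = bernoulli_fun m (real a * of_int i / real q)"
proof -
  have "real a * of_int (i + int q) / real q = real a * of_int i / real q + real a"
    using assms by (simp add: field_simps)
  then show ?thesis by (simp only: bernoulli_fun_add_of_nat)
qed

lemma bernoulli_dft_cong:
  assumes "q > 0" "[r = s] (mod int q)"
  shows "bernoulli_dft q m a r = bernoulli_dft q m a s"
  unfolding bernoulli_dft_def
  by (intro sum.cong refl arg_cong2[where f = "(*)"] unit_root_cong assms)
     (simp add: cong_minus_minus_iff cong_scalar_left assms)

lemma bernoulli_dft_minus:
  assumes "q > 0"
  shows "bernoulli_dft q m a (- r) = (-1) ^ m * bernoulli_dft q m a r"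
proof -
  define g where "g i = unit_root q (- (i * r)) * complex_of_real (bernoulli_fun m (real a * of_int i / real q))" for i
  have per: "g (i + int q) = g i" for i
  proof -
    have "unit_root q (- ((i + int q) * r)) = unit_root q (- (i * r) + int q * (- r))"
      by (simp add: algebra_simps)
    then have "unit_root q (- ((i + int q) * r)) = unit_root q (- (i * r))" using assms by simp
    then show ?thesis unfolding g_def bernoulli_fun_periodic_nat[OF assms] by simp
  qed
  have "bernoulli_dft q m a (- r) = (\<Sum>k<q. (-1) ^ m * g (- int k))"
    unfolding bernoulli_dft_def
  proof (intro sum.cong refl)
    fix k
    have "real a * of_int (- int k) / real q = - (real a * real k / real q)" by simp
    then have "complex_of_real (bernoulli_fun m (real a * of_int (- int k) / real q)) =
        (-1) ^ m * complex_of_real (bernoulli_fun m (real a * real k / real q))"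
      by (simp only: bernoulli_fun_minus) simp
    then show "unit_root q (- (int k * - r)) * complex_of_real (bernoulli_fun m (real a * real k / real q)) =
        (-1) ^ m * g (- int k)"
      by (simp add: g_def flip: mult.assoc power_mult_distrib)
  qed
  also have "\<dots> = (-1) ^ m * (\<Sum>k<q. g (- int k))" by (simp add: sum_distrib_left)
  also have "(\<Sum>k<q. g (- int k)) = (\<Sum>k<q. g (int k))"
    by (rule sum_residues_uminus[of q g, OF assms per])
  finally show ?thesis by (simp add: g_def bernoulli_dft_def)
qed

lemma bernoulli_dft_coprime:
  assumes "q > 0" "coprime a q"
  shows "bernoulli_dft q m a (int a * r) = bernoulli_dft q m 1 r"
proof -
  define g where "g i = unit_root q (- (i * r)) * complex_of_real (bernoulli_fun m (real 1 * of_int i / real q))" for i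
  have per: "g (i + int q) = g i" for i
  proof -
    have "unit_root q (- ((i + int q) * r)) = unit_root q (- (i * r) + int q * (- r))"
      by (simp add: algebra_simps)
    then have "unit_root q (- ((i + int q) * r)) = unit_root q (- (i * r))" using assms by simp
    then show ?thesis unfolding g_def bernoulli_fun_periodic_nat[OF assms(1)] by simp
  qed
  have "bernoulli_dft q m a (int a * r) = (\<Sum>k<q. g (int a * int k))"
    by (simp add: bernoulli_dft_def g_def mult_ac)
  also have "\<dots> = (\<Sum>k<q. g (int k))"
    using sum_residues_coprime[of q g "int a", OF assms(1) per] assms(2) by simp
  finally show ?thesis by (simp add: bernoulli_dft_def g_def)
qed

text \<open>Write the residues modulo d e as k + d t. At the frequency e i the root of unity does
  not see t, and the sum over t is a distribution relation, after permuting t by the unit a.\<close>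

lemma bernoulli_dft_descend:
  assumes "d > 0" "e > 0" "coprime a (d * e)"
  shows "bernoulli_dft (d * e) m a (int (e * i)) = of_nat e / of_nat e ^ m * bernoulli_dft d m a (int i)"
proof -
  define q where "q = d * e"
  have q: "q > 0" using assms by (simp add: q_def)
  have "coprime a e" using assms(3) by simp
  have inner: "(\<Sum>t<e. bernoulli_fun m (real a * real (k + d * t) / real q)) =
      real e / real e ^ m * bernoulli_fun m (real a * real k / real d)" for k
  proof -
    define g where "g j = bernoulli_fun m (real a * real k / real q + of_int j / real e)" for j
    have per: "g (j + int e) = g j" for j
    proof -
      have "real a * real k / real q + of_int (j + int e) / real e =
          (real a * real k / real q + of_int j / real e) + of_int 1"
        using assms by (simp add: field_simps)
      then show ?thesis by (simp only: g_def bernoulli_fun_add_int)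
    qed
    have "(\<Sum>t<e. bernoulli_fun m (real a * real (k + d * t) / real q)) = (\<Sum>t<e. g (int a * int t))"
      using assms by (intro sum.cong refl) (simp add: g_def q_def field_simps)
    also have "\<dots> = (\<Sum>t<e. g (int t))"
      using sum_residues_coprime[of e g "int a", OF assms(2) per] \<open>coprime a e\<close> by simp
    also have "\<dots> = real e / real e ^ m * bernoulli_fun m (real e * (real a * real k / real q))"
      using bernoulli_fun_distribution[OF assms(2), of m "real a * real k / real q"] by (simp add: g_def)
    also have "real e * (real a * real k / real q) = real a * real k / real d"
      using assms by (simp add: q_def)
    finally show ?thesis .
  qed
  have ur: "unit_root q (- (int (k + d * t) * int (e * i))) = unit_root d (- (int k * int i))" for k t
  proof -
    have "- (int (k + d * t) * int (e * i)) = - (int k * int i) * int e + int q * (- (int t * int i))"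
      by (simp add: q_def algebra_simps)
    then have "unit_root q (- (int (k + d * t) * int (e * i))) = unit_root q (- (int k * int i) * int e)"
      using q by simp
    also have "\<dots> = unit_root d (- (int k * int i))"
      using assms by (simp add: unit_root_def q_def mult_ac)
    finally show ?thesis .
  qed
  have "bernoulli_dft q m a (int (e * i)) = (\<Sum>k<d. \<Sum>t<e. unit_root q (- (int (k + d * t) * int (e * i))) *
      of_real (bernoulli_fun m (real a * real (k + d * t) / real q)))"
    unfolding bernoulli_dft_def q_def by (subst sum_residues_split) (rule sum.swap)
  also have "\<dots> = (\<Sum>k<d. unit_root d (- (int k * int i)) *
      of_real (\<Sum>t<e. bernoulli_fun m (real a * real (k + d * t) / real q)))"
    unfolding ur of_real_sum sum_distrib_left ..
  also have "\<dots> = of_nat e / of_nat e ^ m * bernoulli_dft d m a (int i)"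
    unfolding inner bernoulli_dft_def sum_distrib_left by (intro sum.cong refl) (simp add: mult_ac)
  finally show ?thesis by (simp add: q_def)
qed

lemma sum_product3:
  fixes f1 f2 f3 :: "'a \<Rightarrow> 'b :: comm_semiring_0"
  shows "(\<Sum>k\<in>A. f1 k) * (\<Sum>k\<in>A. f2 k) * (\<Sum>k\<in>A. f3 k) =
      (\<Sum>k1\<in>A. \<Sum>k2\<in>A. \<Sum>k3\<in>A. f1 k1 * f2 k2 * f3 k3)"
  by (simp only: sum_distrib_left[symmetric] sum_distrib_right[symmetric])

text \<open>Summation over i detects k1 + k2 + k3 = 0 modulo d; the parity of the third factor then
  yields \<open>(-1) ^ m3\<close>.\<close>

lemma sum_bernoulli_dft_product:
  assumes "d > 0"
  shows "(\<Sum>i<d. bernoulli_dft d m1 a (int i) * bernoulli_dft d m2 b (int i) * bernoulli_dft d m3 c (int i)) =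
    of_nat d * ((-1) ^ m3 * of_real (triple_bernoulli_sum m1 m2 m3 d a b c))"
proof -
  define B1 B2 B3 where "B1 k = complex_of_real (bernoulli_fun m1 (real a * real k / real d))"
    and "B2 k = complex_of_real (bernoulli_fun m2 (real b * real k / real d))"
    and "B3 j = complex_of_real (bernoulli_fun m3 (real c * of_int j / real d))" for k :: nat and j :: int
  have per: "B3 (k + int d) = B3 k" for k
    unfolding B3_def bernoulli_fun_periodic_nat[OF assms] ..
  have "(\<Sum>i<d. bernoulli_dft d m1 a (int i) * bernoulli_dft d m2 b (int i) * bernoulli_dft d m3 c (int i)) =
    (\<Sum>i<d. \<Sum>k1<d. \<Sum>k2<d. \<Sum>k3<d. B1 k1 * B2 k2 * B3 (int k3) * unit_root d (int i * - (int k1 + int k2 + int k3)))"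
    unfolding bernoulli_dft_def sum_product3
  proof (intro sum.cong refl)
    fix i k1 k2 k3
    have "int i * - (int k1 + int k2 + int k3) = - (int k1 * int i) + - (int k2 * int i) + - (int k3 * int i)"
      by (simp add: algebra_simps)
    then have "unit_root d (int i * - (int k1 + int k2 + int k3)) =
        unit_root d (- (int k1 * int i)) * unit_root d (- (int k2 * int i)) * unit_root d (- (int k3 * int i))"
      by (simp only: unit_root_add)
    then show "unit_root d (- (int k1 * int i)) * complex_of_real (bernoulli_fun m1 (real a * real k1 / real d)) *
          (unit_root d (- (int k2 * int i)) * complex_of_real (bernoulli_fun m2 (real b * real k2 / real d))) *
          (unit_root d (- (int k3 * int i)) * complex_of_real (bernoulli_fun m3 (real c * real k3 / real d))) =
        B1 k1 * B2 k2 * B3 (int k3) * unit_root d (int i * - (int k1 + int k2 + int k3))"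
      by (simp add: B1_def B2_def B3_def mult_ac)
  qed
  also have "\<dots> = (\<Sum>k1<d. \<Sum>k2<d. \<Sum>k3<d. B1 k1 * B2 k2 * B3 (int k3) * (\<Sum>i<d. unit_root d (int i * - (int k1 + int k2 + int k3))))"
    unfolding sum_distrib_left
    by (subst sum.swap, rule sum.cong[OF refl], subst sum.swap, rule sum.cong[OF refl], rule sum.swap)
  also have "\<dots> = (\<Sum>k1<d. \<Sum>k2<d. of_nat d * (B1 k1 * B2 k2 * B3 (- int k1 - int k2)))"
  proof (intro sum.cong refl)
    fix k1 k2
    \<comment> \<open>The summand as a function of j = k1 + k2 + k3; after shifting, only j = 0
      passes the divisibility test.\<close>
    define g where "g j = B1 k1 * B2 k2 * (B3 (j - int k1 - int k2) * (if int d dvd j then of_nat d else 0))" for j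
    have perg: "g (j + int d) = g j" for j
    proof -
      have "j + int d - int k1 - int k2 = (j - int k1 - int k2) + int d" by simp
      then have "B3 (j + int d - int k1 - int k2) = B3 (j - int k1 - int k2)" using per by metis
      then show ?thesis by (simp add: g_def)
    qed
    have "(\<Sum>k3<d. B1 k1 * B2 k2 * B3 (int k3) * (\<Sum>i<d. unit_root d (int i * - (int k1 + int k2 + int k3)))) =
       (\<Sum>k3<d. g (int k3 + (int k1 + int k2)))"
      unfolding sum_unit_root[OF assms] dvd_minus_iff
      by (intro sum.cong refl) (simp add: g_def ac_simps)
    also have "\<dots> = (\<Sum>k3<d. g (int k3))"
      by (rule sum_residues_shift[of d g, OF assms perg])
    also have "\<dots> = (\<Sum>k3<d. if k3 = 0 then g 0 else 0)"
      by (intro sum.cong refl) (auto simp: g_def dest: dvd_imp_le)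
    also have "\<dots> = of_nat d * (B1 k1 * B2 k2 * B3 (- int k1 - int k2))"
      using assms by (simp add: g_def)
    finally show "(\<Sum>k3<d. B1 k1 * B2 k2 * B3 (int k3) * (\<Sum>i<d. unit_root d (int i * - (int k1 + int k2 + int k3)))) =
      of_nat d * (B1 k1 * B2 k2 * B3 (- int k1 - int k2))" .
  qed
  also have "\<dots> = of_nat d * ((-1) ^ m3 * of_real (triple_bernoulli_sum m1 m2 m3 d a b c))"
    unfolding triple_bernoulli_sum_def of_real_sum sum_distrib_left
  proof (intro sum.cong refl)
    fix k1 k2
    have "real c * of_int (- int k1 - int k2) / real d = - (real c * (real k2 / real d + real k1 / real d))"
      using assms by (simp add: field_simps)
    then have "B3 (- int k1 - int k2) = (-1) ^ m3 * of_real (bernoulli_fun m3 (real c * (real k2 / real d + real k1 / real d)))"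
      unfolding B3_def by (simp only: bernoulli_fun_minus) simp
    then show "of_nat d * (B1 k1 * B2 k2 * B3 (- int k1 - int k2)) =
      of_nat d * ((-1) ^ m3 * complex_of_real (bernoulli_fun m1 (real a * (real k1 / real d)) *
        (bernoulli_fun m2 (real b * (real k2 / real d)) *
      bernoulli_fun m3 (real c * (real k2 / real d + real k1 / real d)))))"
      by (simp add: B1_def B2_def mult_ac)
  qed
  finally show ?thesis .
qed

definition char_bernoulli_sum :: "nat \<Rightarrow> nat \<Rightarrow> nat \<Rightarrow> (int \<Rightarrow> complex) \<Rightarrow> complex" where
  "char_bernoulli_sum q m a chi = (\<Sum>r<q. chi (int r) * bernoulli_dft q m a (int r))"

text \<open>The substitution of a r for r moves the factor chi(a) into the slope of the Bernoulli
  function, which is how a, b and c become slopes.\<close>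

lemma char_bernoulli_sum_twist:
  assumes "q > 0" "coprime a q" "chi \<in> dchars q"
  shows "chi (int a) * char_bernoulli_sum q m 1 chi = char_bernoulli_sum q m a chi"
proof -
  have per: "chi (r + int q) * bernoulli_dft q m a (r + int q) = chi r * bernoulli_dft q m a r" for r
    using dcharsD(1)[OF assms(3)] bernoulli_dft_cong[OF assms(1), of "r + int q" r] by (simp add: cong_def)
  have "chi (int a) * char_bernoulli_sum q m 1 chi =
      (\<Sum>r<q. chi (int a * int r) * bernoulli_dft q m a (int a * int r))"
    unfolding char_bernoulli_sum_def sum_distrib_left bernoulli_dft_coprime[OF assms(1,2)]
    by (simp add: dcharsD(2)[OF assms(3)] mult.assoc)
  also have "\<dots> = char_bernoulli_sum q m a chi"
    unfolding char_bernoulli_sum_def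
    using sum_residues_coprime[of q "\<lambda>r. chi r * bernoulli_dft q m a r" "int a", OF assms(1) per] assms(2) by simp
  finally show ?thesis .
qed

text \<open>Replacing r by -r multiplies the sum by chi(-1) (-1)^m = -1.\<close>

lemma char_bernoulli_sum_wrong_parity:
  assumes "q > 0" "chi \<in> dchars q" "chi (-1) \<noteq> (-1) ^ m"
  shows "char_bernoulli_sum q m a chi = 0"
proof -
  have "chi (-1) * chi (-1) = 1"
    using dcharsD(2)[OF assms(2), of "-1" "-1"] assms(2) by simp
  then have "chi (-1) = 1 \<or> chi (-1) = -1" by (simp add: square_eq_1_iff)
  then have sgn: "chi (-1) * (-1) ^ m = -1" using assms(3) by (cases "even m") auto
  have per: "chi (r + int q) * bernoulli_dft q m a (r + int q) = chi r * bernoulli_dft q m a r" for r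
    using dcharsD(1)[OF assms(2)] bernoulli_dft_cong[OF assms(1), of "r + int q" r] by (simp add: cong_def)
  have neg: "chi (- int r) = chi (-1) * chi (int r)" for r
    using dcharsD(2)[OF assms(2), of "-1" "int r"] by simp
  have "char_bernoulli_sum q m a chi = (\<Sum>r<q. chi (- int r) * bernoulli_dft q m a (- int r))"
    unfolding char_bernoulli_sum_def
    using sum_residues_uminus[of q "\<lambda>r. chi r * bernoulli_dft q m a r", OF assms(1) per] by simp
  also have "\<dots> = (\<Sum>r<q. (chi (-1) * (-1) ^ m) * (chi (int r) * bernoulli_dft q m a (int r)))"
    unfolding neg bernoulli_dft_minus[OF assms(1)] by (simp only: mult_ac)
  also have "\<dots> = - char_bernoulli_sum q m a chi"
    unfolding sgn char_bernoulli_sum_def by (simp add: sum_negf)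
  finally show ?thesis by simp
qed

text \<open>Plain Fourier inversion modulo q. It treats all characters alike, whereas the usual
  factorisation through a Gauss sum breaks down for imprimitive ones.\<close>

lemma dchars_dft:
  assumes "q > 0" "chi \<in> dchars q"
  shows "of_nat q * chi n = (\<Sum>r<q. \<Sum>k<q. chi (int r) * unit_root q (- (int k * int r)) * unit_root q (int k * n))"
proof -
  have "(\<Sum>r<q. \<Sum>k<q. chi (int r) * unit_root q (- (int k * int r)) * unit_root q (int k * n)) =
      (\<Sum>r<q. chi (int r) * (\<Sum>k<q. unit_root q (int k * (n - int r))))"
    unfolding sum_distrib_left
  proof (intro sum.cong refl)
    fix r k
    have "int k * (n - int r) = - (int k * int r) + int k * n" by (simp add: algebra_simps)
    then show "chi (int r) * unit_root q (- (int k * int r)) * unit_root q (int k * n) = chi (int r) * unit_root q (int k * (n - int r))"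
      by (simp only: unit_root_add mult.assoc)
  qed
  also have "\<dots> = (\<Sum>r<q. if r = nat (n mod int q) then of_nat q * chi n else 0)"
    unfolding sum_unit_root[OF assms(1)]
  proof (intro sum.cong refl)
    fix r assume r: "r \<in> {..<q}"
    have "int q dvd n - int r \<longleftrightarrow> n mod int q = int r mod int q" by (simp add: mod_eq_dvd_iff)
    also have "\<dots> \<longleftrightarrow> r = nat (n mod int q)" using r assms(1) by auto
    finally have iff: "int q dvd n - int r \<longleftrightarrow> r = nat (n mod int q)" .
    have "chi (int r) = chi n" if "r = nat (n mod int q)"
      using dchars_mod[OF assms(2), of n] that assms(1) by simp
    then show "chi (int r) * (if int q dvd n - int r then of_nat q else 0) = (if r = nat (n mod int q) then of_nat q * chi n else 0)"
      unfolding iff by simp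
  qed
  also have "\<dots> = of_nat q * chi n" using assms(1) by (simp add: nat_less_iff)
  finally show ?thesis ..
qed

text \<open>Parity of chi symmetrises n and -n in the inverted transform and leaves exactly the
  Fourier terms of index m. For m = 1 it also excludes the principal character, whose series
  diverges.\<close>

theorem dirichlet_L_value:
  assumes q: "q > 0" and chi: "chi \<in> dchars q" and par: "chi (-1) = (-1) ^ m" and m: "m \<ge> 1"
  shows "dirichlet_L (of_nat m) chi = - ((2 * of_real pi * \<i>) ^ m / (2 * fact m * of_nat q)) * char_bernoulli_sum q m 1 chi"
proof -
  define S where "S n = (\<Sum>r<q. \<Sum>k<q. chi (int r) * unit_root q (- (int k * int r)) * of_real (fourier_term m n (real k / real q)))" for n
  \<comment> \<open>For an angle t this is e^(it) + (-1)^m e^(-it) = 2 i^m cos(t - m pi / 2), from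
    (-1)^m = i^(2m).\<close>
  have trig: "unit_root q (int k * int (Suc n)) + (-1) ^ m * unit_root q (int k * - int (Suc n)) =
      2 * \<i> ^ m * of_real (cos (2 * pi * real (Suc n) * (real k / real q) - real m * pi / 2))" for k n
  proof -
    define \<theta> where "\<theta> = 2 * pi * real (Suc n) * (real k / real q)"
    have u: "unit_root q (int k * int (Suc n)) = cis \<theta>" "unit_root q (int k * - int (Suc n)) = cis (- \<theta>)"
    proof -
      have "2 * pi * of_int (int k * int (Suc n)) / real q = \<theta>" "2 * pi * of_int (int k * - int (Suc n)) / real q = - \<theta>"
        using q by (simp_all add: \<theta>_def field_simps)
      then show "unit_root q (int k * int (Suc n)) = cis \<theta>" "unit_root q (int k * - int (Suc n)) = cis (- \<theta>)"
        unfolding unit_root_def by (simp_all only:)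
    qed
    have i: "\<i> ^ m = cis (real m * pi / 2)"
      using Complex.DeMoivre[of "pi / 2" m] by simp
    have "(-1) ^ m = (\<i> ^ m) * (\<i> ^ m)" by (simp flip: power_mult_distrib)
    also have "\<dots> = cis (real m * pi / 2) * cis (real m * pi / 2)" by (simp only: i)
    finally have neg: "(-1) ^ m = cis (real m * pi / 2) * cis (real m * pi / 2)" .
    have c: "2 * complex_of_real (cos \<phi>) = cis \<phi> + cis (- \<phi>)" for \<phi>
      by (simp add: complex_eq_iff)
    have "2 * \<i> ^ m * of_real (cos (\<theta> - real m * pi / 2)) =
        cis (real m * pi / 2) * (cis (\<theta> - real m * pi / 2) + cis (- (\<theta> - real m * pi / 2)))"
      unfolding c[symmetric] i by simp
    also have "\<dots> = cis \<theta> + (-1) ^ m * cis (- \<theta>)"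
      unfolding neg by (simp add: distrib_left cis_mult)
    finally show ?thesis unfolding u \<theta>_def by simp
  qed
  have "chi (int (Suc n)) * of_nat (Suc n) powr (- of_nat m) = \<i> ^ m / of_nat q * S n" for n
  proof -
    have p: "complex_of_nat (Suc n) powr (- of_nat m) = 1 / of_nat (Suc n) ^ m"
      by (simp add: powr_minus powr_nat' divide_inverse del: of_nat_Suc)
    have "chi (- int (Suc n)) = (-1) ^ m * chi (int (Suc n))"
      using dcharsD(2)[OF chi, of "-1" "int (Suc n)"] par by simp
    then have "2 * chi (int (Suc n)) = chi (int (Suc n)) + (-1) ^ m * chi (- int (Suc n))"
      by (simp flip: mult.assoc power_add)
    then have "of_nat q * (2 * chi (int (Suc n))) = of_nat q * chi (int (Suc n)) + (-1) ^ m * (of_nat q * chi (- int (Suc n)))"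
      by (simp add: distrib_left mult.left_commute)
    also have "\<dots> = (\<Sum>r<q. \<Sum>k<q. chi (int r) * unit_root q (- (int k * int r)) *
        (unit_root q (int k * int (Suc n)) + (-1) ^ m * unit_root q (int k * - int (Suc n))))"
      unfolding dchars_dft[OF q chi] sum_distrib_left sum.distrib[symmetric]
      by (intro sum.cong refl) (simp only: distrib_left mult_ac)
    also have "\<dots> = (\<Sum>r<q. \<Sum>k<q. 2 * \<i> ^ m * of_nat (Suc n) ^ m * (chi (int r) * unit_root q (- (int k * int r)) * of_real (fourier_term m n (real k / real q))))"
      unfolding trig fourier_term_def by (intro sum.cong refl) (simp del: of_nat_Suc)
    also have "\<dots> = 2 * \<i> ^ m * of_nat (Suc n) ^ m * S n"
      by (simp only: S_def sum_distrib_left)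
    finally have "of_nat q * chi (int (Suc n)) = \<i> ^ m * of_nat (Suc n) ^ m * S n" by simp
    then have "chi (int (Suc n)) = \<i> ^ m * of_nat (Suc n) ^ m * S n / of_nat q" using q by (simp add: field_simps)
    then show ?thesis unfolding p by (simp del: of_nat_Suc)
  qed
  moreover have "(\<lambda>n. \<i> ^ m / of_nat q * S n) sums
     (\<i> ^ m / of_nat q * (\<Sum>r<q. \<Sum>k<q. chi (int r) * unit_root q (- (int k * int r)) *
        of_real (- ((2 * pi) ^ m / (2 * fact m)) * bernoulli_fun m (real k / real q))))"
    unfolding S_def
    by (intro sums_mult sums_sum sums_of_real bernoulli_fun_fourier m)
  ultimately have "dirichlet_L (of_nat m) chi = \<i> ^ m / of_nat q * (\<Sum>r<q. \<Sum>k<q. chi (int r) * unit_root q (- (int k * int r)) *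
        of_real (- ((2 * pi) ^ m / (2 * fact m)) * bernoulli_fun m (real k / real q)))"
    unfolding dirichlet_L_def by (simp add: sums_iff)
  also have "(\<Sum>r<q. \<Sum>k<q. chi (int r) * unit_root q (- (int k * int r)) *
        of_real (- ((2 * pi) ^ m / (2 * fact m)) * bernoulli_fun m (real k / real q))) =
     of_real (- ((2 * pi) ^ m / (2 * fact m))) * char_bernoulli_sum q m 1 chi"
    unfolding char_bernoulli_sum_def bernoulli_dft_def sum_distrib_left
    by (intro sum.cong refl) (simp add: mult_ac)
  finally show ?thesis by (simp add: power_mult_distrib mult_ac)
qed

text \<open>At multiples of e = q/d the three transforms descend to the modulus d, with total factor
  e^3 / e^M for M = m1 + m2 + m3. With the factor d from the triple sum and q = d e, this becomes
  q^3 / q^M times d^(M-2).\<close>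

lemma sum_coprime_bernoulli_dft:
  assumes q: "q > 0" and cop: "coprime a q" "coprime b q" "coprime c q" and M: "m1 + m2 + m3 \<ge> 3"
  shows "(\<Sum>r | r < q \<and> coprime r q. bernoulli_dft q m1 a (int r) * bernoulli_dft q m2 b (int r) * bernoulli_dft q m3 c (int r)) =
    (-1) ^ m3 * of_nat q ^ 3 / of_nat q ^ (m1 + m2 + m3) *
      (\<Sum>d | d dvd q. of_int (moebius (q div d)) *
         of_real (real d ^ (m1 + m2 + m3 - 2) * triple_bernoulli_sum m1 m2 m3 d a b c))"
  unfolding sum_coprime_residues[OF q] sum_distrib_left[where A = "{d. d dvd q}"]
proof (rule sum.cong[OF refl])
  fix d assume "d \<in> {d. d dvd q}"
  then obtain e where qde: "q = d * e" by auto
  have d: "d > 0" and e: "e > 0" using q qde by auto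
  have e': "q div d = e" using qde d by simp
  define M where "M = m1 + m2 + m3"
  let ?T = "complex_of_real (triple_bernoulli_sum m1 m2 m3 d a b c)"
  have D: "bernoulli_dft q m x (int (e * i)) = of_nat e / of_nat e ^ m * bernoulli_dft d m x (int i)" if "coprime x q" for m x i
    using bernoulli_dft_descend[OF d e, of x m i] that by (simp add: qde)
  have "(\<Sum>i<d. bernoulli_dft q m1 a (int (e * i)) * bernoulli_dft q m2 b (int (e * i)) * bernoulli_dft q m3 c (int (e * i))) =
     of_nat e ^ 3 / of_nat e ^ M * (\<Sum>i<d. bernoulli_dft d m1 a (int i) * bernoulli_dft d m2 b (int i) * bernoulli_dft d m3 c (int i))"
    unfolding D[OF cop(1)] D[OF cop(2)] D[OF cop(3)] sum_distrib_left
    by (intro sum.cong refl) (simp add: M_def power_add power3_eq_cube)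
  also have "\<dots> = of_nat e ^ 3 / of_nat e ^ M * (of_nat d * ((-1) ^ m3 * ?T))"
    by (simp only: sum_bernoulli_dft_product[OF d])
  also have "\<dots> = (-1) ^ m3 * (of_nat e ^ 3 / of_nat e ^ M * of_nat d) * ?T"
    by simp
  also have "of_nat e ^ 3 / of_nat e ^ M * of_nat d = of_nat q ^ 3 / of_nat q ^ M * (of_nat d ^ (M - 2) :: complex)"
  proof -
    have "M = Suc (Suc (M - 2))" using M by (simp add: M_def)
    then have "(of_nat d :: complex) ^ M = of_nat d * of_nat d * of_nat d ^ (M - 2)"
      by (metis power_Suc mult.assoc)
    then show ?thesis using d e
      by (simp add: qde power_mult_distrib power3_eq_cube)
  qed
  finally show "of_int (moebius (q div d)) * (\<Sum>i<d. bernoulli_dft q m1 a (int (q div d * i)) *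
        bernoulli_dft q m2 b (int (q div d * i)) * bernoulli_dft q m3 c (int (q div d * i))) =
     (-1) ^ m3 * of_nat q ^ 3 / of_nat q ^ (m1 + m2 + m3) * (of_int (moebius (q div d)) *
         complex_of_real (real d ^ (m1 + m2 + m3 - 2) * triple_bernoulli_sum m1 m2 m3 d a b c))"
    unfolding e' M_def by (simp add: mult_ac)
qed

lemma cnj_dchars:
  assumes "chi1 \<in> dchars q" "chi2 \<in> dchars q"
  shows "(\<lambda>n. cnj (chi1 n * chi2 n)) \<in> dchars q"
  using assms by (auto simp: dchars_def)

text \<open>Once r3 is fixed the two character sums separate, and orthogonality forces r1 = r3 and
  r2 = r3. Residues r3 not coprime to q drop out because the conjugated characters vanish
  there.\<close>

lemma sum_dchars_triple:
  assumes q: "q \<ge> 2"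
  shows "(\<Sum>chi1\<in>dchars q. \<Sum>chi2\<in>dchars q. char_bernoulli_sum q m1 a chi1 * char_bernoulli_sum q m2 b chi2 *
      char_bernoulli_sum q m3 c (\<lambda>n. cnj (chi1 n * chi2 n))) =
    of_nat (totient q) ^ 2 * (\<Sum>r | r < q \<and> coprime r q. bernoulli_dft q m1 a (int r) * bernoulli_dft q m2 b (int r) * bernoulli_dft q m3 c (int r))"
proof -
  define f1 f2 f3 where "f1 r = bernoulli_dft q m1 a (int r)" and "f2 r = bernoulli_dft q m2 b (int r)"
    and "f3 r = bernoulli_dft q m3 c (int r)" for r
  let ?D = "dchars q"
  have swap1: "(\<Sum>chi\<in>?D. \<Sum>s<q. f s * g chi s) = (\<Sum>s<q. f s * (\<Sum>chi\<in>?D. g chi s))"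
    for f and g :: "(int \<Rightarrow> complex) \<Rightarrow> nat \<Rightarrow> complex"
    unfolding sum_distrib_left by (rule sum.swap)
  have swap3: "(\<Sum>chi1\<in>?D. \<Sum>chi2\<in>?D. \<Sum>r<q. f r * X chi1 r * Y chi2 r) =
      (\<Sum>r<q. f r * (\<Sum>chi\<in>?D. X chi r) * (\<Sum>chi\<in>?D. Y chi r))"
    for f and X Y :: "(int \<Rightarrow> complex) \<Rightarrow> nat \<Rightarrow> complex"
  proof -
    have "(\<Sum>chi1\<in>?D. \<Sum>chi2\<in>?D. \<Sum>r<q. f r * X chi1 r * Y chi2 r) =
        (\<Sum>chi1\<in>?D. \<Sum>r<q. \<Sum>chi2\<in>?D. f r * X chi1 r * Y chi2 r)"
      by (rule sum.cong[OF refl], rule sum.swap)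
    also have "\<dots> = (\<Sum>r<q. \<Sum>chi1\<in>?D. \<Sum>chi2\<in>?D. f r * X chi1 r * Y chi2 r)"
      by (rule sum.swap)
    also have "\<dots> = (\<Sum>r<q. f r * (\<Sum>chi\<in>?D. X chi r) * (\<Sum>chi\<in>?D. Y chi r))"
      by (simp only: sum_distrib_left[symmetric] sum_distrib_right[symmetric])
    finally show ?thesis .
  qed
  have tw: "(\<Sum>r<q. u r * f r) * w = (\<Sum>r<q. f r * (u r * w))" for u f :: "nat \<Rightarrow> complex" and w
    unfolding sum_distrib_right by (simp only: mult_ac)
  have orth: "(\<Sum>chi\<in>?D. chi (int s) * cnj (chi (int r))) = (if s = r then of_nat (totient q) else 0)"
    if "coprime r q" "r < q" "s < q" for r s
  proof -
    have "[int s = int r] (mod int q) \<longleftrightarrow> s = r"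
      unfolding cong_int_iff cong_def using that by simp
    then show ?thesis using dchars_orthogonality[OF q, of "int r" "int s"] that by simp
  qed
  have pick: "(\<Sum>s<q. f s * (\<Sum>chi\<in>?D. chi (int s) * cnj (chi (int r)))) = of_nat (totient q) * f r"
    if "coprime r q" "r < q" for r and f :: "nat \<Rightarrow> complex"
  proof -
    have "(\<Sum>s<q. f s * (\<Sum>chi\<in>?D. chi (int s) * cnj (chi (int r)))) = (\<Sum>s<q. if s = r then of_nat (totient q) * f r else 0)"
      using that by (intro sum.cong refl) (auto simp: orth)
    then show ?thesis using that by simp
  qed
  have "(\<Sum>chi1\<in>?D. \<Sum>chi2\<in>?D. char_bernoulli_sum q m1 a chi1 * char_bernoulli_sum q m2 b chi2 *
      char_bernoulli_sum q m3 c (\<lambda>n. cnj (chi1 n * chi2 n))) =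
    (\<Sum>chi1\<in>?D. \<Sum>chi2\<in>?D. \<Sum>r3<q. f3 r3 * (\<Sum>r1<q. f1 r1 * (chi1 (int r1) * cnj (chi1 (int r3)))) *
       (\<Sum>r2<q. f2 r2 * (chi2 (int r2) * cnj (chi2 (int r3)))))"
  proof (intro sum.cong refl)
    fix chi1 chi2
    have "char_bernoulli_sum q m1 a chi1 * char_bernoulli_sum q m2 b chi2 * char_bernoulli_sum q m3 c (\<lambda>n. cnj (chi1 n * chi2 n)) =
      (\<Sum>r3<q. (\<Sum>r1<q. chi1 (int r1) * f1 r1) * (\<Sum>r2<q. chi2 (int r2) * f2 r2) * (cnj (chi1 (int r3) * chi2 (int r3)) * f3 r3))"
      unfolding char_bernoulli_sum_def f1_def f2_def f3_def by (simp only: sum_distrib_left)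
    also have "\<dots> = (\<Sum>r3<q. f3 r3 * ((\<Sum>r1<q. chi1 (int r1) * f1 r1) * cnj (chi1 (int r3))) * ((\<Sum>r2<q. chi2 (int r2) * f2 r2) * cnj (chi2 (int r3))))"
      by (intro sum.cong refl) (simp add: mult_ac)
    also have "\<dots> = (\<Sum>r3<q. f3 r3 * (\<Sum>r1<q. f1 r1 * (chi1 (int r1) * cnj (chi1 (int r3)))) *
       (\<Sum>r2<q. f2 r2 * (chi2 (int r2) * cnj (chi2 (int r3)))))"
      by (simp only: tw)
    finally show "char_bernoulli_sum q m1 a chi1 * char_bernoulli_sum q m2 b chi2 * char_bernoulli_sum q m3 c (\<lambda>n. cnj (chi1 n * chi2 n)) =
      (\<Sum>r3<q. f3 r3 * (\<Sum>r1<q. f1 r1 * (chi1 (int r1) * cnj (chi1 (int r3)))) *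
       (\<Sum>r2<q. f2 r2 * (chi2 (int r2) * cnj (chi2 (int r3)))))" .
  qed
  also have "\<dots> = (\<Sum>r3<q. f3 r3 * (\<Sum>chi1\<in>?D. \<Sum>r1<q. f1 r1 * (chi1 (int r1) * cnj (chi1 (int r3)))) *
       (\<Sum>chi2\<in>?D. \<Sum>r2<q. f2 r2 * (chi2 (int r2) * cnj (chi2 (int r3)))))"
    by (rule swap3)
  also have "\<dots> = (\<Sum>r3<q. f3 r3 * (\<Sum>r1<q. f1 r1 * (\<Sum>chi\<in>?D. chi (int r1) * cnj (chi (int r3)))) *
       (\<Sum>r2<q. f2 r2 * (\<Sum>chi\<in>?D. chi (int r2) * cnj (chi (int r3)))))"
    by (simp only: swap1)
  also have "\<dots> = (\<Sum>r | r < q \<and> coprime r q. of_nat (totient q) ^ 2 * (f1 r * f2 r * f3 r))"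
  proof (rule sum.mono_neutral_cong_right)
    show "\<forall>r\<in>{..<q} - {r. r < q \<and> coprime r q}. f3 r * (\<Sum>r1<q. f1 r1 * (\<Sum>chi\<in>?D. chi (int r1) * cnj (chi (int r)))) *
       (\<Sum>r2<q. f2 r2 * (\<Sum>chi\<in>?D. chi (int r2) * cnj (chi (int r)))) = 0"
    proof
      fix r assume "r \<in> {..<q} - {r. r < q \<and> coprime r q}"
      then have "\<not> coprime (int r) (int q)" by simp
      then have "chi (int r) = 0" if "chi \<in> ?D" for chi using dcharsD(3)[OF that] by blast
      then have "(\<Sum>chi\<in>?D. chi (int s) * cnj (chi (int r))) = 0" for s by (intro sum.neutral) auto
      then show "f3 r * (\<Sum>r1<q. f1 r1 * (\<Sum>chi\<in>?D. chi (int r1) * cnj (chi (int r)))) *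
       (\<Sum>r2<q. f2 r2 * (\<Sum>chi\<in>?D. chi (int r2) * cnj (chi (int r)))) = 0" by simp
    qed
    fix r assume "r \<in> {r. r < q \<and> coprime r q}"
    then show "f3 r * (\<Sum>r1<q. f1 r1 * (\<Sum>chi\<in>?D. chi (int r1) * cnj (chi (int r)))) *
       (\<Sum>r2<q. f2 r2 * (\<Sum>chi\<in>?D. chi (int r2) * cnj (chi (int r)))) = of_nat (totient q) ^ 2 * (f1 r * f2 r * f3 r)"
      by (simp add: pick power2_eq_square)
  qed auto
  finally show ?thesis
    by (simp add: sum_distrib_left f1_def f2_def f3_def)
qed

theorem V_eq_bernoulli_sum:
  assumes q: "q \<ge> 2" and m: "m1 \<ge> 1" "m2 \<ge> 1" "m3 \<ge> 1" and par: "even (m1 + m2 + m3)"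
    and cop: "coprime a q" "coprime b q" "coprime c q"
  shows "V q m1 m2 m3 (int a) (int b) (int c) =
    - ((2 * of_real pi * \<i>) ^ (m1 + m2 + m3) / (8 * fact m1 * fact m2 * fact m3 * of_nat q ^ (m1 + m2 + m3))) *
      (-1) ^ m3 * of_nat (totient q) ^ 2 *
      (\<Sum>d | d dvd q. of_int (moebius (q div d)) *
         of_real (real d ^ (m1 + m2 + m3 - 2) * triple_bernoulli_sum m1 m2 m3 d a b c))"
proof -
  have q0: "q > 0" using q by simp
  define K where "K m = - ((2 * of_real pi * \<i>) ^ m / (2 * fact m * of_nat q))" for m :: nat
  let ?D = "dchars q"
  let ?P = "\<lambda>m. {chi \<in> dchars q. chi (-1) = (-1) ^ m}"
  define W where "W chi1 chi2 = char_bernoulli_sum q m1 a chi1 * char_bernoulli_sum q m2 b chi2 *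
      char_bernoulli_sum q m3 c (\<lambda>n. cnj (chi1 n * chi2 n))" for chi1 chi2
  \<comment> \<open>This gives the conjugate product the parity that the value formula at m3
    requires.\<close>
  have sgn: "(-1) ^ m3 = ((-1) ^ m1 * (-1) ^ m2 :: complex)"
  proof -
    have "even (m1 + m2) \<longleftrightarrow> even m3" using par by simp
    then show ?thesis unfolding power_add[symmetric] unfolding minus_one_power_iff by (simp only:)
  qed
  have summand: "chi1 (int a) * chi2 (int b) * cnj (chi1 (int c) * chi2 (int c)) *
        dirichlet_L (of_nat m1) chi1 * dirichlet_L (of_nat m2) chi2 *
        dirichlet_L (of_nat m3) (\<lambda>n. cnj (chi1 n * chi2 n)) = K m1 * K m2 * K m3 * W chi1 chi2"
    if "chi1 \<in> ?P m1" "chi2 \<in> ?P m2" for chi1 chi2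
  proof -
    define psi where "psi n = cnj (chi1 n * chi2 n)" for n :: int
    have psi_eq: "psi = (\<lambda>n. cnj (chi1 n * chi2 n))" by (rule ext) (rule psi_def)
    have "chi1 \<in> ?D" "chi2 \<in> ?D" using that by simp_all
    note D = this cnj_dchars[OF this, folded psi_eq]
    have par': "chi1 (-1) = (-1) ^ m1" "chi2 (-1) = (-1) ^ m2" "psi (-1) = (-1) ^ m3"
      using that by (simp_all add: psi_def sgn)
    have L: "dirichlet_L (of_nat m1) chi1 = K m1 * char_bernoulli_sum q m1 1 chi1"
      "dirichlet_L (of_nat m2) chi2 = K m2 * char_bernoulli_sum q m2 1 chi2"
      "dirichlet_L (of_nat m3) psi = K m3 * char_bernoulli_sum q m3 1 psi"
      unfolding K_def using dirichlet_L_value[OF q0 D(1) par'(1) m(1)]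
        dirichlet_L_value[OF q0 D(2) par'(2) m(2)] dirichlet_L_value[OF q0 D(3) par'(3) m(3)]
      by (simp_all only:)
    have T: "chi1 (int a) * char_bernoulli_sum q m1 1 chi1 = char_bernoulli_sum q m1 a chi1"
      "chi2 (int b) * char_bernoulli_sum q m2 1 chi2 = char_bernoulli_sum q m2 b chi2"
      "psi (int c) * char_bernoulli_sum q m3 1 psi = char_bernoulli_sum q m3 c psi"
      by (rule char_bernoulli_sum_twist[OF q0 cop(1) D(1)] char_bernoulli_sum_twist[OF q0 cop(2) D(2)]
        char_bernoulli_sum_twist[OF q0 cop(3) D(3)])+
    have W_psi: "W chi1 chi2 = char_bernoulli_sum q m1 a chi1 * char_bernoulli_sum q m2 b chi2 * char_bernoulli_sum q m3 c psi"
      unfolding psi_eq by (rule W_def)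
    have "chi1 (int a) * chi2 (int b) * psi (int c) *
        (K m1 * char_bernoulli_sum q m1 1 chi1) * (K m2 * char_bernoulli_sum q m2 1 chi2) * (K m3 * char_bernoulli_sum q m3 1 psi) =
      K m1 * K m2 * K m3 * ((chi1 (int a) * char_bernoulli_sum q m1 1 chi1) * (chi2 (int b) * char_bernoulli_sum q m2 1 chi2) *
        (psi (int c) * char_bernoulli_sum q m3 1 psi))"
      by (simp only: mult_ac)
    also have "\<dots> = K m1 * K m2 * K m3 * W chi1 chi2"
      by (simp only: T W_psi)
    finally show ?thesis
      unfolding L[symmetric] unfolding psi_eq .
  qed
  \<comment> \<open>Allows both sums to be extended to all characters.\<close>
  have W0: "W chi1 chi2 = 0" if "chi1 \<in> ?D" "chi2 \<in> ?D" "chi1 \<notin> ?P m1 \<or> chi2 \<notin> ?P m2" for chi1 chi2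
    using that char_bernoulli_sum_wrong_parity[OF q0] by (auto simp: W_def)
  have "V q m1 m2 m3 (int a) (int b) (int c) = (\<Sum>chi1\<in>?P m1. \<Sum>chi2\<in>?P m2. K m1 * K m2 * K m3 * W chi1 chi2)"
    unfolding V_def by (intro sum.cong refl) (rule summand)
  also have "\<dots> = K m1 * K m2 * K m3 * (\<Sum>chi1\<in>?P m1. \<Sum>chi2\<in>?P m2. W chi1 chi2)"
    by (simp only: sum_distrib_left)
  also have "(\<Sum>chi1\<in>?P m1. \<Sum>chi2\<in>?P m2. W chi1 chi2) = (\<Sum>chi1\<in>?P m1. \<Sum>chi2\<in>?D. W chi1 chi2)"
    using finite_dchars[OF q0] W0 by (intro sum.cong refl sum.mono_neutral_left) auto
  also have "\<dots> = (\<Sum>chi1\<in>?D. \<Sum>chi2\<in>?D. W chi1 chi2)"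
    using finite_dchars[OF q0] W0 by (intro sum.mono_neutral_left) (auto intro!: sum.neutral)
  also have "\<dots> = of_nat (totient q) ^ 2 * (\<Sum>r | r < q \<and> coprime r q. bernoulli_dft q m1 a (int r) * bernoulli_dft q m2 b (int r) * bernoulli_dft q m3 c (int r))"
    unfolding W_def by (rule sum_dchars_triple[OF q])
  also have "(\<Sum>r | r < q \<and> coprime r q. bernoulli_dft q m1 a (int r) * bernoulli_dft q m2 b (int r) * bernoulli_dft q m3 c (int r)) =
    (-1) ^ m3 * of_nat q ^ 3 / of_nat q ^ (m1 + m2 + m3) *
      (\<Sum>d | d dvd q. of_int (moebius (q div d)) *
         of_real (real d ^ (m1 + m2 + m3 - 2) * triple_bernoulli_sum m1 m2 m3 d a b c))"
    using m by (intro sum_coprime_bernoulli_dft q0 cop) simp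
  \<comment> \<open>Each K brings a sign and 1/(2q): hence the leading minus, the 8 and the
    cancellation of q^3.\<close>
  also have "K m1 * K m2 * K m3 * (of_nat (totient q) ^ 2 * ((-1) ^ m3 * of_nat q ^ 3 / of_nat q ^ (m1 + m2 + m3) * X)) =
    - ((2 * of_real pi * \<i>) ^ (m1 + m2 + m3) / (8 * fact m1 * fact m2 * fact m3 * of_nat q ^ (m1 + m2 + m3))) *
      (-1) ^ m3 * of_nat (totient q) ^ 2 * X" for X
    using q0 by (simp add: K_def power_add power3_eq_cube mult_ac)
  finally show ?thesis .
qed

theorem theorem2p4:
  fixes q m1 m2 m3 a b c :: nat
  assumes "q \<ge> 2" and "m1 \<ge> 1" and "m2 \<ge> 1" and "m3 \<ge> 2"
    and "a \<ge> 1" and "b \<ge> 1" and "c \<ge> 1"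
    and "[m1 + m2 = m3] (mod 2)"
    and "gcd a q = 1" and "gcd b q = 1" and "gcd c q = 1"
  shows "V q m1 m2 m3 (int a) (int b) (int c) =
      (-1) powi ((int m1 - int m2 - int m3) div 2) * (2 * of_real pi) ^ (m1 + m2 + m3) *
        of_nat (gcd b c) ^ (m2 + m3) * of_nat (totient q) ^ 2 /
        (8 * of_nat q ^ (m1 + m2 + m3) * of_nat b ^ m3 * of_nat c ^ m2 *
           fact m1 * fact (m2 + m3)) *
        (of_real (R_term m1 (m2 + m3) q a (b * c div gcd b c)) +
         of_real (R_term (m2 + m3) m1 q (b * c div gcd b c) a))
    - (-1) powi ((int m1 + int m2 - int m3) div 2) * (2 * of_real pi) ^ (m1 + m2 + m3) *
        of_nat (totient q) ^ 2 /
        (8 * of_nat q ^ (m1 + m2 + m3) * fact m1 * fact m2 * fact m3) *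
        (of_real (A_term m1 m2 m3 q a b c) + (-1) ^ m1 * of_real (A_term m1 m3 m2 q a c b)
         + of_real (B_term m1 m2 m3 q a b c) + (-1) ^ m1 * of_real (B_term m1 m3 m2 q a c b)
         + of_real (C_term m1 m2 m3 q a b c) + (-1) ^ m1 * of_real (C_term m1 m3 m2 q a c b)
         - of_real (D_term m1 m2 m3 q b c) + of_real (D_term m1 m3 m2 q c b)
         + C2_term m1 m2 m3 q a b c)"
proof -
  define M where "M = m1 + m2 + m3"
  have par: "even (m1 + m2 + m3)" using assms(8) unfolding cong_def by presburger
  then obtain h where h: "m1 + m2 + m3 = 2 * h" by (elim evenE)
  have hi: "int m1 + int m2 + int m3 = 2 * int h" using arg_cong[OF h, of int] by simp
  \<comment> \<open>As m1 + m2 + m3 = 2h, the power of i is \<open>(-1) ^ h\<close>; together with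
    \<open>(-1) ^ m3\<close> it is the sign of the second main term. The exponents h - m3 and h - m2
    - m3 may be negative, hence the integer powers.\<close>
  define s where "s = ((-1) ^ h * (-1) ^ m3 :: complex)"
  have e1: "(-1) powi ((int m1 + int m2 - int m3) div 2) = s"
  proof -
    have "int m1 + int m2 - int m3 = 2 * (int h - int m3)" using hi by simp
    then have "(int m1 + int m2 - int m3) div 2 = int h - int m3" by simp
    then show ?thesis by (simp add: s_def power_int_diff minus_one_power_iff)
  qed
  have e2: "(-1) powi ((int m1 - int m2 - int m3) div 2) = s * (-1) ^ m2"
  proof -
    have "int m1 - int m2 - int m3 = 2 * (int h - int (m2 + m3))" using hi by simp
    then have "(int m1 - int m2 - int m3) div 2 = int h - int (m2 + m3)" by simp
    then have "(-1) powi ((int m1 - int m2 - int m3) div 2) = (-1 :: complex) powi (int h - int (m2 + m3))" by (simp only:)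
    also have "\<dots> = (-1) ^ h / (-1) ^ (m2 + m3)" by (simp add: power_int_diff del: of_nat_add)
    also have "\<dots> = s * (-1) ^ m2" by (simp add: s_def power_add minus_one_power_iff)
    finally show ?thesis .
  qed
  have pow: "(2 * of_real pi * \<i>) ^ (m1 + m2 + m3) * (-1) ^ m3 = (2 * of_real pi) ^ M * s"
    unfolding power_mult_distrib by (simp add: M_def h power_mult s_def)
  have pos: "a > 0" "b > 0" "c > 0" "m3 \<ge> 1" using assms by auto
  have cop: "coprime a q" "coprime b q" "coprime c q" using assms(9-11) by (simp_all only: coprime_iff_gcd_eq_1)
  have V: "V q m1 m2 m3 (int a) (int b) (int c) =
    - ((2 * of_real pi) ^ M * s * of_nat (totient q) ^ 2 / (8 * of_nat q ^ M * fact m1 * fact m2 * fact m3)) *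
      (\<Sum>d | d dvd q. of_int (moebius (q div d)) *
         of_real (real d ^ (m1 + m2 + m3 - 2) * triple_bernoulli_sum m1 m2 m3 d a b c))"
    unfolding V_eq_bernoulli_sum[OF assms(1-3) pos(4) par cop] pow[symmetric] by (simp add: M_def mult_ac)
  \<comment> \<open>The factorials of m2 and m3 cancel in the R part only, which accounts for the
    different denominators of the two main terms.\<close>
  have alg: "- (P * s * t / (8 * Q * f1 * f2 * f3)) * (X - (-1) ^ m2 * (f2 * f3 / f23) * (g / (b' * c')) * Y) =
      s * (-1) ^ m2 * P * g * t / (8 * Q * b' * c' * f1 * f23) * Y - s * P * t / (8 * Q * f1 * f2 * f3) * X"
    if "f2 \<noteq> 0" "f3 \<noteq> 0" for P t Q f1 f2 f3 f23 g b' c' X Y :: complex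
    using that by (simp add: right_diff_distrib mult_ac)
  show ?thesis
    unfolding V moebius_triple_sum[OF pos(1-3) assms(1-4) par cop]
    unfolding e1 e2 M_def[symmetric]
    by (rule alg) simp_all
qed

end
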